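(* Let $m\ge2$ and let $\mathbf{X}^{(n_i)}_{i1},\ldots,\mathbf{X}^{(n_i)}_{in_i}$, $i=1,\ldots,m$, be $m$ independent samples on $\mathcal{S}^{d-1}$, the $i$th one being i.i.d. with distribution $\mathrm{P}_i\in\mathfrak{P}_d$ and directional distribution function $\mathbf{F}_i$. Let $\mathbf{J}:\mathcal{S}^{d-1}\to\mathbb{R}^{d_{\mathbf{J}}}$ be a score function and let $Q^{(n)}_{\mathbf{J}}$ be the rank-based MANOVA statistic associated with $\mathbf{J}$. Assume that (i) $\mathbf{J}$ is continuous over $\mathcal{S}^{d-1}$; (ii) $\mathbf{J}$ is square-integrable, that is, $\int_{\mathcal{S}^{d-1}}\|\mathbf{J}(\mathbf{u})\|^2\,\mathrm{d}\mathrm{P}^{\mathbf{U}}(\mathbf{u})<\infty$; (iii) for any sequence $\mathfrak{G}^{(n)}=\{\mathfrak{G}^{(n)}_1,\ldots,\mathfrak{G}^{(n)}_n\}$ of $n$-tuples in $\mathcal{S}^{d-1}$ such that the uniform discrete distribution over $\mathfrak{G}^{(n)}$ converges weakly to $\mathrm{P}^{\mathbf{U}}$ as $n\to\infty$, $$\lim_{n\to\infty}n^{-1}\sum_{\ell=1}^n\|\mathbf{J}(\mathfrak{G}^{(n)}_\ell)\|^2=\int_{\mathcal{S}^{d-1}}\|\mathbf{J}(\mathbf{u})\|^2\,\mathrm{d}\mathrm{P}^{\mathbf{U}}(\mathbf{u}).$$ Then, under the null hypothesis $\mathcal{H}_0:\mathbf{F}_1=\cdots=\mathbf{F}_m$,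 as $n\to\infty$, $Q^{(n)}_{\mathbf{J}}$ is asymptotically chi-square with $(m-1)d^*$ degrees of freedom, where $d^*$ is the rank of the $d_{\mathbf{J}}\times d_{\mathbf{J}}$ matrix $\mathbf{D}_{\mathbf{J}}$.
   Context: Let $d\ge 2$ and $\mathcal{S}^{d-1}=\{\mathbf{x}\in\mathbb{R}^d:\|\mathbf{x}\|=1\}$, with surface area measure $\lambda^{d-1}$. Let $c(\mathbf{y},\mathbf{z})=\tfrac12 d(\mathbf{y},\mathbf{z})^2$ with $d(\mathbf{y},\mathbf{z})=\arccos(\mathbf{y}^\top\mathbf{z})$. $\mathfrak{P}_d$ is the family of probability measures on $\mathcal{S}^{d-1}$ that are absolutely continuous with respect to $\lambda^{d-1}$ with densities bounded away from zero and infinity; $\mathrm{P}^{\mathbf{U}}$ is the uniform probability measure on $\mathcal{S}^{d-1}$. For $\mathrm{P}\in\mathfrak{P}_d$, the directional distribution function of $\mathrm{P}$ is the $\mathrm{P}$-a.s. unique minimizer of $\int c(\mathbf{z},\mathbf{S}(\mathbf{z}))\,\mathrm{d}\mathrm{P}(\mathbf{z})$ among measurable $\mathbf{S}:\mathcal{S}^{d-1}\to\mathcal{S}^{d-1}$ pushing $\mathrm{P}$ forward to $\mathrm{P}^{\mathbf{U}}$ (taken in its continuous version). Let $n=n_1+\cdots+n_m$; it is assumed that $r^{(n)}_i:=n_i/n$ converges to a constant $0<r_i<1$ as $n\to\infty$. Denote by $\{\mathbf{Y}^{(n)}_1,\ldots,\mathbf{Y}^{(n)}_n\}=\{\mathbf{X}^{(n_1)}_{11},\ldots,\mathbf{X}^{(n_1)}_{1n_1},\ldots,\mathbf{X}^{(n_m)}_{m1},\ldots,\mathbf{X}^{(n_m)}_{mn_m}\}$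 the pooled sample. Given $n$-point grids $\{\mathfrak{g}^{(n)}_1,\ldots,\mathfrak{g}^{(n)}_n\}\subset\mathcal{S}^{d-1}$ whose uniform discrete distributions converge weakly to $\mathrm{P}^{\mathbf{U}}$ as $n\to\infty$, the empirical directional distribution function $\mathbf{F}^{(n)}$ of the pooled sample is a bijection from the pooled sample to the grid satisfying $\sum_{\ell=1}^n c(\mathbf{Y}^{(n)}_\ell,\mathbf{F}^{(n)}(\mathbf{Y}^{(n)}_\ell))=\min_T\sum_{\ell=1}^n c(\mathbf{Y}^{(n)}_\ell,\mathfrak{g}^{(n)}_{T(\ell)})$, the minimum being over permutations $T$ of $\{1,\ldots,n\}$. For a score function $\mathbf{J}:\mathcal{S}^{d-1}\to\mathbb{R}^{d_{\mathbf{J}}}$, let, for $i=1,\ldots,m$, $$\boldsymbol{\Delta}^{(n_i)}_{i;\mathbf{J}}=n_i^{-1/2}\sum_{j=1}^{n_i}\mathbf{J}(\mathbf{F}^{(n)}(\mathbf{X}^{(n_i)}_{ij}))-n^{-1/2}\sum_{\ell=1}^n\frac{n_i^{1/2}}{n^{1/2}}\mathbf{J}(\mathbf{F}^{(n)}(\mathbf{Y}^{(n)}_\ell)),$$ $\boldsymbol{\Delta}^{(n)}_{\mathbf{J}}=((\boldsymbol{\Delta}^{(n_1)}_{1;\mathbf{J}})^\top,\ldots,(\boldsymbol{\Delta}^{(n_m)}_{m;\mathbf{J}})^\top)^\top$, $\mathbf{D}_{\mathbf{J}}=\mathrm{Var}(\mathbf{J}(\mathbf{U}))$ for $\mathbf{U}\sim\mathrm{P}^{\mathbf{U}}$,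 and $$Q^{(n)}_{\mathbf{J}}=(\boldsymbol{\Delta}^{(n)}_{\mathbf{J}})^\top(\mathbf{I}_m\otimes\mathbf{D}_{\mathbf{J}}^{-})\boldsymbol{\Delta}^{(n)}_{\mathbf{J}},$$ where $\mathbf{D}_{\mathbf{J}}^-$ is the Moore–Penrose inverse of $\mathbf{D}_{\mathbf{J}}$. *)

theory Defs
  imports "HOL-Probability.Probability"
begin

section \<open>The unit sphere and its uniform distribution\<close>

definition sphere_borel :: "(real ^ 'd) measure" where
  "sphere_borel = restrict_space borel (sphere 0 1)"

text \<open>
  Surface area via polar coordinates: the area of \<open>A\<close> is \<open>d\<close> times the Lebesgue measure of the
  cone \<open>{x. 0 < norm x < 1 \<and> x / norm x \<in> A}\<close> over \<open>A\<close>; note \<open>sgn x = x / norm x\<close>.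
\<close>

definition surface_measure :: "(real ^ 'd) measure" where
  "surface_measure = scale_measure (of_nat CARD('d))
     (distr (restrict_space lborel (ball 0 1 - {0})) sphere_borel sgn)"

definition uniform_sphere :: "(real ^ 'd) measure" where
  "uniform_sphere = uniform_measure surface_measure (sphere 0 1)"

definition bounded_density_class :: "(real ^ 'd) measure set" where
  "bounded_density_class = {P. prob_space P \<and>
     (\<exists>f c C. f \<in> borel_measurable surface_measure \<and> 0 < c \<and>
        (AE z in surface_measure. c \<le> f z \<and> f z \<le> C) \<and>
        P = density surface_measure (\<lambda>z. ennreal (f z)))}"

definition weakly_converges ::
    "(nat \<Rightarrow> 'a::topological_space measure) \<Rightarrow> 'a measure \<Rightarrow> bool" where
  "weakly_converges \<mu> \<nu> \<longleftrightarrow>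
     (\<forall>f :: 'a \<Rightarrow> real. continuous_on (space \<nu>) f \<and> bounded (f ` space \<nu>) \<longrightarrow>
        (\<lambda>n. \<integral>x. f x \<partial>\<mu> n) \<longlonglongrightarrow> (\<integral>x. f x \<partial>\<nu>))"

text \<open>The tuple \<open>g 1, \<dots>, g n\<close> may have repeated entries, which are counted with multiplicity.\<close>

definition discrete_uniform :: "nat \<Rightarrow> (nat \<Rightarrow> real ^ 'd) \<Rightarrow> (real ^ 'd) measure" where
  "discrete_uniform n g = distr (uniform_count_measure {1..n}) sphere_borel g"

section \<open>Directional distribution functions\<close>

definition cost :: "real ^ 'd \<Rightarrow> real ^ 'd \<Rightarrow> real" where
  "cost y z = (arccos (y \<bullet> z))\<^sup>2 / 2"

definition transport_maps :: "(real ^ 'd) measure \<Rightarrow> (real ^ 'd \<Rightarrow> real ^ 'd) set" where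
  "transport_maps P =
     {S \<in> sphere_borel \<rightarrow>\<^sub>M sphere_borel. distr P sphere_borel S = uniform_sphere}"

definition optimal_transport_map ::
    "(real ^ 'd) measure \<Rightarrow> (real ^ 'd \<Rightarrow> real ^ 'd) \<Rightarrow> bool" where
  "optimal_transport_map P F \<longleftrightarrow> F \<in> transport_maps P \<and>
     (\<forall>S \<in> transport_maps P. (\<integral>z. cost z (F z) \<partial>P) \<le> (\<integral>z. cost z (S z) \<partial>P))"

text \<open>
  For \<open>P\<close> in \<open>bounded_density_class\<close> the last conjunct is automatic (McCann's theorem).
  Only the values of \<open>F\<close> on the sphere matter.
\<close>

definition directional_df ::
    "(real ^ 'd) measure \<Rightarrow> (real ^ 'd \<Rightarrow> real ^ 'd) \<Rightarrow> bool" where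
  "directional_df P F \<longleftrightarrow> continuous_on (sphere 0 1) F \<and> optimal_transport_map P F \<and>
     (\<forall>S. optimal_transport_map P S \<longrightarrow> (AE z in P. S z = F z))"

definition empirical_directional_df ::
    "nat \<Rightarrow> (nat \<Rightarrow> real ^ 'd) \<Rightarrow> (nat \<Rightarrow> real ^ 'd) \<Rightarrow> (real ^ 'd \<Rightarrow> real ^ 'd) \<Rightarrow> bool" where
  "empirical_directional_df n g y F \<longleftrightarrow>
     bij_betw F (y ` {1..n}) (g ` {1..n}) \<and>
     (\<Sum>l=1..n. cost (y l) (F (y l))) =
       Min ((\<lambda>T. \<Sum>l=1..n. cost (y l) (g (T l))) ` {T. T permutes {1..n}})"

section \<open>The rank-based MANOVA statistic\<close>

definition covariance_matrix :: "'a measure \<Rightarrow> ('a \<Rightarrow> real ^ 'k) \<Rightarrow> real ^ 'k ^ 'k" where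
  "covariance_matrix M V = (\<chi> a b.
     \<integral>u. (V u $ a - (\<integral>v. V v $ a \<partial>M)) * (V u $ b - (\<integral>v. V v $ b \<partial>M)) \<partial>M)"

definition moore_penrose_inverse :: "real ^ 'n ^ 'm \<Rightarrow> real ^ 'm ^ 'n" where
  "moore_penrose_inverse A = (THE B. A ** B ** A = A \<and> B ** A ** B = B \<and>
     transpose (A ** B) = A ** B \<and> transpose (B ** A) = B ** A)"

definition kronecker_product ::
    "real ^ 'b ^ 'a \<Rightarrow> real ^ 'd ^ 'c \<Rightarrow> real ^ ('b \<times> 'd) ^ ('a \<times> 'c)" where
  "kronecker_product A B = (\<chi> p q. A $ fst p $ fst q * B $ snd p $ snd q)"

text \<open>
  In the following, \<open>F\<close> is the empirical directional distribution function, \<open>N i\<close> the size of the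
  \<open>i\<close>-th sample \<open>x i 1, \<dots>, x i (N i)\<close>, and \<open>y 1, \<dots>, y n\<close> the pooled sample.
\<close>

definition score_deviation ::
    "(real ^ 'd \<Rightarrow> real ^ 'k) \<Rightarrow> (real ^ 'd \<Rightarrow> real ^ 'd) \<Rightarrow> nat \<Rightarrow> ('m \<Rightarrow> nat) \<Rightarrow>
     ('m \<Rightarrow> nat \<Rightarrow> real ^ 'd) \<Rightarrow> (nat \<Rightarrow> real ^ 'd) \<Rightarrow> 'm \<Rightarrow> real ^ 'k" where
  "score_deviation J F n N x y i =
     (1 / sqrt (real (N i))) *\<^sub>R (\<Sum>j=1..N i. J (F (x i j))) -
     (1 / sqrt (real n)) *\<^sub>R (\<Sum>l=1..n. (sqrt (real (N i)) / sqrt (real n)) *\<^sub>R J (F (y l)))"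

definition stacked_score_deviation ::
    "(real ^ 'd \<Rightarrow> real ^ 'k) \<Rightarrow> (real ^ 'd \<Rightarrow> real ^ 'd) \<Rightarrow> nat \<Rightarrow> ('m::finite \<Rightarrow> nat) \<Rightarrow>
     ('m \<Rightarrow> nat \<Rightarrow> real ^ 'd) \<Rightarrow> (nat \<Rightarrow> real ^ 'd) \<Rightarrow> real ^ ('m \<times> 'k)" where
  "stacked_score_deviation J F n N x y = (\<chi> p. score_deviation J F n N x y (fst p) $ snd p)"

definition rank_manova_statistic ::
    "(real ^ 'd \<Rightarrow> real ^ 'k) \<Rightarrow> (real ^ 'd \<Rightarrow> real ^ 'd) \<Rightarrow> nat \<Rightarrow> ('m::finite \<Rightarrow> nat) \<Rightarrow>
     ('m \<Rightarrow> nat \<Rightarrow> real ^ 'd) \<Rightarrow> (nat \<Rightarrow> real ^ 'd) \<Rightarrow> real" where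
  "rank_manova_statistic J F n N x y =
     stacked_score_deviation J F n N x y \<bullet>
     (kronecker_product (mat 1 :: real ^ 'm ^ 'm)
        (moore_penrose_inverse (covariance_matrix uniform_sphere J))
      *v stacked_score_deviation J F n N x y)"

text \<open>
  The law of the sum of \<open>k\<close> squared independent standard normal variables; for \<open>k = 0\<close> it is the
  unit mass at 0.
\<close>

definition chi_square :: "nat \<Rightarrow> real measure" where
  "chi_square k = distr (\<Pi>\<^sub>M i\<in>{..<k}. density lborel std_normal_density) borel
     (\<lambda>z. \<Sum>i<k. (z i)\<^sup>2)"

end

theory Submission
  imports Defs "HOL-Real_Asymp.Real_Asymp"
begin

text \<open>
  Under the null hypothesis all samples have the same law. Indeed, the common map \<open>F\<close> is continuous and
  optimal, hence its graph is monotone under swapping two points (\<open>optimal_monotone\<close>); a slope argument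
  along great circles then shows that almost every point of the sphere has at most one preimage under
  \<open>F\<close> (\<open>ambiguous_fibre_null\<close>). A law that \<open>F\<close> pushes forward to the uniform one is therefore
  determined by \<open>F\<close> (\<open>same_df_imp_same_law\<close>).

  So the pooled sample is i.i.d. Ties between two assignments have probability zero, because level sets
  of a difference of two cost functions are null (\<open>cost_difference_level_null\<close>). Hence the optimal
  assignment is almost surely unique, and by exchangeability it is a uniformly random permutation of the
  grid (\<open>expectation_of_ranks\<close>). The law of the statistic becomes a combinatorial quantity:
  after whitening the scores by the Moore-Penrose inverse, the statistic is \<open>Q = |V|^2\<close> where \<open>V\<close>
  collects the normalised group sums of centred scores under a random permutation.

  The limit of \<open>Q\<close> is found from its Laplace transform \<open>L(s) = E exp (- s Q)\<close> by the method of
  exchangeable pairs: composing the permutation with a random transposition moves \<open>V\<close> by a jump whose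
  conditional covariance is close to a projection of rank \<open>K = (m - 1) d\<close> that fixes \<open>V\<close>. This gives
  \<open>(1 + 2 s) E (Q exp (- s Q)) = K L(s) + o(1)\<close> (\<open>laplace_stein\<close>), that is,
  \<open>L' = - K L / (1 + 2 s) + o(1)\<close>, so that \<open>L(s)\<close> tends to \<open>(1 + 2 s) powr (- K / 2)\<close>, the transform of
  the chi-square law (\<open>permutation_laplace_limit\<close>). Convergence of Laplace transforms at positive
  integers implies weak convergence by Weierstrass approximation in the variable \<open>exp (- x)\<close>
  (\<open>laplace_imp_weak_conv\<close>).
\<close>

section \<open>Laplace transforms and weak convergence\<close>

text \<open>
  The continuous step functions that characterise weak convergence become, in the variable
  \<open>v = exp (- x)\<close>, continuous functions on \<open>{0..1}\<close>, hence uniform limits of Bernstein polynomials; the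
  moments of \<open>v\<close> are the values of the Laplace transform at the natural numbers.
\<close>
theorem laplace_imp_weak_conv:
  fixes \<mu> :: "nat \<Rightarrow> real measure" and \<nu> :: "real measure"
  assumes \<mu>: "\<And>n. real_distribution (\<mu> n)" "\<And>n. AE x in \<mu> n. x \<ge> 0"
    and \<nu>: "real_distribution \<nu>" "AE x in \<nu>. x \<ge> 0"
    and lim: "\<And>j::nat. j > 0 \<Longrightarrow> (\<lambda>n. \<integral>x. exp (- real j * x) \<partial>\<mu> n) \<longlonglongrightarrow> (\<integral>x. exp (- real j * x) \<partial>\<nu>)"
  shows "weak_conv_m \<mu> \<nu>"
proof (rule integral_cts_step_conv_imp_weak_conv[OF \<mu>(1) \<nu>(1)])
  fix x y :: real assume xy: "x < y"
  define h where "h v = (if v \<le> 0 then 0 else cts_step x y (- ln v))" for v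
  have cts: "continuous_on UNIV (cts_step x y)"
    using cts_step_uniformly_continuous[OF xy] by (rule uniformly_continuous_imp_continuous)
  have h_cont: "continuous_on {0..1} h"
  proof -
    have "isCont h v" for v
    proof (cases "v \<le> 0")
      case True
      have "\<forall>\<^sub>F w in nhds v. h w = 0"
      proof -
        have "\<forall>\<^sub>F w in nhds v. w < exp (- y)"
          using True by (intro eventually_nhds_in_open[of "{..<exp (- y)}", simplified]) 
             (auto intro: le_less_trans)
        then show ?thesis
        proof eventually_elim
          case (elim w)
          show ?case
          proof (cases "w \<le> 0")
            case False
            then have "ln w < - y" using elim by (metis exp_gt_zero ln_exp ln_less_cancel_iff not_le)
            then show ?thesis using xy False by (simp add: h_def cts_step_def)
          qed (simp add: h_def)
        qed
      qed
      then have "isCont h v \<longleftrightarrow> isCont (\<lambda>_. 0 :: real) v" by (rule isCont_cong)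
      then show ?thesis by simp
    next
      case False
      have "\<forall>\<^sub>F w in nhds v. h w = cts_step x y (- ln w)"
      proof -
        have "\<forall>\<^sub>F w in nhds v. w > 0"
          using False by (intro eventually_nhds_in_open[of "{0<..}", simplified]) auto
        then show ?thesis by eventually_elim (simp add: h_def)
      qed
      then have "isCont h v \<longleftrightarrow> isCont (\<lambda>w. cts_step x y (- ln w)) v" by (rule isCont_cong)
      moreover have "isCont (\<lambda>w. cts_step x y (- ln w)) v"
        using False cts by (intro isCont_o2[of v _ "cts_step x y"]) 
          (auto simp: continuous_on_eq_continuous_at intro!: continuous_intros)
      ultimately show ?thesis by simp
    qed
    then show ?thesis by (simp add: continuous_at_imp_continuous_on)
  qed
  have h_eq: "cts_step x y z = h (exp (- z))" for z by (simp add: h_def)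
  show "(\<lambda>n. \<integral>z. cts_step x y z \<partial>\<mu> n) \<longlonglongrightarrow> (\<integral>z. cts_step x y z \<partial>\<nu>)"
  proof (rule tendstoI)
    fix e :: real assume e: "e > 0"
    obtain N where N: "\<And>n v. N \<le> n \<Longrightarrow> v \<in> {0..1} \<Longrightarrow> \<bar>h v - (\<Sum>k\<le>n. h (k / n) * Bernstein n k v)\<bar> < e / 3"
      using Bernstein_Weierstrass[OF h_cont, of "e / 3"] e by auto
    define p where "p v = (\<Sum>k\<le>N. h (k / N) * Bernstein N k v)" for v
    define P where "P = (\<Sum>k\<le>N. smult (h (k / N) * real (N choose k)) (monom 1 k * [:1, -1:] ^ (N - k)))"
    have pP: "p v = poly P v" for v
      by (simp add: p_def P_def Bernstein_def poly_sum poly_monom mult_ac)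
    have pow: "exp (- real j * z) = exp (- z) ^ j" for j :: nat and z :: real
      by (simp add: exp_of_nat_mult[symmetric])
    have int: "integrable \<sigma> (\<lambda>z. exp (- real j * z))" "integrable \<sigma> (\<lambda>z. poly P (exp (- z)))"
       "(\<integral>z. poly P (exp (- z)) \<partial>\<sigma>) = (\<Sum>j\<le>degree P. coeff P j * (\<integral>z. exp (- real j * z) \<partial>\<sigma>))"
       "\<bar>(\<integral>z. cts_step x y z \<partial>\<sigma>) - (\<integral>z. poly P (exp (- z)) \<partial>\<sigma>)\<bar> \<le> e / 3"
      if \<sigma>: "real_distribution \<sigma>" "AE z in \<sigma>. z \<ge> 0" for \<sigma> j
    proof -
      interpret real_distribution \<sigma> by fact
      show i: "integrable \<sigma> (\<lambda>z. exp (- real j * z))" for j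
        by (rule integrable_const_bound[of _ 1]) (use \<sigma>(2) in auto)
      have eq: "(\<lambda>z. poly P (exp (- z))) = (\<lambda>z. \<Sum>j\<le>degree P. coeff P j * exp (- real j * z))"
        unfolding poly_altdef pow ..
      show ip: "integrable \<sigma> (\<lambda>z. poly P (exp (- z)))" unfolding eq using i by simp
      show "(\<integral>z. poly P (exp (- z)) \<partial>\<sigma>) = (\<Sum>j\<le>degree P. coeff P j * (\<integral>z. exp (- real j * z) \<partial>\<sigma>))"
        unfolding eq using i by simp
      have "(\<integral>z. cts_step x y z \<partial>\<sigma>) - (\<integral>z. poly P (exp (- z)) \<partial>\<sigma>) = (\<integral>z. cts_step x y z - poly P (exp (- z)) \<partial>\<sigma>)"
        using integrable_cts_step[OF xy] ip by simp
      also have "norm \<dots> \<le> (\<integral>z. e / 3 \<partial>\<sigma>)"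
      proof (rule order_trans[OF integral_norm_bound], rule integral_mono_AE)
        show "integrable \<sigma> (\<lambda>z. norm (cts_step x y z - poly P (exp (- z))))"
          using integrable_cts_step[OF xy] ip by (intro integrable_norm) simp
        show "AE z in \<sigma>. norm (cts_step x y z - poly P (exp (- z))) \<le> e / 3"
          using \<sigma>(2)
        proof eventually_elim
          case (elim z)
          then have "exp (- z) \<in> {0..1}" by simp
          from N[OF order_refl this] show ?case by (simp add: h_eq pP[symmetric] p_def)
        qed
      qed simp
      finally show "\<bar>(\<integral>z. cts_step x y z \<partial>\<sigma>) - (\<integral>z. poly P (exp (- z)) \<partial>\<sigma>)\<bar> \<le> e / 3"
        using prob_space by simp
    qed
    have "(\<lambda>n. \<integral>z. exp (- real j * z) \<partial>\<mu> n) \<longlonglongrightarrow> (\<integral>z. exp (- real j * z) \<partial>\<nu>)" for j :: nat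
    proof (cases "j = 0")
      case True
      then show ?thesis using \<mu>(1) \<nu>(1) by (simp add: real_distribution_def prob_space.prob_space)
    qed (rule lim, simp)
    then have "(\<lambda>n. \<integral>z. poly P (exp (- z)) \<partial>\<mu> n) \<longlonglongrightarrow> (\<integral>z. poly P (exp (- z)) \<partial>\<nu>)"
      unfolding int(3)[OF \<mu>] int(3)[OF \<nu>] by (intro tendsto_sum tendsto_mult tendsto_const)
    then have "\<forall>\<^sub>F n in sequentially. \<bar>(\<integral>z. poly P (exp (- z)) \<partial>\<mu> n) - (\<integral>z. poly P (exp (- z)) \<partial>\<nu>)\<bar> < e / 3"
      using e by (auto dest!: tendstoD[of _ _ _ "e / 3"] simp: dist_real_def)
    then show "\<forall>\<^sub>F n in sequentially. dist (\<integral>z. cts_step x y z \<partial>\<mu> n) (\<integral>z. cts_step x y z \<partial>\<nu>) < e"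
    proof eventually_elim
      case (elim n)
      show ?case using int(4)[OF \<mu>, of n] int(4)[OF \<nu>] elim unfolding dist_real_def by linarith
    qed
  qed
qed

section \<open>The chi-square law\<close>

lemma std_normal_prob: "prob_space (density lborel std_normal_density)"
  by (rule prob_space_normal_density) simp

lemma std_normal_laplace_square:
  assumes s: "s > 0"
  shows "(\<integral>z. exp (- s * z\<^sup>2) \<partial>density lborel std_normal_density) = (1 + 2 * s) powr (- 1 / 2)"
proof -
  define \<sigma> where "\<sigma> = 1 / sqrt (1 + 2 * s)"
  have \<sigma>: "\<sigma> > 0" "\<sigma>\<^sup>2 = 1 / (1 + 2 * s)" using s by (auto simp: \<sigma>_def power_divide)
  have eq: "std_normal_density z * exp (- s * z\<^sup>2) = \<sigma> * normal_density 0 \<sigma> z" for z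
  proof -
    have "sqrt (2 * pi * \<sigma>\<^sup>2) = sqrt (2 * pi) * \<sigma>" using \<sigma>(1) by (simp only: real_sqrt_mult) simp
    moreover have "- (z\<^sup>2) / (2 * \<sigma>\<^sup>2) = - z\<^sup>2 / 2 + - s * z\<^sup>2" using s unfolding \<sigma>(2) by (simp add: field_simps)
    ultimately show ?thesis
      using \<sigma>(1) unfolding normal_density_def by (simp add: exp_add[symmetric])
  qed
  have "(\<integral>z. exp (- s * z\<^sup>2) \<partial>density lborel std_normal_density) =
      (\<integral>z. std_normal_density z *\<^sub>R exp (- s * z\<^sup>2) \<partial>lborel)"
    by (rule integral_density) auto
  also have "\<dots> = (\<integral>z. \<sigma> * normal_density 0 \<sigma> z \<partial>lborel)"
    unfolding real_scaleR_def eq ..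
  also have "\<dots> = \<sigma> * (\<integral>z. normal_density 0 \<sigma> z \<partial>lborel)"
    by (rule integral_mult_right_zero)
  also have "\<dots> = \<sigma>"
    by (simp only: integral_normal_density[OF \<sigma>(1)] mult_1_right)
  also have "\<sigma> = (1 + 2 * s) powr (- (1 / 2))"
    unfolding powr_minus \<sigma>_def using s by (subst powr_half_sqrt) (auto simp: inverse_eq_divide)
  finally show ?thesis by simp
qed

lemma chi_square_measurable: "(\<lambda>z. \<Sum>i<k. (z i)\<^sup>2) \<in> borel_measurable (\<Pi>\<^sub>M i\<in>{..<k}. density lborel std_normal_density)"
  for k :: nat
  by (intro borel_measurable_sum borel_measurable_power) (auto intro!: measurable_component_singleton[THEN measurable_compose])

lemma real_distribution_chi_square: "real_distribution (chi_square k)"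
proof -
  interpret product_prob_space "\<lambda>_. density lborel std_normal_density" "{..<k}"
    by (simp add: product_prob_spaceI std_normal_prob)
  have "prob_space (chi_square k)"
    unfolding chi_square_def by (rule prob_space_distr[OF chi_square_measurable])
  then show ?thesis by (simp add: real_distribution_def real_distribution_axioms_def chi_square_def)
qed

lemma AE_chi_square_nonneg: "AE x in chi_square k. x \<ge> 0"
  unfolding chi_square_def by (subst AE_distr_iff[OF chi_square_measurable]) (auto simp: sum_nonneg)

lemma chi_square_laplace:
  assumes s: "s > 0"
  shows "(\<integral>x. exp (- s * x) \<partial>chi_square k) = (1 + 2 * s) powr (- real k / 2)"
proof -
  interpret product_prob_space "\<lambda>_. density lborel std_normal_density" "{..<k}"
    by (simp add: product_prob_spaceI std_normal_prob)
  have fin: "finite_measure (density lborel std_normal_density)"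
    using std_normal_prob by (rule prob_space.finite_measure)
  have "(\<integral>x. exp (- s * x) \<partial>chi_square k) =
      (\<integral>z. exp (- s * (\<Sum>i<k. (z i)\<^sup>2)) \<partial>(\<Pi>\<^sub>M i\<in>{..<k}. density lborel std_normal_density))"
    unfolding chi_square_def by (rule integral_distr[OF chi_square_measurable]) simp
  also have "\<dots> = (\<integral>z. (\<Prod>i<k. exp (- s * (z i)\<^sup>2)) \<partial>(\<Pi>\<^sub>M i\<in>{..<k}. density lborel std_normal_density))"
    by (simp add: sum_distrib_left exp_sum)
  also have "\<dots> = (\<Prod>i<k. \<integral>z. exp (- s * z\<^sup>2) \<partial>density lborel std_normal_density)"
  proof (rule product_integral_prod)
    show "integrable (density lborel std_normal_density) (\<lambda>z. exp (- s * z\<^sup>2))"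
      by (rule finite_measure.integrable_const_bound[OF fin, of _ 1]) (use s in auto)
  qed simp
  also have "\<dots> = ((1 + 2 * s) powr (- 1 / 2)) ^ k"
    unfolding std_normal_laplace_square[OF s] by simp
  also have "\<dots> = ((1 + 2 * s) powr (- 1 / 2)) powr real k"
    by (rule powr_realpow[symmetric]) (use s in simp)
  also have "\<dots> = (1 + 2 * s) powr (- real k / 2)" by (simp add: powr_powr)
  finally show ?thesis .
qed

section \<open>Means over permutations and exchangeable pairs\<close>

definition perm_mean :: "nat \<Rightarrow> ((nat \<Rightarrow> nat) \<Rightarrow> 'v::real_vector) \<Rightarrow> 'v" where
  "perm_mean n f = (1 / fact n) *\<^sub>R (\<Sum>T | T permutes {1..n}. f T)"

lemma perm_mean_add: "perm_mean n (\<lambda>T. f T + g T) = perm_mean n f + perm_mean n g"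
  by (simp add: perm_mean_def sum.distrib scaleR_add_right)

lemma perm_mean_diff: "perm_mean n (\<lambda>T. f T - g T) = perm_mean n f - perm_mean n g"
  by (simp add: perm_mean_def sum_subtractf scaleR_diff_right)

lemma perm_mean_sum: "perm_mean n (\<lambda>T. \<Sum>i\<in>A. f i T) = (\<Sum>i\<in>A. perm_mean n (f i))"
  unfolding perm_mean_def by (subst sum.swap) (simp add: scaleR_sum_right)

lemma perm_mean_cmult: "perm_mean n (\<lambda>T. c * f T) = c * perm_mean n f" for c :: real
  by (simp add: perm_mean_def sum_distrib_left mult.left_commute)

lemma perm_mean_mono:
  fixes f g :: "_ \<Rightarrow> real"
  assumes "\<And>T. T permutes {1..n} \<Longrightarrow> f T \<le> g T"
  shows "perm_mean n f \<le> perm_mean n g"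
  unfolding perm_mean_def real_scaleR_def
  by (rule mult_left_mono, rule sum_mono) (use assms in auto)

lemma perm_mean_const: "perm_mean n (\<lambda>T. c) = c"
  by (simp add: perm_mean_def card_permutations sum_constant_scaleR)

lemma perm_mean_cong:
  assumes "\<And>T. T permutes {1..n} \<Longrightarrow> f T = g T"
  shows "perm_mean n f = perm_mean n g"
  unfolding perm_mean_def using assms by (auto intro!: arg_cong[where f="scaleR _"] sum.cong)

lemma perm_mean_abs_le: "\<bar>perm_mean n f\<bar> \<le> perm_mean n (\<lambda>T. \<bar>f T\<bar>)" for f :: "_ \<Rightarrow> real"
  unfolding perm_mean_def real_scaleR_def abs_mult
  by (rule mult_mono[OF _ sum_abs]) auto

lemma perm_mean_transpose:
  assumes "I \<in> {1..n}" "J \<in> {1..n}"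
  shows "perm_mean n (\<lambda>T. f (T \<circ> Transposition.transpose I J)) = perm_mean n f"
proof -
  have p: "Transposition.transpose I J permutes {1..n}" using assms by (rule permutes_swap_id)
  have "(\<Sum>T | T permutes {1..n}. f (T \<circ> Transposition.transpose I J)) = (\<Sum>T | T permutes {1..n}. f T)"
    by (rule sum.reindex_bij_witness[where i="\<lambda>T. T \<circ> Transposition.transpose I J" and j="\<lambda>T. T \<circ> Transposition.transpose I J"])
       (use permutes_compose[OF p] in \<open>simp_all add: comp_assoc\<close>)
  then show ?thesis by (simp add: perm_mean_def)
qed

text \<open>
  The change of the sum \<open>comb_sum n B T\<close> when \<open>T\<close> is composed with the transposition of \<open>I\<close> and \<open>J\<close>.
\<close>
definition swap_jump :: "(nat \<Rightarrow> nat \<Rightarrow> 'v::real_vector) \<Rightarrow> (nat \<Rightarrow> nat) \<Rightarrow> nat \<Rightarrow> nat \<Rightarrow> 'v" where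
  "swap_jump B T I J = B I (T J) + B J (T I) - B I (T I) - B J (T J)"

definition comb_sum :: "nat \<Rightarrow> (nat \<Rightarrow> nat \<Rightarrow> 'v::real_vector) \<Rightarrow> (nat \<Rightarrow> nat) \<Rightarrow> 'v" where
  "comb_sum n B T = (\<Sum>I=1..n. B I (T I))"

lemma comb_sum_transpose:
  assumes I: "I \<in> {1..n}" and J: "J \<in> {1..n}"
  shows "comb_sum n B (T \<circ> Transposition.transpose I J) = comb_sum n B T + swap_jump B T I J"
proof (cases "I = J")
  case True
  then show ?thesis by (simp add: comb_sum_def swap_jump_def)
next
  case False
  have *: "comb_sum n B S = (B I (S I) + B J (S J)) + (\<Sum>l\<in>{1..n}-{I,J}. B l (S l))" for S
  proof -
    have "(\<Sum>l\<in>{1..n}. B l (S l)) = (\<Sum>l\<in>{I,J}. B l (S l)) + (\<Sum>l\<in>{1..n}-{I,J}. B l (S l))"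
      using I J by (subst sum.union_disjoint[symmetric]) (auto intro: sum.cong)
    then show ?thesis using False by (simp add: comb_sum_def)
  qed
  have "(\<Sum>l\<in>{1..n}-{I,J}. B l ((T \<circ> Transposition.transpose I J) l)) = (\<Sum>l\<in>{1..n}-{I,J}. B l (T l))"
    by (rule sum.cong) (auto simp: Transposition.transpose_def)
  then show ?thesis
    unfolding *[of "T \<circ> Transposition.transpose I J"] *[of T] by (simp add: swap_jump_def)
qed

lemma sum_permuted: "T permutes {1..n} \<Longrightarrow> (\<Sum>I=1..n. f (T I)) = (\<Sum>I=1..n. f I)"
  using sum.permute[of T "{1..n}" f] by (simp add: o_def)

lemma sum_swap_jump:
  fixes B :: "nat \<Rightarrow> nat \<Rightarrow> 'v::real_vector"
  assumes T: "T permutes {1..n}" and B: "(\<Sum>I=1..n. \<Sum>s=1..n. B I s) = 0"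
  shows "(\<Sum>I=1..n. \<Sum>J=1..n. swap_jump B T I J) = - (2 * real n) *\<^sub>R comb_sum n B T"
proof -
  have 1: "(\<Sum>I=1..n. \<Sum>J=1..n. B I (T J)) = 0"
    using B by (subst sum_permuted[OF T]) simp
  then have 2: "(\<Sum>I=1..n. \<Sum>J=1..n. B J (T I)) = 0"
    by (subst sum.swap)
  have 3: "(\<Sum>I=1..n. \<Sum>J=1..n. B I (T I)) = real n *\<^sub>R comb_sum n B T"
    by (simp add: comb_sum_def scaleR_sum_right sum_constant_scaleR)
  have 4: "(\<Sum>I=1..n. \<Sum>J=1..n. B J (T J)) = real n *\<^sub>R comb_sum n B T"
    by (simp add: comb_sum_def sum_constant_scaleR)
  have 5: "(2 * real n) *\<^sub>R comb_sum n B T = real n *\<^sub>R comb_sum n B T + real n *\<^sub>R comb_sum n B T"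
    by (simp add: scaleR_add_left[symmetric])
  show ?thesis
    unfolding swap_jump_def sum_subtractf sum.distrib 1 2 3 4 scaleR_minus_left 5 by simp
qed

lemma swap_jump_transpose:
  "swap_jump B (T \<circ> Transposition.transpose I J) I J = - swap_jump B T I J"
  by (simp add: swap_jump_def)

text \<open>
  Composition with a transposition preserves the mean and changes the sign of the jump, and the jumps
  from a given permutation add up to \<open>- 2 n\<close> times the statistic. So the left side is a mean of jumps
  against \<open>\<psi>\<close>, which can be antisymmetrised.
\<close>
lemma stein_identity:
  fixes B :: "nat \<Rightarrow> nat \<Rightarrow> 'v::real_inner"
  assumes B: "(\<Sum>I=1..n. \<Sum>s=1..n. B I s) = 0" and n: "n > 0"
  shows "perm_mean n (\<lambda>T. comb_sum n B T \<bullet> \<psi> (comb_sum n B T)) =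
    perm_mean n (\<lambda>T. (\<Sum>I=1..n. \<Sum>J=1..n.
       swap_jump B T I J \<bullet> (\<psi> (comb_sum n B T + swap_jump B T I J) - \<psi> (comb_sum n B T)))) / (4 * real n)"
proof -
  let ?V = "comb_sum n B" and ?h = "swap_jump B"
  have anti: "perm_mean n (\<lambda>T. ?h T I J \<bullet> \<psi> (?V T + ?h T I J)) =
      - perm_mean n (\<lambda>T. ?h T I J \<bullet> \<psi> (?V T))"
    if "I \<in> {1..n}" "J \<in> {1..n}" for I J
  proof -
    have "perm_mean n (\<lambda>T. ?h T I J \<bullet> \<psi> (?V T)) =
        perm_mean n (\<lambda>T. ?h (T \<circ> Transposition.transpose I J) I J \<bullet> \<psi> (?V (T \<circ> Transposition.transpose I J)))"
      by (rule perm_mean_transpose[OF that, symmetric])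
    also have "\<dots> = perm_mean n (\<lambda>T. - 1 * (?h T I J \<bullet> \<psi> (?V T + ?h T I J)))"
      using that by (simp add: comb_sum_transpose swap_jump_transpose)
    finally show ?thesis unfolding perm_mean_cmult by simp
  qed
  have "perm_mean n (\<lambda>T. (\<Sum>I=1..n. \<Sum>J=1..n. ?h T I J \<bullet> (\<psi> (?V T + ?h T I J) - \<psi> (?V T))))
      = (\<Sum>I=1..n. \<Sum>J=1..n. perm_mean n (\<lambda>T. ?h T I J \<bullet> \<psi> (?V T + ?h T I J)) -
           perm_mean n (\<lambda>T. ?h T I J \<bullet> \<psi> (?V T)))"
    by (simp add: perm_mean_sum inner_diff_right perm_mean_diff)
  also have "\<dots> = (\<Sum>I=1..n. \<Sum>J=1..n. (-2) * perm_mean n (\<lambda>T. ?h T I J \<bullet> \<psi> (?V T)))"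
    by (intro sum.cong refl) (simp add: anti)
  also have "\<dots> = (-2) * (\<Sum>I=1..n. \<Sum>J=1..n. perm_mean n (\<lambda>T. ?h T I J \<bullet> \<psi> (?V T)))"
    by (simp only: sum_distrib_left)
  also have "(\<Sum>I=1..n. \<Sum>J=1..n. perm_mean n (\<lambda>T. ?h T I J \<bullet> \<psi> (?V T))) =
      perm_mean n (\<lambda>T. (\<Sum>I=1..n. \<Sum>J=1..n. ?h T I J) \<bullet> \<psi> (?V T))"
    by (simp add: perm_mean_sum inner_sum_left)
  also have "\<dots> = perm_mean n (\<lambda>T. - (2 * real n) * (?V T \<bullet> \<psi> (?V T)))"
    by (rule perm_mean_cong) (subst sum_swap_jump[OF _ B], simp_all)
  also have "\<dots> = - (2 * real n) * perm_mean n (\<lambda>T. ?V T \<bullet> \<psi> (?V T))"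
    by (rule perm_mean_cmult)
  finally show ?thesis using n by (simp add: field_simps)
qed

text \<open>
  The Stein identity with \<open>\<psi>\<close> the identity bounds the second moment by the squared jumps.
\<close>
lemma perm_mean_norm_square_le:
  fixes B :: "nat \<Rightarrow> nat \<Rightarrow> 'v::real_inner"
  assumes B: "(\<Sum>I=1..n. \<Sum>s=1..n. B I s) = 0" and n: "n > 0"
    and h: "\<And>T. T permutes {1..n} \<Longrightarrow> (\<Sum>I=1..n. \<Sum>J=1..n. (norm (swap_jump B T I J))\<^sup>2) \<le> 4 * real n * c"
  shows "perm_mean n (\<lambda>T. (norm (comb_sum n B T))\<^sup>2) \<le> c"
proof -
  have "perm_mean n (\<lambda>T. (norm (comb_sum n B T))\<^sup>2) =
     perm_mean n (\<lambda>T. (\<Sum>I=1..n. \<Sum>J=1..n. (norm (swap_jump B T I J))\<^sup>2)) / (4 * real n)"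
    using stein_identity[OF B n, of "\<lambda>v. v"] by (simp add: power2_norm_eq_inner)
  also have "\<dots> \<le> (4 * real n * c) / (4 * real n)"
    using perm_mean_mono[OF h] n by (intro divide_right_mono) (simp_all add: perm_mean_const)
  finally show ?thesis using n by simp
qed

text \<open>
  Second-order Taylor expansion of \<open>t \<mapsto> h \<bullet> \<psi> (v + t h)\<close> for \<open>\<psi> v = exp (- s |v|^2) v\<close>. The
  Gaussian factor absorbs the powers of \<open>v\<close> in the second derivative, which makes the bound uniform in \<open>v\<close>.
\<close>
lemma taylor_gauss:
  fixes v h :: "'v::real_inner"
  assumes s: "s > 0"
  shows "\<bar>h \<bullet> (exp (- s * (norm (v + h))\<^sup>2) *\<^sub>R (v + h) - exp (- s * (norm v)\<^sup>2) *\<^sub>R v)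
      - ((norm h)\<^sup>2 - 2 * s * (v \<bullet> h)\<^sup>2) * exp (- s * (norm v)\<^sup>2)\<bar> \<le> 8 * sqrt s * norm h ^ 3"
proof -
  define b where "b = v \<bullet> h"
  define c where "c = (norm h)\<^sup>2"
  define a where "a = (norm v)\<^sup>2"
  define q where "q t = b + t * c" for t
  define E where "E t = exp (- s * (a + 2 * t * b + t\<^sup>2 * c))" for t
  define D0 where "D0 t = q t * E t" for t
  define D1 where "D1 t = (c - 2 * s * (q t)\<^sup>2) * E t" for t
  define D2 where "D2 t = (- 6 * s * c * q t + 4 * s\<^sup>2 * (q t)^3) * E t" for t
  have dq: "(q has_real_derivative c) (at t)" for t
    unfolding q_def by (auto intro!: derivative_eq_intros)
  have dE: "(E has_real_derivative (- 2 * s * q t * E t)) (at t)" for t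
    unfolding E_def q_def by (rule derivative_eq_intros refl | simp add: algebra_simps power2_eq_square)+
  have d0: "(D0 has_real_derivative D1 t) (at t)" for t
    unfolding D0_def D1_def by (rule derivative_eq_intros dq dE refl | simp add: algebra_simps power2_eq_square)+
  have d1: "(D1 has_real_derivative D2 t) (at t)" for t
    unfolding D1_def D2_def by (rule derivative_eq_intros dq dE refl | simp add: algebra_simps power2_eq_square power3_eq_cube)+
  have nt: "(norm (v + t *\<^sub>R h))\<^sup>2 = a + 2 * t * b + t\<^sup>2 * c" for t
    unfolding a_def b_def c_def power2_norm_eq_inner
    by (simp add: inner_add_left inner_add_right inner_commute power2_eq_square algebra_simps)
  have qt: "q t = h \<bullet> (v + t *\<^sub>R h)" for t
    unfolding q_def b_def c_def power2_norm_eq_inner by (simp add: inner_add_right inner_commute)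
  have bound: "\<bar>D2 t\<bar> \<le> 16 * sqrt s * norm h ^ 3" for t
  proof -
    define x where "x = sqrt s * norm (v + t *\<^sub>R h)"
    have x0: "x \<ge> 0" using s by (simp add: x_def)
    have Ex: "E t = exp (- x\<^sup>2)" using s by (simp add: E_def nt[symmetric] x_def power_mult_distrib)
    have e1: "x * exp (- x\<^sup>2) \<le> 1"
    proof -
      have "x \<le> 1 + x\<^sup>2" using zero_le_power2[of "x - 1"] x0 by (simp add: power2_eq_square algebra_simps)
      also have "\<dots> \<le> exp (x\<^sup>2)" by (rule exp_ge_add_one_self)
      finally show ?thesis by (simp add: exp_minus field_simps)
    qed
    have e3: "x^3 * exp (- x\<^sup>2) \<le> 2"
    proof -
      have "x^3 \<le> x\<^sup>2 + x^4"
      proof -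
        have "0 \<le> x\<^sup>2 * ((x - 1/2)\<^sup>2 + 3/4)" by simp
        also have "\<dots> = x\<^sup>2 + x^4 - x^3" by (simp add: power2_eq_square algebra_simps power3_eq_cube power4_eq_xxxx)
        finally show ?thesis by simp
      qed
      also have "\<dots> \<le> 2 * (1 + x\<^sup>2 + (x\<^sup>2)\<^sup>2 / 2)" by simp
      also have "\<dots> \<le> 2 * exp (x\<^sup>2)" using exp_lower_Taylor_quadratic[of "x\<^sup>2"] by simp
      finally show ?thesis by (simp add: exp_minus field_simps)
    qed
    have aq: "sqrt s * \<bar>q t\<bar> \<le> norm h * x"
      unfolding qt x_def using Cauchy_Schwarz_ineq2[of h "v + t *\<^sub>R h"] s
      by (simp add: mult.left_commute mult_left_mono)
    have q1: "sqrt s * \<bar>q t\<bar> * E t \<le> norm h"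
    proof -
      have "sqrt s * \<bar>q t\<bar> * E t \<le> norm h * x * E t" using aq by (simp add: Ex)
      also have "\<dots> \<le> norm h * 1" unfolding Ex mult.assoc using e1 by (intro mult_left_mono) auto
      finally show ?thesis by simp
    qed
    have q3: "(sqrt s * \<bar>q t\<bar>)^3 * E t \<le> 2 * norm h ^ 3"
    proof -
      have "(sqrt s * \<bar>q t\<bar>)^3 * E t \<le> (norm h * x)^3 * E t"
        using aq s by (intro mult_right_mono power_mono) (auto simp: Ex)
      also have "\<dots> = norm h ^3 * (x^3 * exp (- x\<^sup>2))" by (simp add: Ex power_mult_distrib)
      also have "\<dots> \<le> norm h ^ 3 * 2" using e3 by (intro mult_left_mono) auto
      finally show ?thesis by simp
    qed
    have "\<bar>D2 t\<bar> \<le> \<bar>6 * s * c * q t\<bar> * E t + \<bar>4 * s\<^sup>2 * (q t)^3\<bar> * E t"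
      unfolding D2_def abs_mult[of _ "E t"] by (simp add: Ex ring_distribs(2)[symmetric] mult_right_mono) 
    also have "\<bar>6 * s * c * q t\<bar> * E t = 6 * sqrt s * c * (sqrt s * \<bar>q t\<bar> * E t)"
      using s by (simp add: abs_mult c_def)
    also have "\<dots> \<le> 6 * sqrt s * c * norm h"
      using q1 s by (intro mult_left_mono) (auto simp: c_def)
    also have "\<bar>4 * s\<^sup>2 * (q t)^3\<bar> * E t = 4 * sqrt s * ((sqrt s * \<bar>q t\<bar>)^3 * E t)"
    proof -
      have "s\<^sup>2 = sqrt s * sqrt s ^ 3" using s by (simp add: power3_eq_cube power2_eq_square)
      then show ?thesis using s by (simp add: abs_mult power_mult_distrib power_abs)
    qed
    also have "\<dots> \<le> 4 * sqrt s * (2 * norm h ^ 3)"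
      using q3 s by (intro mult_left_mono) auto
    finally show ?thesis by (simp add: c_def power2_eq_square power3_eq_cube)
  qed
  have "\<exists>t. D0 1 = D0 0 + D1 0 + D2 t / 2"
  proof -
    have "\<exists>t>0. t < 1 \<and> D0 1 = (\<Sum>m<2. (if m = 0 then D0 else if m = 1 then D1 else D2) 0 / fact m * 1 ^ m) +
        (if (2::nat) = 0 then D0 else if (2::nat) = 1 then D1 else D2) t / fact 2 * 1 ^ 2"
      by (rule Maclaurin[of 1 2]) (auto simp: d0 d1 less_Suc_eq numeral_2_eq_2)
    then show ?thesis by (auto simp: numeral_2_eq_2)
  qed
  then obtain t where t: "D0 1 = D0 0 + D1 0 + D2 t / 2" by auto
  have "h \<bullet> (exp (- s * (norm (v + h))\<^sup>2) *\<^sub>R (v + h) - exp (- s * (norm v)\<^sup>2) *\<^sub>R v) = D0 1 - D0 0"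
    using qt[of 0] qt[of 1] nt[of 0] nt[of 1] by (simp add: D0_def E_def inner_diff_right)
  moreover have "((norm h)\<^sup>2 - 2 * s * (v \<bullet> h)\<^sup>2) * exp (- s * (norm v)\<^sup>2) = D1 0"
    by (simp add: D1_def q_def E_def c_def b_def a_def)
  ultimately show ?thesis using bound[of t] t by simp
qed

section \<open>Group means of permuted scores\<close>

declare One_nat_def [simp del]

lemma double_sum_mult: "(\<Sum>I\<in>A. \<Sum>J\<in>B. k * f I J) = k * (\<Sum>I\<in>A. \<Sum>J\<in>B. f I J)" for k :: real
  by (simp add: sum_distrib_left)

text \<open>
  The positions \<open>1, \<dots>, n\<close> are divided into groups by \<open>G\<close>, and position \<open>l\<close> receives the score
  \<open>\<alpha> (T l)\<close>.
\<close>
locale grouped_scores =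
  fixes n :: nat and G :: "nat \<Rightarrow> 'm::finite" and \<alpha> :: "nat \<Rightarrow> 'a::euclidean_space"
  assumes n_pos: "n > 0"
    and centred: "(\<Sum>s=1..n. \<alpha> s) = 0"
    and groups_nonempty: "\<And>i. \<exists>l\<in>{1..n}. G l = i"
begin

definition size :: "'m \<Rightarrow> real" where
  "size i = (\<Sum>l=1..n. of_bool (G l = i))"

definition group_mean :: "(nat \<Rightarrow> nat) \<Rightarrow> 'm \<Rightarrow> 'a" where
  "group_mean T i = (1 / size i) *\<^sub>R (\<Sum>l=1..n. of_bool (G l = i) *\<^sub>R \<alpha> (T l))"

definition weight :: "nat \<Rightarrow> 'm \<Rightarrow> real" where
  "weight I i = of_bool (G I = i) / sqrt (size i)"

definition kernel :: "nat \<Rightarrow> nat \<Rightarrow> 'a ^ 'm" where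
  "kernel I s = (\<chi> i. weight I i *\<^sub>R \<alpha> s)"

abbreviation dev :: "(nat \<Rightarrow> nat) \<Rightarrow> 'a ^ 'm" where
  "dev \<equiv> comb_sum n kernel"

abbreviation jump :: "(nat \<Rightarrow> nat) \<Rightarrow> nat \<Rightarrow> nat \<Rightarrow> 'a ^ 'm" where
  "jump \<equiv> swap_jump kernel"

definition Q :: "(nat \<Rightarrow> nat) \<Rightarrow> real" where
  "Q T = (norm (dev T))\<^sup>2"

lemma size_pos: "size i > 0"
proof -
  obtain l where l: "l \<in> {1..n}" "G l = i" using groups_nonempty by blast
  have "(1::real) \<le> size i"
    unfolding size_def using l member_le_sum[of l "{1..n}" "\<lambda>l. of_bool (G l = i) :: real"] by auto
  then show ?thesis by simp
qed

lemma size_nonzero [simp]: "size i \<noteq> 0" "size i \<ge> 0" 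
  using size_pos[of i] by auto

lemma sum_by_group:
  fixes f :: "'m \<Rightarrow> 'b::real_vector"
  shows "(\<Sum>I=1..n. f (G I)) = (\<Sum>i\<in>UNIV. size i *\<^sub>R f i)"
proof -
  have "(\<Sum>I=1..n. f (G I)) = (\<Sum>I=1..n. \<Sum>i\<in>UNIV. of_bool (G I = i) *\<^sub>R f i)"
    by (intro sum.cong refl) (simp add: of_bool_def if_distrib[of "\<lambda>c. c *\<^sub>R _"] cong: if_cong)
  also have "\<dots> = (\<Sum>i\<in>UNIV. size i *\<^sub>R f i)"
    by (subst sum.swap) (simp only: size_def scaleR_sum_left)
  finally show ?thesis .
qed

lemma sum_size: "(\<Sum>i\<in>UNIV. size i) = real n"
  using sum_by_group[of "\<lambda>_. 1::real"] by simp

lemma sum_group: "(\<Sum>l=1..n. of_bool (G l = i) *\<^sub>R \<alpha> (T l)) = size i *\<^sub>R group_mean T i"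
  by (simp add: group_mean_def)

lemma sum_scores: "T permutes {1..n} \<Longrightarrow> (\<Sum>l=1..n. \<alpha> (T l)) = 0"
  using sum_permuted[of T n \<alpha>] centred by simp

lemma sum_inner_group:
  "(\<Sum>l=1..n. \<alpha> (T l) \<bullet> f (G l)) = (\<Sum>i\<in>UNIV. size i * (group_mean T i \<bullet> f i))"
proof -
  have "(\<Sum>l=1..n. \<alpha> (T l) \<bullet> f (G l)) = (\<Sum>l=1..n. \<Sum>i\<in>UNIV. (of_bool (G l = i) *\<^sub>R \<alpha> (T l)) \<bullet> f i)"
    by (intro sum.cong refl) (simp add: of_bool_def if_distrib[of "\<lambda>c. c * _"] cong: if_cong)
  also have "\<dots> = (\<Sum>i\<in>UNIV. (\<Sum>l=1..n. of_bool (G l = i) *\<^sub>R \<alpha> (T l)) \<bullet> f i)"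
    by (subst sum.swap) (simp add: inner_sum_left)
  finally show ?thesis unfolding sum_group by simp
qed

lemma sum_group_mean:
  assumes "T permutes {1..n}"
  shows "(\<Sum>I=1..n. group_mean T (G I)) = 0"
proof -
  have "(\<Sum>I=1..n. group_mean T (G I)) = (\<Sum>i\<in>UNIV. size i *\<^sub>R group_mean T i)"
    by (rule sum_by_group)
  also have "\<dots> = (\<Sum>i\<in>UNIV. \<Sum>l=1..n. of_bool (G l = i) *\<^sub>R \<alpha> (T l))" by (simp only: sum_group)
  also have "\<dots> = (\<Sum>l=1..n. \<alpha> (T l))"
    by (subst sum.swap) (simp add: scaleR_sum_left[symmetric] of_bool_def)
  finally show ?thesis using sum_scores[OF assms] by simp
qed

lemma dev_component: "dev T $ i = sqrt (size i) *\<^sub>R group_mean T i"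
proof -
  have "dev T $ i = (1 / sqrt (size i)) *\<^sub>R (\<Sum>l=1..n. of_bool (G l = i) *\<^sub>R \<alpha> (T l))"
    by (simp add: comb_sum_def kernel_def weight_def sum_component scaleR_sum_right)
  also have "\<dots> = (1 / sqrt (size i) * size i) *\<^sub>R group_mean T i"
    unfolding sum_group by simp
  also have "1 / sqrt (size i) * size i = sqrt (size i)" by (simp add: real_div_sqrt)
  finally show ?thesis .
qed

lemma Q_eq: "Q T = (\<Sum>i\<in>UNIV. size i * (norm (group_mean T i))\<^sup>2)"
  unfolding Q_def power2_norm_eq_inner inner_vec_def dev_component
  by (intro sum.cong refl) (simp flip: mult.assoc)

lemma Q_nonneg: "Q T \<ge> 0" by (simp add: Q_def)

lemma jump_component: "jump T I J $ i = (weight I i - weight J i) *\<^sub>R (\<alpha> (T J) - \<alpha> (T I))"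
  by (simp add: swap_jump_def kernel_def algebra_simps)

lemma kernel_sum: "(\<Sum>I=1..n. \<Sum>s=1..n. kernel I s) = 0"
proof -
  have "(\<Sum>s=1..n. kernel I s) = 0" for I
    by (simp add: vec_eq_iff kernel_def sum_component scaleR_sum_right[symmetric] centred)
  then show ?thesis by simp
qed

lemma sum_weight: "(\<Sum>i\<in>UNIV. (weight I i - weight J i)\<^sup>2) =
    1 / size (G I) + 1 / size (G J) - 2 * of_bool (G I = G J) / size (G I)"
proof -
  have "(weight I i - weight J i)\<^sup>2 = of_bool (i = G I) * (1 / size i) + of_bool (i = G J) * (1 / size i)
      - 2 * (of_bool (i = G I) * (of_bool (G I = G J) / size i))" for i
    by (auto simp: weight_def power2_eq_square of_bool_def)
  moreover have "(\<Sum>i\<in>UNIV. of_bool (i = k) * f i) = f k" for k :: 'm and f :: "'m \<Rightarrow> real"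
    by (simp add: of_bool_def if_distrib[of "\<lambda>c. c * _"] cong: if_cong)
  ultimately show ?thesis
    by (simp only: sum.distrib sum_subtractf sum_distrib_left[symmetric])
qed

lemma norm_jump: "(norm (jump T I J))\<^sup>2 =
    (1 / size (G I) + 1 / size (G J) - 2 * of_bool (G I = G J) / size (G I)) * (norm (\<alpha> (T J) - \<alpha> (T I)))\<^sup>2"
  unfolding power2_norm_eq_inner inner_vec_def jump_component sum_weight[symmetric] sum_distrib_right
  by (intro sum.cong refl) (simp add: power2_eq_square)

lemma dev_inner_jump: "dev T \<bullet> jump T I J =
    (group_mean T (G I) - group_mean T (G J)) \<bullet> (\<alpha> (T J) - \<alpha> (T I))"
proof -
  let ?u = "\<lambda>i. group_mean T i \<bullet> (\<alpha> (T J) - \<alpha> (T I))"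
  have "dev T \<bullet> jump T I J = (\<Sum>i\<in>UNIV. of_bool (i = G I) * ?u i - of_bool (i = G J) * ?u i)"
    unfolding inner_vec_def dev_component jump_component
    by (intro sum.cong refl) (auto simp: weight_def)
  then show ?thesis by (simp add: sum_subtractf inner_diff_left of_bool_def if_distrib[of "\<lambda>c. c * _"] cong: if_cong)
qed

lemma sum_inverse_size: "(\<Sum>I=1..n. 1 / size (G I)) = real CARD('m)"
  using sum_by_group[of "\<lambda>i. 1 / size i"] by simp

text \<open>
  Summed over all transpositions, the squared length of the jump is an explicit function of the
  permuted scores; \<open>Q\<close> enters because scores in the same group are not separated by a transposition.
\<close>
lemma sum_norm_jump:
  assumes T: "T permutes {1..n}"
  shows "(\<Sum>I=1..n. \<Sum>J=1..n. (norm (jump T I J))\<^sup>2) =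
    2 * real n * (\<Sum>I=1..n. (norm (\<alpha> (T I)))\<^sup>2 / size (G I))
    + (2 * real CARD('m) - 4) * (\<Sum>s=1..n. (norm (\<alpha> s))\<^sup>2) + 4 * Q T"
proof -
  define a where "a I = \<alpha> (T I)" for I
  define c where "c I = 1 / size (G I)" for I
  define e where "e I J = (of_bool (G I = G J) :: real)" for I J
  define A where "A = (\<Sum>s=1..n. (norm (\<alpha> s))\<^sup>2)"
  have A: "(\<Sum>J=1..n. (norm (a J))\<^sup>2) = A"
    unfolding a_def A_def by (rule sum_permuted[OF T])
  have a0: "(\<Sum>J=1..n. a J) = 0" unfolding a_def by (rule sum_scores[OF T])
  have c1: "(\<Sum>I=1..n. c I) = real CARD('m)" unfolding c_def by (rule sum_inverse_size)
  have ec: "e I J * c I = e I J * c J" for I J by (auto simp: e_def c_def)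
  have es: "(\<Sum>J=1..n. e I J) = size (G I)" for I
    unfolding e_def size_def by (intro sum.cong refl) auto
  have cs: "c I * size (G I) = 1" for I by (simp add: c_def)
  have pt: "(norm (jump T I J))\<^sup>2 =
      c I * (norm (a I))\<^sup>2 + c I * (norm (a J))\<^sup>2 + c J * (norm (a I))\<^sup>2 + c J * (norm (a J))\<^sup>2
       - 2 * (c I * (a I \<bullet> a J)) - 2 * (c J * (a I \<bullet> a J))
       - 2 * (e I J * (c I * (norm (a I))\<^sup>2)) - 2 * (e I J * (c J * (norm (a J))\<^sup>2)) + 4 * (e I J * c I * (a I \<bullet> a J))" for I J
  proof -
    have "(norm (jump T I J))\<^sup>2 = (c I + c J - 2 * (e I J * c I)) * ((norm (a I))\<^sup>2 + (norm (a J))\<^sup>2 - 2 * (a I \<bullet> a J))"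
      unfolding norm_jump c_def e_def a_def[symmetric]
      by (simp add: power2_norm_eq_inner inner_diff_left inner_diff_right inner_commute)
    also have "\<dots> = c I * (norm (a I))\<^sup>2 + c I * (norm (a J))\<^sup>2 + c J * (norm (a I))\<^sup>2 + c J * (norm (a J))\<^sup>2
       - 2 * (c I * (a I \<bullet> a J)) - 2 * (c J * (a I \<bullet> a J))
       - 2 * (e I J * c I) * (norm (a I))\<^sup>2 - 2 * (e I J * c I) * (norm (a J))\<^sup>2 + 4 * (e I J * c I * (a I \<bullet> a J))"
      by (simp add: algebra_simps)
    also have "2 * (e I J * c I) * (norm (a J))\<^sup>2 = 2 * (e I J * (c J * (norm (a J))\<^sup>2))"
      using arg_cong[OF ec[of I J], of "\<lambda>z. 2 * z * (norm (a J))\<^sup>2"] by (simp only: mult.assoc)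
    finally show ?thesis by (simp only: mult.assoc)
  qed
  have s1: "(\<Sum>I=1..n. \<Sum>J=1..n. c I * (norm (a I))\<^sup>2) = real n * (\<Sum>I=1..n. c I * (norm (a I))\<^sup>2)"
    by (simp add: sum_distrib_left)
  have s2: "(\<Sum>I=1..n. \<Sum>J=1..n. c I * (norm (a J))\<^sup>2) = real CARD('m) * A"
    by (simp only: sum_distrib_left[symmetric] sum_distrib_right[symmetric] A c1)
  have s3: "(\<Sum>I=1..n. \<Sum>J=1..n. c J * (norm (a I))\<^sup>2) = real CARD('m) * A"
    using s2 by (subst sum.swap)
  have s4: "(\<Sum>I=1..n. \<Sum>J=1..n. c J * (norm (a J))\<^sup>2) = real n * (\<Sum>I=1..n. c I * (norm (a I))\<^sup>2)"
    by simp
  have s5: "(\<Sum>I=1..n. \<Sum>J=1..n. c I * (a I \<bullet> a J)) = 0"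
    by (simp only: sum_distrib_left[symmetric] inner_sum_right[symmetric] a0) simp
  have s6: "(\<Sum>I=1..n. \<Sum>J=1..n. c J * (a I \<bullet> a J)) = 0"
    using s5 by (subst sum.swap) (simp add: inner_commute)
  have s7: "(\<Sum>I=1..n. \<Sum>J=1..n. e I J * (c I * (norm (a I))\<^sup>2)) = A"
  proof -
    have "(\<Sum>I=1..n. \<Sum>J=1..n. e I J * (c I * (norm (a I))\<^sup>2)) = (\<Sum>I=1..n. (c I * size (G I)) * (norm (a I))\<^sup>2)"
      by (simp only: sum_distrib_right[symmetric] es) (simp add: mult_ac)
    then show ?thesis by (simp only: cs A mult_1)
  qed
  have s8: "(\<Sum>I=1..n. \<Sum>J=1..n. e I J * (c J * (norm (a J))\<^sup>2)) = A"
  proof -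
    have "e I J = e J I" for I J by (auto simp: e_def)
    then have "(\<Sum>I=1..n. \<Sum>J=1..n. e I J * (c J * (norm (a J))\<^sup>2)) =
        (\<Sum>J=1..n. \<Sum>I=1..n. e J I * (c J * (norm (a J))\<^sup>2))"
      by (subst sum.swap) (intro sum.cong refl arg_cong2[where f="(*)"], blast)
    then show ?thesis using s7 by simp
  qed
  have s9: "(\<Sum>I=1..n. \<Sum>J=1..n. e I J * c I * (a I \<bullet> a J)) = Q T"
  proof -
    have "(\<Sum>J=1..n. e I J * c I * (a I \<bullet> a J)) = a I \<bullet> group_mean T (G I)" for I
    proof -
      have "(\<Sum>J=1..n. e I J * c I * (a I \<bullet> a J)) = a I \<bullet> (c I *\<^sub>R (\<Sum>J=1..n. of_bool (G J = G I) *\<^sub>R a J))"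
        by (auto simp: inner_sum_right scaleR_sum_right e_def mult_ac intro!: sum.cong)
      then show ?thesis by (simp add: group_mean_def a_def c_def)
    qed
    then show ?thesis unfolding a_def by (simp add: sum_inner_group Q_eq power2_norm_eq_inner)
  qed
  have "(\<Sum>I=1..n. \<Sum>J=1..n. (norm (jump T I J))\<^sup>2) =
    2 * (real n * (\<Sum>I=1..n. c I * (norm (a I))\<^sup>2)) + 2 * (real CARD('m) * A) - 4 * A + 4 * Q T"
    by (simp only: pt sum.distrib sum_subtractf double_sum_mult s1 s2 s3 s4 s5 s6 s7 s8 s9)
  then show ?thesis by (simp add: c_def a_def A_def algebra_simps)
qed

text \<open>
  Expanding the square, every mixed term with a free index vanishes, since the scores and the group
  means both add up to zero; what remains has leading part \<open>4 n Q\<close>.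
\<close>
lemma sum_inner_jump:
  assumes T: "T permutes {1..n}"
  shows "(\<Sum>I=1..n. \<Sum>J=1..n. (dev T \<bullet> jump T I J)\<^sup>2) =
    2 * (\<Sum>i\<in>UNIV. size i * (\<Sum>s=1..n. (\<alpha> s \<bullet> group_mean T i)\<^sup>2))
    + 2 * real n * (\<Sum>I=1..n. (\<alpha> (T I) \<bullet> group_mean T (G I))\<^sup>2)
    + 2 * (\<Sum>i\<in>UNIV. \<Sum>j\<in>UNIV. size i * size j * (group_mean T i \<bullet> group_mean T j)\<^sup>2) + 2 * (Q T)\<^sup>2"
proof -
  define x where "x J I = \<alpha> (T J) \<bullet> group_mean T (G I)" for I J
  have x1: "(\<Sum>J=1..n. x J I) = 0" for I
    unfolding x_def inner_sum_left[symmetric] sum_scores[OF T] by simp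
  have x2: "(\<Sum>I=1..n. x J I) = 0" for J
    unfolding x_def inner_sum_right[symmetric] sum_group_mean[OF T] by simp
  have pt: "(dev T \<bullet> jump T I J)\<^sup>2 = (x J I)\<^sup>2 + (x I J)\<^sup>2 + (x I I)\<^sup>2 + (x J J)\<^sup>2
      + 2 * (x J I * x I J) + 2 * (x I I * x J J) - 2 * (x I I * x J I) - 2 * (x J J * x J I) 
      - 2 * (x I I * x I J) - 2 * (x J J * x I J)" for I J
  proof -
    have "dev T \<bullet> jump T I J = x J I + x I J - x I I - x J J"
      unfolding dev_inner_jump x_def by (simp add: inner_diff_left inner_diff_right inner_commute)
    moreover have "(p + q - r - t)\<^sup>2 = p\<^sup>2 + q\<^sup>2 + r\<^sup>2 + t\<^sup>2 + 2 * (p * q) + 2 * (r * t)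
        - 2 * (r * p) - 2 * (t * p) - 2 * (r * q) - 2 * (t * q)" for p q r t :: real
      by (simp add: power2_eq_square algebra_simps)
    ultimately show ?thesis by simp
  qed
  have s1: "(\<Sum>I=1..n. \<Sum>J=1..n. (x J I)\<^sup>2) = (\<Sum>i\<in>UNIV. size i * (\<Sum>s=1..n. (\<alpha> s \<bullet> group_mean T i)\<^sup>2))"
    unfolding x_def by (subst sum_permuted[OF T, of "\<lambda>s. (\<alpha> s \<bullet> _)\<^sup>2"]) (rule sum_by_group[of "\<lambda>i. \<Sum>s=1..n. (\<alpha> s \<bullet> group_mean T i)\<^sup>2", unfolded real_scaleR_def])
  have s2: "(\<Sum>I=1..n. \<Sum>J=1..n. (x I J)\<^sup>2) = (\<Sum>i\<in>UNIV. size i * (\<Sum>s=1..n. (\<alpha> s \<bullet> group_mean T i)\<^sup>2))"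
    using s1 by (subst sum.swap)
  have s3: "(\<Sum>I=1..n. \<Sum>J=1..n. (x I I)\<^sup>2) = real n * (\<Sum>I=1..n. (x I I)\<^sup>2)"
    by (simp add: sum_distrib_left)
  have s4: "(\<Sum>I=1..n. \<Sum>J=1..n. (x J J)\<^sup>2) = real n * (\<Sum>I=1..n. (x I I)\<^sup>2)"
    by simp
  have s5: "(\<Sum>I=1..n. \<Sum>J=1..n. x J I * x I J) =
      (\<Sum>i\<in>UNIV. \<Sum>j\<in>UNIV. size i * size j * (group_mean T i \<bullet> group_mean T j)\<^sup>2)"
  proof -
    let ?u = "group_mean T"
    have 1: "(\<Sum>J=1..n. x J I * x I J) = (\<Sum>j\<in>UNIV. size j * (?u j \<bullet> ?u (G I)) * (\<alpha> (T I) \<bullet> ?u j))" for I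
    proof -
      have "(\<Sum>J=1..n. x J I * x I J) = (\<Sum>J=1..n. \<alpha> (T J) \<bullet> ((\<alpha> (T I) \<bullet> ?u (G J)) *\<^sub>R ?u (G I)))"
        by (simp add: x_def mult_ac)
      also have "\<dots> = (\<Sum>j\<in>UNIV. size j * (?u j \<bullet> ((\<alpha> (T I) \<bullet> ?u j) *\<^sub>R ?u (G I))))"
        by (rule sum_inner_group)
      finally show ?thesis by (simp add: mult_ac)
    qed
    have "(\<Sum>I=1..n. \<Sum>J=1..n. x J I * x I J) =
        (\<Sum>j\<in>UNIV. \<Sum>I=1..n. \<alpha> (T I) \<bullet> ((size j * (?u j \<bullet> ?u (G I))) *\<^sub>R ?u j))"
      unfolding 1 by (subst sum.swap) (simp add: mult_ac)
    also have "\<dots> = (\<Sum>j\<in>UNIV. \<Sum>i\<in>UNIV. size i * (?u i \<bullet> ((size j * (?u j \<bullet> ?u i)) *\<^sub>R ?u j)))"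
      by (intro sum.cong refl) (rule sum_inner_group)
    also have "\<dots> = (\<Sum>i\<in>UNIV. \<Sum>j\<in>UNIV. size i * size j * (?u i \<bullet> ?u j)\<^sup>2)"
      by (subst sum.swap) (simp add: power2_eq_square inner_commute mult_ac)
    finally show ?thesis .
  qed
  have s6: "(\<Sum>I=1..n. \<Sum>J=1..n. x I I * x J J) = (Q T)\<^sup>2"
  proof -
    have "(\<Sum>I=1..n. x I I) = Q T"
      unfolding x_def Q_eq by (simp add: sum_inner_group power2_norm_eq_inner)
    then show ?thesis by (simp add: sum_product[symmetric] power2_eq_square)
  qed
  have s7: "(\<Sum>I=1..n. \<Sum>J=1..n. x I I * x J I) = 0"
    by (simp only: sum_distrib_left[symmetric] x1) simp
  have s8: "(\<Sum>I=1..n. \<Sum>J=1..n. x J J * x J I) = 0"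
    by (subst sum.swap) (simp only: sum_distrib_left[symmetric] x2, simp)
  have s9: "(\<Sum>I=1..n. \<Sum>J=1..n. x I I * x I J) = 0"
    by (simp only: sum_distrib_left[symmetric] x2) simp
  have s10: "(\<Sum>I=1..n. \<Sum>J=1..n. x J J * x I J) = 0"
    by (subst sum.swap) (simp only: sum_distrib_left[symmetric] x1, simp)
  show ?thesis
    by (simp only: pt sum.distrib sum_subtractf double_sum_mult s1 s2 s3 s4 s5 s6 s7 s8 s9 s10)
       (simp add: x_def)
qed

lemma sum_cross_le: "(\<Sum>i\<in>UNIV. \<Sum>j\<in>UNIV. size i * size j * (group_mean T i \<bullet> group_mean T j)\<^sup>2) \<le> (Q T)\<^sup>2"
proof -
  have "(group_mean T i \<bullet> group_mean T j)\<^sup>2 \<le> (norm (group_mean T i))\<^sup>2 * (norm (group_mean T j))\<^sup>2" for i j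
    using Cauchy_Schwarz_ineq by (simp add: power2_norm_eq_inner)
  then have "(\<Sum>i\<in>UNIV. \<Sum>j\<in>UNIV. size i * size j * (group_mean T i \<bullet> group_mean T j)\<^sup>2) \<le>
      (\<Sum>i\<in>UNIV. \<Sum>j\<in>UNIV. (size i * (norm (group_mean T i))\<^sup>2) * (size j * (norm (group_mean T j))\<^sup>2))"
    by (intro sum_mono) (auto intro!: mult_left_mono simp: mult_ac)
  also have "\<dots> = (Q T)\<^sup>2" by (simp add: Q_eq sum_product power2_eq_square)
  finally show ?thesis .
qed

end

section \<open>Stein equation for the Laplace transform\<close>

lemma mult_exp_neg_le: "s > 0 \<Longrightarrow> q \<ge> 0 \<Longrightarrow> q * exp (- s * q) \<le> 1 / s" for s q :: real
  using order_trans[OF _ exp_ge_add_one_self[of "s * q"], of "s * q"] by (simp add: exp_minus field_simps)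

lemma square_mult_exp_neg_le: 
  fixes s q :: real
  assumes "s > 0" "q \<ge> 0" shows "q\<^sup>2 * exp (- s * q) \<le> 2 / s\<^sup>2"
proof -
  have "(s * q)\<^sup>2 \<le> 2 * exp (s * q)"
    proof -
    have "0 \<le> s * q" using assms by simp
    then show ?thesis using exp_lower_Taylor_quadratic[of "s * q"] by linarith
  qed
  then show ?thesis using assms by (simp add: exp_minus field_simps power_mult_distrib)
qed

text \<open>
  A sample sum without replacement deviates from its mean by the order of the square root of the
  number of positions; the second moment comes from the exchangeable pair.
\<close>
lemma perm_mean_abs_centred_le:
  fixes \<beta> :: "nat \<Rightarrow> real"
  assumes n: "n > 0" and b: "\<And>s. s \<in> {1..n} \<Longrightarrow> \<bar>\<beta> s\<bar> \<le> b" and b0: "b > 0"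
    and c: "\<And>I. c I \<in> {0, 1::real}"
  shows "perm_mean n (\<lambda>T. \<bar>(\<Sum>I=1..n. c I * \<beta> (T I)) - (\<Sum>I=1..n. c I) / real n * (\<Sum>s=1..n. \<beta> s)\<bar>)
    \<le> b * sqrt (real n)"
proof -
  define B where "B I s = c I * (\<beta> s - (\<Sum>s=1..n. \<beta> s) / real n)" for I s
  have B0: "(\<Sum>I=1..n. \<Sum>s=1..n. B I s) = 0"
    using n by (simp add: B_def sum_distrib_left[symmetric] sum_subtractf)
  have S: "comb_sum n B T = (\<Sum>I=1..n. c I * \<beta> (T I)) - (\<Sum>I=1..n. c I) / real n * (\<Sum>s=1..n. \<beta> s)" for T
    by (simp add: comb_sum_def B_def right_diff_distrib sum_subtractf sum_distrib_right[symmetric] sum_divide_distrib[symmetric])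
  have j: "swap_jump B T I J = (c I - c J) * (\<beta> (T J) - \<beta> (T I))" for T I J
    by (simp add: swap_jump_def B_def algebra_simps)
  have "perm_mean n (\<lambda>T. (norm (comb_sum n B T))\<^sup>2) \<le> real n * b\<^sup>2"
  proof (rule perm_mean_norm_square_le[OF B0 n])
    fix T assume T: "T permutes {1..n}"
    have "(norm (swap_jump B T I J))\<^sup>2 \<le> 4 * b\<^sup>2" if "I \<in> {1..n}" "J \<in> {1..n}" for I J
    proof -
      have "T I \<in> {1..n}" "T J \<in> {1..n}" using permutes_in_image[OF T] that by auto
      then have "\<bar>\<beta> (T J) - \<beta> (T I)\<bar> \<le> 2 * b" using b[of "T I"] b[of "T J"] by linarith
      moreover have "\<bar>c I - c J\<bar> \<le> 1" using c[of I] c[of J] by auto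
      ultimately have "\<bar>swap_jump B T I J\<bar> \<le> 1 * (2 * b)"
        unfolding j abs_mult using b0 by (intro mult_mono) auto
      then have "\<bar>swap_jump B T I J\<bar>\<^sup>2 \<le> (2 * b)\<^sup>2" by (intro power_mono) auto
      then show ?thesis by (simp add: power_mult_distrib)
    qed
    then have "(\<Sum>I=1..n. \<Sum>J=1..n. (norm (swap_jump B T I J))\<^sup>2) \<le> (\<Sum>I=1..n. \<Sum>J=1..n. 4 * b\<^sup>2)"
      by (intro sum_mono) auto
    also have "\<dots> = 4 * real n * (real n * b\<^sup>2)" by simp
    finally show "(\<Sum>I=1..n. \<Sum>J=1..n. (norm (swap_jump B T I J))\<^sup>2) \<le> 4 * real n * (real n * b\<^sup>2)" .
  qed
  then have m: "perm_mean n (\<lambda>T. (comb_sum n B T)\<^sup>2) \<le> real n * b\<^sup>2" by simp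
  define l where "l = b * sqrt (real n)"
  have l: "l > 0" "l\<^sup>2 = real n * b\<^sup>2" using b0 n by (auto simp: l_def power_mult_distrib)
  have "perm_mean n (\<lambda>T. \<bar>comb_sum n B T\<bar>) \<le> perm_mean n (\<lambda>T. (1 / (2 * l)) * (comb_sum n B T)\<^sup>2 + l / 2)"
  proof (rule perm_mean_mono)
    fix T
    have "0 \<le> (\<bar>comb_sum n B T\<bar> - l)\<^sup>2" by simp
    also have "\<dots> = (comb_sum n B T)\<^sup>2 + l\<^sup>2 - 2 * l * \<bar>comb_sum n B T\<bar>"
      by (simp add: power2_diff)
    finally show "\<bar>comb_sum n B T\<bar> \<le> (1 / (2 * l)) * (comb_sum n B T)\<^sup>2 + l / 2"
      using l(1) by (simp add: field_simps power2_eq_square)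
  qed
  also have "\<dots> = (1 / (2 * l)) * perm_mean n (\<lambda>T. (comb_sum n B T)\<^sup>2) + l / 2"
    unfolding perm_mean_add perm_mean_cmult perm_mean_const ..
  also have "\<dots> \<le> (1 / (2 * l)) * l\<^sup>2 + l / 2" using m l by (simp add: divide_right_mono)
  also have "\<dots> = l" using l(1) by (simp add: field_simps power2_eq_square)
  finally show ?thesis by (simp add: S l_def)
qed

text \<open>
  The bound \<open>gram\<close> says that the scores are nearly white on their span. There, \<open>C\<close> bounds the scores
  and \<open>\<rho>\<close> the relative group sizes from below.
\<close>
locale bounded_scores = grouped_scores n G \<alpha>
  for n and G :: "nat \<Rightarrow> 'm::finite" and \<alpha> :: "nat \<Rightarrow> 'a::euclidean_space" +
  fixes C \<rho> \<epsilon> :: real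
  assumes C: "C > 0" "\<And>s. s \<in> {1..n} \<Longrightarrow> norm (\<alpha> s) \<le> C"
    and \<rho>: "\<rho> > 0" "\<And>i. size i \<ge> \<rho> * real n"
    and gram: "\<And>x. x \<in> span (\<alpha> ` {1..n}) \<Longrightarrow>
      \<bar>(\<Sum>s=1..n. (\<alpha> s \<bullet> x)\<^sup>2) - real n * (norm x)\<^sup>2\<bar> \<le> real n * \<epsilon> * (norm x)\<^sup>2"
begin

definition mean_square :: real where
  "mean_square = (\<Sum>s=1..n. (norm (\<alpha> s))\<^sup>2) / real n"

text \<open>
  Entries of the difference between the second-moment matrix of the scores in group \<open>i\<close> and its mean
  over permutations.
\<close>
definition resid :: "(nat \<Rightarrow> nat) \<Rightarrow> 'm \<Rightarrow> 'a \<Rightarrow> 'a \<Rightarrow> real" where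
  "resid T i b b' = (\<Sum>l=1..n. of_bool (G l = i) * ((\<alpha> (T l) \<bullet> b) * (\<alpha> (T l) \<bullet> b')))
      - size i / real n * (\<Sum>s=1..n. (\<alpha> s \<bullet> b) * (\<alpha> s \<bullet> b'))"

definition group_resid :: "(nat \<Rightarrow> nat) \<Rightarrow> 'm \<Rightarrow> real" where
  "group_resid T i = (\<Sum>b\<in>Basis. \<Sum>b'\<in>Basis. \<bar>resid T i b b'\<bar>)"

definition total_resid :: "(nat \<Rightarrow> nat) \<Rightarrow> real" where
  "total_resid T = (\<Sum>i\<in>UNIV. group_resid T i)"

lemma group_resid_nonneg: "group_resid T i \<ge> 0" by (simp add: group_resid_def sum_nonneg)

lemma group_resid_le: "group_resid T i \<le> total_resid T"
  unfolding total_resid_def by (rule member_le_sum) (auto simp: group_resid_nonneg)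

lemma total_resid_nonneg: "total_resid T \<ge> 0" by (simp add: total_resid_def sum_nonneg group_resid_nonneg)

lemma mean_total_resid:
  "perm_mean n total_resid \<le> real CARD('m) * real DIM('a)^2 * C\<^sup>2 * sqrt (real n)"
proof -
  have "perm_mean n (\<lambda>T. \<bar>resid T i b b'\<bar>) \<le> C\<^sup>2 * sqrt (real n)" if "b \<in> Basis" "b' \<in> Basis" for i b b'
    unfolding resid_def size_def
  proof (rule perm_mean_abs_centred_le[where \<beta>="\<lambda>s. (\<alpha> s \<bullet> b) * (\<alpha> s \<bullet> b')"])
    fix s assume s: "s \<in> {1..n}"
    have "\<bar>\<alpha> s \<bullet> b\<bar> \<le> C" "\<bar>\<alpha> s \<bullet> b'\<bar> \<le> C"
      using Basis_le_norm[OF that(1), of "\<alpha> s"] Basis_le_norm[OF that(2), of "\<alpha> s"] C(2)[OF s] by auto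
    then show "\<bar>(\<alpha> s \<bullet> b) * (\<alpha> s \<bullet> b')\<bar> \<le> C\<^sup>2"
      unfolding abs_mult power2_eq_square using C(1) by (intro mult_mono) auto
  qed (use n_pos C in auto)
  then have "(\<Sum>i\<in>UNIV. \<Sum>b\<in>Basis. \<Sum>b'\<in>Basis. perm_mean n (\<lambda>T. \<bar>resid T (i::'m) b b'\<bar>)) \<le>
      (\<Sum>i\<in>(UNIV::'m set). \<Sum>b\<in>(Basis::'a set). \<Sum>b'\<in>(Basis::'a set). C\<^sup>2 * sqrt (real n))"
    by (intro sum_mono) auto
  also have "\<dots> = real CARD('m) * real DIM('a)^2 * C\<^sup>2 * sqrt (real n)"
    by (simp add: power2_eq_square)
  finally show ?thesis unfolding total_resid_def group_resid_def by (simp add: perm_mean_sum)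
qed

lemma group_mean_span: "T permutes {1..n} \<Longrightarrow> group_mean T i \<in> span (\<alpha> ` {1..n})"
  unfolding group_mean_def
  by (intro span_scale span_sum span_base imageI) (use permutes_in_image in fastforce)

lemma inner_square_expand: "(a \<bullet> u)\<^sup>2 = (\<Sum>b\<in>Basis. \<Sum>b'\<in>Basis. (u \<bullet> b) * (u \<bullet> b') * ((a \<bullet> b) * (a \<bullet> b')))"
  for a u :: 'a
  by (subst euclidean_inner) (simp add: power2_eq_square sum_product mult_ac)

lemma group_second_moment:
  "\<bar>(\<Sum>l=1..n. of_bool (G l = i) * (\<alpha> (T l) \<bullet> u)\<^sup>2) - size i / real n * (\<Sum>s=1..n. (\<alpha> s \<bullet> u)\<^sup>2)\<bar>
    \<le> (norm u)\<^sup>2 * group_resid T i"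
proof -
  have "(\<Sum>l=1..n. of_bool (G l = i) * (\<alpha> (T l) \<bullet> u)\<^sup>2) - size i / real n * (\<Sum>s=1..n. (\<alpha> s \<bullet> u)\<^sup>2) =
      (\<Sum>b\<in>Basis. \<Sum>b'\<in>Basis. (u \<bullet> b) * (u \<bullet> b') * resid T i b b')"
  proof -
    have 1: "(\<Sum>l=1..n. k l * (f l \<bullet> u)\<^sup>2) =
      (\<Sum>b\<in>Basis. \<Sum>b'\<in>Basis. (u \<bullet> b) * (u \<bullet> b') * (\<Sum>l=1..n. k l * ((f l \<bullet> b) * (f l \<bullet> b'))))" 
      for k and f :: "nat \<Rightarrow> 'a"
      unfolding inner_square_expand[of _ u] sum_distrib_left
      by (subst sum.swap, intro sum.cong refl, subst sum.swap, intro sum.cong refl) simp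
    have 2: "(\<Sum>s=1..n. (\<alpha> s \<bullet> u)\<^sup>2) = (\<Sum>b\<in>Basis. \<Sum>b'\<in>Basis. (u \<bullet> b) * (u \<bullet> b') * (\<Sum>s=1..n. (\<alpha> s \<bullet> b) * (\<alpha> s \<bullet> b')))"
      using 1[of "\<lambda>_. 1" \<alpha>] by simp
    show ?thesis
      unfolding 1 2 resid_def by (simp add: right_diff_distrib sum_subtractf sum_distrib_left mult_ac)
  qed
  also have "\<bar>\<dots>\<bar> \<le> (\<Sum>b\<in>Basis. \<Sum>b'\<in>Basis. \<bar>(u \<bullet> b) * (u \<bullet> b') * resid T i b b'\<bar>)"
    by (rule order_trans[OF sum_abs], rule sum_mono, rule sum_abs)
  also have "\<dots> \<le> (\<Sum>b\<in>Basis. \<Sum>b'\<in>Basis. (norm u)\<^sup>2 * \<bar>resid T i b b'\<bar>)"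
    unfolding abs_mult power2_eq_square
    by (intro sum_mono mult_right_mono mult_mono) (auto simp: Basis_le_norm)
  finally show ?thesis by (simp add: group_resid_def sum_distrib_left)
qed

lemma group_norm_moment:
  "\<bar>(\<Sum>l=1..n. of_bool (G l = i) * (norm (\<alpha> (T l)))\<^sup>2) - size i * mean_square\<bar> \<le> group_resid T i"
proof -
  have 1: "(norm a)\<^sup>2 = (\<Sum>b\<in>Basis. (a \<bullet> b) * (a \<bullet> b))" for a :: 'a
    unfolding power2_norm_eq_inner by (rule euclidean_inner)
  have "(\<Sum>l=1..n. of_bool (G l = i) * (norm (\<alpha> (T l)))\<^sup>2) - size i * mean_square = (\<Sum>b\<in>Basis. resid T i b b)"
  proof -
    have "(\<Sum>l=1..n. of_bool (G l = i) * (norm (\<alpha> (T l)))\<^sup>2) =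
        (\<Sum>b\<in>Basis. \<Sum>l=1..n. of_bool (G l = i) * ((\<alpha> (T l) \<bullet> b) * (\<alpha> (T l) \<bullet> b)))"
      unfolding 1 sum_distrib_left by (rule sum.swap)
    moreover have "(\<Sum>s=1..n. (norm (\<alpha> s))\<^sup>2) = (\<Sum>b\<in>Basis. \<Sum>s=1..n. (\<alpha> s \<bullet> b) * (\<alpha> s \<bullet> b))"
      unfolding 1 by (rule sum.swap)
    ultimately show ?thesis
      unfolding mean_square_def resid_def by (simp add: sum_subtractf sum_distrib_left sum_divide_distrib)
  qed
  also have "\<bar>\<dots>\<bar> \<le> (\<Sum>b\<in>Basis. \<bar>resid T i b b\<bar>)" by (rule sum_abs)
  also have "\<dots> \<le> group_resid T i"
    unfolding group_resid_def by (intro sum_mono member_le_sum) auto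
  finally show ?thesis .
qed

lemma size_quot: "x \<ge> 0 \<Longrightarrow> x / size i \<le> x / (\<rho> * real n)"
  using \<rho> n_pos size_pos[of i] by (intro divide_left_mono) auto

text \<open>
  The averaged quadratic form of the jump is, up to small terms, what a projection of trace
  \<open>(m - 1) mean_square\<close> fixing the statistic would give.
\<close>
lemma conditional_variance:
  assumes T: "T permutes {1..n}" and s: "s > 0"
  shows "\<bar>(\<Sum>I=1..n. \<Sum>J=1..n. (norm (jump T I J))\<^sup>2 - 2 * s * (dev T \<bullet> jump T I J)\<^sup>2) / (4 * real n)
     - ((real CARD('m) - 1) * mean_square - 2 * s * Q T)\<bar>
    \<le> total_resid T / (2 * \<rho> * real n) + Q T / real n
      + s * (2 * \<epsilon> * Q T + Q T * total_resid T / (\<rho> * real n) + 2 * (Q T)\<^sup>2 / real n)"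
proof -
  let ?u = "group_mean T"
  define W where "W = (\<Sum>I=1..n. (norm (\<alpha> (T I)))\<^sup>2 / size (G I))"
  define X1 where "X1 = (\<Sum>i\<in>UNIV. size i * (\<Sum>s=1..n. (\<alpha> s \<bullet> ?u i)\<^sup>2))"
  define X2 where "X2 = (\<Sum>I=1..n. (\<alpha> (T I) \<bullet> ?u (G I))\<^sup>2)"
  define X3 where "X3 = (\<Sum>i\<in>UNIV. \<Sum>j\<in>UNIV. size i * size j * (?u i \<bullet> ?u j)\<^sup>2)"
  define R where "R = total_resid T"
  have by_group: "(\<Sum>I=1..n. f I (G I)) = (\<Sum>i\<in>UNIV. \<Sum>l=1..n. of_bool (G l = i) * f l i)" 
    for f :: "nat \<Rightarrow> 'm \<Rightarrow> real"
    by (subst sum.swap) (simp add: of_bool_def if_distrib[of "\<lambda>c. c * _"] cong: if_cong)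
  have W: "\<bar>W - real CARD('m) * mean_square\<bar> \<le> R / (\<rho> * real n)"
  proof -
    have "W - real CARD('m) * mean_square =
      (\<Sum>i\<in>UNIV. ((\<Sum>l=1..n. of_bool (G l = i) * (norm (\<alpha> (T l)))\<^sup>2) - size i * mean_square) / size i)"
      unfolding W_def by_group[of "\<lambda>I i. (norm (\<alpha> (T I)))\<^sup>2 / size i"]
      by (simp add: diff_divide_distrib sum_subtractf sum_divide_distrib del: sum_mult_of_bool_eq sum_of_bool_mult_eq)
    also have "\<bar>\<dots>\<bar> \<le> (\<Sum>i\<in>UNIV. group_resid T i / (\<rho> * real n))"
    proof (rule order_trans[OF sum_abs], rule sum_mono)
      fix i
      have "\<bar>((\<Sum>l=1..n. of_bool (G l = i) * (norm (\<alpha> (T l)))\<^sup>2) - size i * mean_square) / size i\<bar> 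
         \<le> group_resid T i / size i"
        using group_norm_moment[of i T] size_pos[of i] by (simp add: divide_right_mono)
      then show "\<bar>((\<Sum>l=1..n. of_bool (G l = i) * (norm (\<alpha> (T l)))\<^sup>2) - size i * mean_square) / size i\<bar>
         \<le> group_resid T i / (\<rho> * real n)"
        using size_quot[OF group_resid_nonneg] order_trans by blast
    qed
    finally show ?thesis by (simp add: R_def total_resid_def sum_divide_distrib)
  qed
  have X1: "\<bar>X1 - real n * Q T\<bar> \<le> real n * \<epsilon> * Q T"
  proof -
    have eq: "X1 - real n * Q T = (\<Sum>i\<in>UNIV. size i * ((\<Sum>s=1..n. (\<alpha> s \<bullet> ?u i)\<^sup>2) - real n * (norm (?u i))\<^sup>2))"
      unfolding X1_def Q_eq by (simp add: right_diff_distrib sum_subtractf sum_distrib_left mult_ac)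
    have "\<bar>X1 - real n * Q T\<bar> \<le> (\<Sum>i\<in>UNIV. size i * (real n * \<epsilon> * (norm (?u i))\<^sup>2))"
      unfolding eq
    proof (rule order_trans[OF sum_abs], rule sum_mono)
      fix i
      show "\<bar>size i * ((\<Sum>s=1..n. (\<alpha> s \<bullet> ?u i)\<^sup>2) - real n * (norm (?u i))\<^sup>2)\<bar> \<le> size i * (real n * \<epsilon> * (norm (?u i))\<^sup>2)"
        unfolding abs_mult using mult_left_mono[OF gram[OF group_mean_span[OF T]] size_nonzero(2)] by simp
    qed
    also have "\<dots> = real n * \<epsilon> * Q T" unfolding Q_eq sum_distrib_left by (intro sum.cong refl) simp
    finally show ?thesis .
  qed
  have X2: "\<bar>X2 - X1 / real n\<bar> \<le> Q T * R / (\<rho> * real n)"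
  proof -
    have eq: "X2 - X1 / real n = (\<Sum>i\<in>UNIV. (\<Sum>l=1..n. of_bool (G l = i) * (\<alpha> (T l) \<bullet> ?u i)\<^sup>2)
         - size i / real n * (\<Sum>s=1..n. (\<alpha> s \<bullet> ?u i)\<^sup>2))"
      unfolding X2_def X1_def by_group[of "\<lambda>I i. (\<alpha> (T I) \<bullet> ?u i)\<^sup>2"]
      by (simp add: sum_subtractf sum_divide_distrib)
    have "\<bar>X2 - X1 / real n\<bar> \<le> (\<Sum>i\<in>UNIV. (size i * (norm (?u i))\<^sup>2) * (R / (\<rho> * real n)))"
      unfolding eq
    proof (rule order_trans[OF sum_abs], rule sum_mono)
      fix i
      have "\<bar>(\<Sum>l=1..n. of_bool (G l = i) * (\<alpha> (T l) \<bullet> ?u i)\<^sup>2) - size i / real n * (\<Sum>s=1..n. (\<alpha> s \<bullet> ?u i)\<^sup>2)\<bar>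
          \<le> (norm (?u i))\<^sup>2 * group_resid T i" by (rule group_second_moment)
      also have "\<dots> \<le> (norm (?u i))\<^sup>2 * R"
        unfolding R_def by (intro mult_left_mono group_resid_le) auto
      also have "\<dots> = (size i * (norm (?u i))\<^sup>2) * (R / size i)" by simp
      also have "\<dots> \<le> (size i * (norm (?u i))\<^sup>2) * (R / (\<rho> * real n))"
        by (intro mult_left_mono size_quot) (auto simp: R_def total_resid_nonneg)
      finally show "\<bar>(\<Sum>l=1..n. of_bool (G l = i) * (\<alpha> (T l) \<bullet> ?u i)\<^sup>2) - size i / real n * (\<Sum>s=1..n. (\<alpha> s \<bullet> ?u i)\<^sup>2)\<bar>
          \<le> (size i * (norm (?u i))\<^sup>2) * (R / (\<rho> * real n))" .
    qed
    also have "\<dots> = Q T * R / (\<rho> * real n)" unfolding Q_eq sum_distrib_right[symmetric] by simp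
    finally show ?thesis .
  qed
  have X3: "0 \<le> X3" "X3 \<le> (Q T)\<^sup>2"
    unfolding X3_def using sum_cross_le by (auto intro!: sum_nonneg)
  have n0: "real n > 0" using n_pos by simp
  have total: "(\<Sum>I=1..n. \<Sum>J=1..n. (norm (jump T I J))\<^sup>2 - 2 * s * (dev T \<bullet> jump T I J)\<^sup>2)
      = (2 * real n * W + (2 * real CARD('m) - 4) * (real n * mean_square) + 4 * Q T)
        - 2 * s * (2 * X1 + 2 * real n * X2 + 2 * X3 + 2 * (Q T)\<^sup>2)"
    unfolding sum_subtractf double_sum_mult sum_norm_jump[OF T] sum_inner_jump[OF T]
    using n0 by (simp add: W_def X1_def X2_def X3_def mean_square_def)
  have main: "(\<Sum>I=1..n. \<Sum>J=1..n. (norm (jump T I J))\<^sup>2 - 2 * s * (dev T \<bullet> jump T I J)\<^sup>2) / (4 * real n)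
      - ((real CARD('m) - 1) * mean_square - 2 * s * Q T)
      = (W - real CARD('m) * mean_square) / 2 + Q T / real n
        - s * ((X1 / real n - Q T) * 2 + (X2 - X1 / real n) + X3 / real n + (Q T)\<^sup>2 / real n)"
  proof -
    have aux: "((2 * N * w + (2 * m - 4) * (N * t) + 4 * q) - 2 * s * (2 * x1 + 2 * N * x2 + 2 * x3 + 2 * qq)) / (4 * N)
        - ((m - 1) * t - 2 * s * q) = (w - m * t) / 2 + q / N
        - s * ((x1 / N - q) * 2 + (x2 - x1 / N) + x3 / N + qq / N)" if "N > 0"
      for N w m t q x1 x2 x3 qq :: real
      using that by (simp add: field_simps)
    show ?thesis unfolding total by (rule aux[OF n0])
  qed
  have w: "\<bar>(W - real CARD('m) * mean_square) / 2\<bar> \<le> R / (2 * \<rho> * real n)"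
    using W by simp
  have x1: "\<bar>X1 / real n - Q T\<bar> \<le> \<epsilon> * Q T"
  proof -
    have "X1 / real n - Q T = (X1 - real n * Q T) / real n" using n0 by (simp add: field_simps)
    moreover have "\<bar>X1 - real n * Q T\<bar> / real n \<le> real n * \<epsilon> * Q T / real n"
      using X1 by (rule divide_right_mono) simp
    ultimately show ?thesis using n0 by (simp add: abs_divide)
  qed
  have x3: "0 \<le> X3 / real n" "X3 / real n \<le> (Q T)\<^sup>2 / real n" 
    using X3 n0 by (auto simp: divide_right_mono)
  have "\<bar>(X1 / real n - Q T) * 2 + (X2 - X1 / real n) + X3 / real n + (Q T)\<^sup>2 / real n\<bar>
      \<le> 2 * (\<epsilon> * Q T) + Q T * R / (\<rho> * real n) + 2 * ((Q T)\<^sup>2 / real n)"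
  proof -
    have "\<bar>a * 2 + b + c + d\<bar> \<le> 2 * p + r + 2 * d" if "\<bar>a\<bar> \<le> p" "\<bar>b\<bar> \<le> r" "0 \<le> c" "c \<le> d" for a b c d p r :: real
      using that by linarith
    from this[OF x1 X2 x3] show ?thesis .
  qed
  then have "s * \<bar>(X1 / real n - Q T) * 2 + (X2 - X1 / real n) + X3 / real n + (Q T)\<^sup>2 / real n\<bar>
      \<le> s * (2 * (\<epsilon> * Q T) + Q T * R / (\<rho> * real n) + 2 * ((Q T)\<^sup>2 / real n))"
    using s by (intro mult_left_mono) auto
  then have y: "\<bar>s * ((X1 / real n - Q T) * 2 + (X2 - X1 / real n) + X3 / real n + (Q T)\<^sup>2 / real n)\<bar>
      \<le> s * (2 * \<epsilon> * Q T + Q T * R / (\<rho> * real n) + 2 * (Q T)\<^sup>2 / real n)"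
    using s by (simp add: abs_mult mult.assoc)
  have "0 \<le> Q T / real n" using Q_nonneg n0 by simp
  show ?thesis
  proof -
    have "\<bar>a + b - c\<bar> \<le> p + b + r" if "\<bar>a\<bar> \<le> p" "0 \<le> b" "\<bar>c\<bar> \<le> r" for a b c p r :: real
      using that by linarith
    from this[OF w _ y] show ?thesis using \<open>0 \<le> Q T / real n\<close> unfolding main R_def[symmetric] by blast
  qed
qed

lemma norm_jump_le:
  assumes T: "T permutes {1..n}" and "I \<in> {1..n}" "J \<in> {1..n}"
  shows "(norm (jump T I J))\<^sup>2 \<le> 8 * C\<^sup>2 / (\<rho> * real n)"
proof -
  have "T I \<in> {1..n}" "T J \<in> {1..n}" using permutes_in_image[OF T] assms by auto
  then have "norm (\<alpha> (T J) - \<alpha> (T I)) \<le> 2 * C"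
    using C(2)[of "T I"] C(2)[of "T J"] norm_triangle_ineq4[of "\<alpha> (T J)" "\<alpha> (T I)"] by linarith
  then have 1: "(norm (\<alpha> (T J) - \<alpha> (T I)))\<^sup>2 \<le> (2 * C)\<^sup>2" by (intro power_mono) auto
  have "1 / size (G I) + 1 / size (G J) - 2 * of_bool (G I = G J) / size (G I) \<le> 2 * (1 / (\<rho> * real n))"
  proof -
    have "2 * of_bool (G I = G J) / size (G I) \<ge> 0" by simp
    moreover have "1 / size (G I) \<le> 1 / (\<rho> * real n)" "1 / size (G J) \<le> 1 / (\<rho> * real n)"
      by (rule size_quot, simp)+
    ultimately show ?thesis by linarith
  qed
  then have "(norm (jump T I J))\<^sup>2 \<le> 2 * (1 / (\<rho> * real n)) * (2 * C)\<^sup>2"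
    unfolding norm_jump using 1 \<rho> by (intro mult_mono) auto
  then show ?thesis by (simp add: power_mult_distrib)
qed

lemma mean_Q_le: "perm_mean n Q \<le> 2 * C\<^sup>2 / \<rho>"
  unfolding Q_def
proof (rule perm_mean_norm_square_le[OF kernel_sum n_pos])
  fix T assume T: "T permutes {1..n}"
  have "(\<Sum>I=1..n. \<Sum>J=1..n. (norm (jump T I J))\<^sup>2) \<le> (\<Sum>I=1..n. \<Sum>J=1..n. 8 * C\<^sup>2 / (\<rho> * real n))"
    by (intro sum_mono norm_jump_le[OF T])
  also have "\<dots> = 4 * real n * (2 * C\<^sup>2 / \<rho>)" using n_pos by (simp add: field_simps)
  finally show "(\<Sum>I=1..n. \<Sum>J=1..n. (norm (jump T I J))\<^sup>2) \<le> 4 * real n * (2 * C\<^sup>2 / \<rho>)" .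
qed

definition err :: "real \<Rightarrow> real" where
  "err s = 3 * real CARD('m) * real DIM('a)^2 * C\<^sup>2 / (2 * \<rho> * sqrt (real n)) + 5 / (s * real n) + 2 * \<epsilon>
     + 2 * sqrt s * sqrt (8 * C\<^sup>2 / \<rho>) ^ 3 / sqrt (real n)"

text \<open>
  Combine the Stein identity, the Taylor expansion and the conditional variance; the exponential factor
  turns powers of \<open>Q\<close> in the error terms into constants.
\<close>
lemma laplace_stein:
  assumes s: "s > 0" and \<epsilon>0: "\<epsilon> \<ge> 0"
  shows "\<bar>(1 + 2 * s) * perm_mean n (\<lambda>T. Q T * exp (- s * Q T))
     - (real CARD('m) - 1) * mean_square * perm_mean n (\<lambda>T. exp (- s * Q T))\<bar> \<le> err s"
proof -
  define \<psi> where "\<psi> v = exp (- s * (norm v)\<^sup>2) *\<^sub>R v" for v :: "'a ^ 'm"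
  define S where "S T = (\<Sum>I=1..n. \<Sum>J=1..n. jump T I J \<bullet> (\<psi> (dev T + jump T I J) - \<psi> (dev T)))" for T
  define Z where "Z T = (\<Sum>I=1..n. \<Sum>J=1..n. (norm (jump T I J))\<^sup>2 - 2 * s * (dev T \<bullet> jump T I J)\<^sup>2)" for T
  have n0: "real n > 0" using n_pos by simp
  have E1: "perm_mean n (\<lambda>T. Q T * exp (- s * Q T)) = perm_mean n (\<lambda>T. S T / (4 * real n))"
  proof -
    have "perm_mean n (\<lambda>T. Q T * exp (- s * Q T)) = perm_mean n (\<lambda>T. dev T \<bullet> \<psi> (dev T))"
      by (rule perm_mean_cong) (simp add: \<psi>_def Q_def power2_norm_eq_inner)
    also have "\<dots> = perm_mean n S / (4 * real n)"
      unfolding S_def using stein_identity[OF kernel_sum n_pos, of \<psi>] .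
    also have "\<dots> = perm_mean n (\<lambda>T. (1 / (4 * real n)) * S T)"
      unfolding perm_mean_cmult by simp
    finally show ?thesis by simp
  qed
  define c3 where "c3 = 2 * sqrt s * sqrt (8 * C\<^sup>2 / \<rho>) ^ 3 / sqrt (real n)"
  have taylor: "\<bar>S T / (4 * real n) - Z T * exp (- s * Q T) / (4 * real n)\<bar> \<le> c3" if T: "T permutes {1..n}" for T
  proof -
    have "\<bar>S T - Z T * exp (- s * Q T)\<bar> =
      \<bar>\<Sum>I=1..n. \<Sum>J=1..n. jump T I J \<bullet> (\<psi> (dev T + jump T I J) - \<psi> (dev T)) -
         ((norm (jump T I J))\<^sup>2 - 2 * s * (dev T \<bullet> jump T I J)\<^sup>2) * exp (- s * (norm (dev T))\<^sup>2)\<bar>"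
      unfolding S_def Z_def Q_def sum_distrib_right sum_subtractf[symmetric] ..
    also have "\<dots> \<le> (\<Sum>I=1..n. \<Sum>J=1..n. 8 * sqrt s * norm (jump T I J) ^ 3)"
      unfolding \<psi>_def by (intro order_trans[OF sum_abs] sum_mono taylor_gauss[OF s])
    also have "\<dots> \<le> (\<Sum>I=1..n. \<Sum>J=1..n. 8 * sqrt s * sqrt (8 * C\<^sup>2 / (\<rho> * real n)) ^ 3)"
    proof (intro sum_mono mult_left_mono power_mono)
      fix I J assume "I \<in> {1..n}" "J \<in> {1..n}"
      then show "norm (jump T I J) \<le> sqrt (8 * C\<^sup>2 / (\<rho> * real n))"
        using norm_jump_le[OF T] by (simp add: real_le_rsqrt)
    qed (use s in auto)
    also have "\<dots> = real n * real n * (8 * sqrt s * sqrt (8 * C\<^sup>2 / (\<rho> * real n)) ^ 3)" by simp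
    also have "sqrt (8 * C\<^sup>2 / (\<rho> * real n)) = sqrt (8 * C\<^sup>2 / \<rho>) / sqrt (real n)"
      by (simp add: real_sqrt_divide real_sqrt_mult)
    also have "real n * real n * (8 * sqrt s * (sqrt (8 * C\<^sup>2 / \<rho>) / sqrt (real n)) ^ 3) = 4 * real n * c3"
    proof -
      have "sqrt (real n) ^ 3 = real n * sqrt (real n)" using n0 by (simp add: power3_eq_cube)
      then show ?thesis using n0 by (simp add: c3_def power_divide field_simps)
    qed
    finally have "\<bar>S T - Z T * exp (- s * Q T)\<bar> / (4 * real n) \<le> c3" using n0 by (simp add: field_simps)
    then show ?thesis using n0 by (simp add: diff_divide_distrib[symmetric] abs_divide)
  qed
  define r where "r = \<rho> * real n"
  have r: "r > 0" using \<rho> n0 by (simp add: r_def)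
  have cv: "\<bar>Z T * exp (- s * Q T) / (4 * real n) - ((real CARD('m) - 1) * mean_square - 2 * s * Q T) * exp (- s * Q T)\<bar>
      \<le> (3 / (2 * r)) * total_resid T + (5 / (s * real n) + 2 * \<epsilon>)" if T: "T permutes {1..n}" for T
  proof -
    define q where "q = Q T"
    define f where "f = exp (- s * q)"
    define R where "R = total_resid T"
    have q: "q \<ge> 0" by (simp add: q_def Q_nonneg)
    have R: "R \<ge> 0" by (simp add: R_def total_resid_nonneg)
    have f: "0 < f" "f \<le> 1" "q * f \<le> 1 / s" "q\<^sup>2 * f \<le> 2 / s\<^sup>2"
      using s q mult_exp_neg_le[OF s q] square_mult_exp_neg_le[OF s q] by (auto simp: f_def)
    have "\<bar>Z T * f / (4 * real n) - ((real CARD('m) - 1) * mean_square - 2 * s * q) * f\<bar>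
       = \<bar>Z T / (4 * real n) - ((real CARD('m) - 1) * mean_square - 2 * s * q)\<bar> * f"
    proof -
      have "Z T * f / (4 * real n) - ((real CARD('m) - 1) * mean_square - 2 * s * q) * f
        = (Z T / (4 * real n) - ((real CARD('m) - 1) * mean_square - 2 * s * q)) * f"
        by (simp add: left_diff_distrib)
      then show ?thesis using f by (simp only: abs_mult abs_of_pos)
    qed
    also have "\<dots> \<le> (R / (2 * \<rho> * real n) + q / real n + s * (2 * \<epsilon> * q + q * R / (\<rho> * real n) + 2 * q\<^sup>2 / real n)) * f"
      using conditional_variance[OF T s] f by (intro mult_right_mono) (auto simp: Z_def q_def R_def)
    also have "\<dots> = R / (2 * r) * f + (q * f) / real n + s * (2 * \<epsilon> * (q * f) + (q * f) * R / r + 2 * (q\<^sup>2 * f) / real n)"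
      by (simp add: r_def algebra_simps)
    also have "\<dots> \<le> R / (2 * r) * 1 + (1 / s) / real n + s * (2 * \<epsilon> * (1 / s) + (1 / s) * R / r + 2 * (2 / s\<^sup>2) / real n)"
      using f r R s \<epsilon>0 n0
      by (intro add_mono mult_left_mono divide_right_mono mult_right_mono) auto
    also have "\<dots> = (3 / (2 * r)) * R + (5 / (s * real n) + 2 * \<epsilon>)"
      using s r n0 by (simp add: field_simps power2_eq_square)
    finally show ?thesis by (simp add: q_def f_def R_def)
  qed
  have "perm_mean n (\<lambda>T. Q T * exp (- s * Q T)) -
      (perm_mean n (\<lambda>T. ((real CARD('m) - 1) * mean_square) * exp (- s * Q T)) - 
       perm_mean n (\<lambda>T. 2 * s * (Q T * exp (- s * Q T))))
     = perm_mean n (\<lambda>T. S T / (4 * real n) - ((real CARD('m) - 1) * mean_square - 2 * s * Q T) * exp (- s * Q T))"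
    unfolding E1 perm_mean_diff[symmetric] by (rule arg_cong[where f="perm_mean n"]) (auto simp: algebra_simps)
  then have eq: "(1 + 2 * s) * perm_mean n (\<lambda>T. Q T * exp (- s * Q T))
     - (real CARD('m) - 1) * mean_square * perm_mean n (\<lambda>T. exp (- s * Q T))
     = perm_mean n (\<lambda>T. S T / (4 * real n) - ((real CARD('m) - 1) * mean_square - 2 * s * Q T) * exp (- s * Q T))"
    unfolding perm_mean_cmult by (simp add: algebra_simps)
  have "\<bar>perm_mean n (\<lambda>T. S T / (4 * real n) - ((real CARD('m) - 1) * mean_square - 2 * s * Q T) * exp (- s * Q T))\<bar>
     \<le> perm_mean n (\<lambda>T. \<bar>S T / (4 * real n) - ((real CARD('m) - 1) * mean_square - 2 * s * Q T) * exp (- s * Q T)\<bar>)"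
    by (rule perm_mean_abs_le)
  also have "\<dots> \<le> perm_mean n (\<lambda>T. (3 / (2 * r)) * total_resid T + (5 / (s * real n) + 2 * \<epsilon> + c3))"
    using taylor cv by (intro perm_mean_mono) force
  also have "\<dots> = (3 / (2 * r)) * perm_mean n total_resid + (5 / (s * real n) + 2 * \<epsilon> + c3)"
    unfolding perm_mean_add perm_mean_cmult perm_mean_const ..
  also have "\<dots> \<le> (3 / (2 * r)) * (real CARD('m) * real DIM('a)^2 * C\<^sup>2 * sqrt (real n)) + (5 / (s * real n) + 2 * \<epsilon> + c3)"
    using mean_total_resid r by (intro add_mono mult_left_mono) auto
  also have "(3 / (2 * r)) * (real CARD('m) * real DIM('a)^2 * C\<^sup>2 * sqrt (real n)) = 
      3 * real CARD('m) * real DIM('a)^2 * C\<^sup>2 / (2 * \<rho> * sqrt (real n))"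
  proof -
    have "sqrt (real n) / r = 1 / (\<rho> * sqrt (real n))"
      using n0 \<rho> by (simp add: r_def field_simps)
    then have "3 * real CARD('m) * real DIM('a)^2 * C\<^sup>2 / 2 * (sqrt (real n) / r) = 
       3 * real CARD('m) * real DIM('a)^2 * C\<^sup>2 / 2 * (1 / (\<rho> * sqrt (real n)))" by (simp only:)
    then show ?thesis by (simp add: mult_ac)
  qed
  finally show ?thesis unfolding eq by (simp add: err_def c3_def)
qed

end

section \<open>The limiting Laplace transform\<close>

lemma perm_mean_has_derivative:
  "((\<lambda>s. perm_mean n (\<lambda>T. exp (- s * q T))) has_real_derivative
     - perm_mean n (\<lambda>T. q T * exp (- s * q T))) (at s)"
proof -
  have "((\<lambda>s. \<Sum>T | T permutes {1..n}. exp (- s * q T)) has_real_derivative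
      (\<Sum>T | T permutes {1..n}. - (q T * exp (- s * q T)))) (at s)"
    by (rule DERIV_sum) (auto intro!: derivative_eq_intros)
  from DERIV_cmult[OF this, of "1 / fact n"] show ?thesis
    unfolding perm_mean_def real_scaleR_def sum_negf by simp
qed

context bounded_scores begin

text \<open>
  Integrating factor for the differential equation of the Laplace transform. The error bound blows
  up at \<open>s = 0\<close>, so integration starts at \<open>\<delta>\<close>, where the transform is close to \<open>1\<close> because the mean of
  \<open>Q\<close> is bounded.
\<close>
lemma laplace_gap:
  assumes \<delta>: "0 < \<delta>" "\<delta> < S" and \<epsilon>0: "\<epsilon> \<ge> 0" and \<tau>: "\<tau> \<ge> 0" and K: "K = (real CARD('m) - 1) * \<tau>"
  shows "\<bar>(1 + 2 * S) powr (K / 2) * perm_mean n (\<lambda>T. exp (- S * Q T)) - 1\<bar> \<le>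
    ((1 + 2 * \<delta>) powr (K / 2) * (\<delta> * (2 * C\<^sup>2 / \<rho>)) + ((1 + 2 * \<delta>) powr (K / 2) - 1))
    + (S - \<delta>) * ((1 + 2 * S) powr (K / 2) *
       (3 * real CARD('m) * real DIM('a)^2 * C\<^sup>2 / (2 * \<rho> * sqrt (real n)) + 5 / (\<delta> * real n) + 2 * \<epsilon>
     + 2 * sqrt S * sqrt (8 * C\<^sup>2 / \<rho>) ^ 3 / sqrt (real n) + real CARD('m) * \<bar>mean_square - \<tau>\<bar>))"
    (is "_ \<le> ?start + (S - \<delta>) * (?c * ?e)")
proof -
  define L where "L s = perm_mean n (\<lambda>T. exp (- s * Q T))" for s
  define L' where "L' s = perm_mean n (\<lambda>T. Q T * exp (- s * Q T))" for s
  define H where "H s = (1 + 2 * s) powr (K / 2) * L s" for s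
  have n0: "real n > 0" using n_pos by simp
  have K0: "K \<ge> 0"
  proof -
    have "real CARD('m) \<ge> 1" using zero_less_card_finite[where 'a='m] by linarith
    then show ?thesis using \<tau> by (simp add: K)
  qed
  have L1: "L s \<le> 1" if "s > 0" for s
    unfolding L_def using perm_mean_mono[of n "\<lambda>T. exp (- s * Q T)" "\<lambda>_. 1"] that Q_nonneg
    by (simp add: perm_mean_const)
  have L0: "L s \<ge> 0" for s
    unfolding L_def using perm_mean_mono[of n "\<lambda>_. 0" "\<lambda>T. exp (- s * Q T)"] by (simp add: perm_mean_const)
  have L\<delta>: "1 - L \<delta> \<le> \<delta> * (2 * C\<^sup>2 / \<rho>)"
  proof -
    have "1 - L \<delta> = perm_mean n (\<lambda>T. 1 - exp (- \<delta> * Q T))"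
      unfolding L_def perm_mean_diff perm_mean_const ..
    also have "\<dots> \<le> perm_mean n (\<lambda>T. \<delta> * Q T)"
    proof (rule perm_mean_mono)
      fix T show "1 - exp (- \<delta> * Q T) \<le> \<delta> * Q T" using exp_ge_add_one_self[of "- \<delta> * Q T"] by simp
    qed
    also have "\<dots> = \<delta> * perm_mean n Q" by (rule perm_mean_cmult)
    also have "\<dots> \<le> \<delta> * (2 * C\<^sup>2 / \<rho>)" using mean_Q_le \<delta> by (intro mult_left_mono) auto
    finally show ?thesis .
  qed
  have dL: "(L has_real_derivative - L' s) (at s)" for s
    unfolding L_def L'_def by (rule perm_mean_has_derivative)
  have dH: "(H has_real_derivative (1 + 2 * s) powr (K / 2 - 1) * (K * L s - (1 + 2 * s) * L' s)) (at s)" if "s > 0" for s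
  proof -
    have "(1 + 2 * s) powr (K / 2) = (1 + 2 * s) powr (K / 2 - 1) * (1 + 2 * s)"
      using that by (simp add: powr_diff)
    moreover have "((\<lambda>s. (1 + 2 * s) powr (K / 2)) has_real_derivative (K * (1 + 2 * s) powr (K / 2 - 1))) (at s)"
      using that by (auto intro!: derivative_eq_intros)
    from DERIV_mult[OF this dL[of s]]
    have "(H has_real_derivative (K * (1 + 2 * s) powr (K / 2 - 1)) * L s + (- L' s) * (1 + 2 * s) powr (K / 2)) (at s)"
      unfolding H_def by simp
    ultimately show ?thesis by (simp add: algebra_simps)
  qed
  have bH: "\<bar>(1 + 2 * s) powr (K / 2 - 1) * (K * L s - (1 + 2 * s) * L' s)\<bar> \<le> ?c * ?e"
    if s: "\<delta> \<le> s" "s \<le> S" for s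
  proof -
    have s0: "s > 0" using s \<delta> by simp
    have c1: "(1 + 2 * s) powr (K / 2 - 1) \<le> ?c"
    proof -
      have "(1 + 2 * s) powr (K / 2 - 1) \<le> (1 + 2 * s) powr (K / 2)" using s0 by (intro powr_mono) auto
      also have "\<dots> \<le> ?c" using s s0 K0 by (intro powr_mono2) auto
      finally show ?thesis .
    qed
    have "err s \<le> 3 * real CARD('m) * real DIM('a)^2 * C\<^sup>2 / (2 * \<rho> * sqrt (real n)) + 5 / (\<delta> * real n) + 2 * \<epsilon>
       + 2 * sqrt S * sqrt (8 * C\<^sup>2 / \<rho>) ^ 3 / sqrt (real n)"
      unfolding err_def using s \<delta> n0 \<rho>
      by (intro add_mono divide_right_mono mult_right_mono divide_left_mono mult_left_mono) auto
    moreover have "\<bar>K * L s - (real CARD('m) - 1) * mean_square * L s\<bar> \<le> real CARD('m) * \<bar>mean_square - \<tau>\<bar>"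
    proof -
      have "K * L s - (real CARD('m) - 1) * mean_square * L s = ((real CARD('m) - 1) * L s) * (\<tau> - mean_square)"
        by (simp add: K algebra_simps)
      also have "\<bar>\<dots>\<bar> = \<bar>(real CARD('m) - 1) * L s\<bar> * \<bar>mean_square - \<tau>\<bar>" by (simp add: abs_mult abs_minus_commute)
      finally have eq: "\<bar>K * L s - (real CARD('m) - 1) * mean_square * L s\<bar> = \<bar>(real CARD('m) - 1) * L s\<bar> * \<bar>mean_square - \<tau>\<bar>" .
      have "real CARD('m) \<ge> 1" using zero_less_card_finite[where 'a='m] by linarith
      then have "\<bar>(real CARD('m) - 1) * L s\<bar> \<le> real CARD('m) * 1"
        unfolding abs_mult using L0 L1[OF s0] by (intro mult_mono) auto
      then show ?thesis unfolding eq by (intro mult_right_mono) auto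
    qed
    moreover have "\<bar>(1 + 2 * s) * L' s - (real CARD('m) - 1) * mean_square * L s\<bar> \<le> err s"
      unfolding L_def L'_def by (rule laplace_stein[OF s0 \<epsilon>0])
    ultimately have "\<bar>K * L s - (1 + 2 * s) * L' s\<bar> \<le> ?e" by linarith
    then show ?thesis unfolding abs_mult using c1 by (intro mult_mono) auto
  qed
  have "\<exists>z>\<delta>. z < S \<and> H S - H \<delta> = (S - \<delta>) * ((1 + 2 * z) powr (K / 2 - 1) * (K * L z - (1 + 2 * z) * L' z))"
    using dH \<delta> by (intro MVT2) auto
  then obtain z where z: "\<delta> < z" "z < S" "H S - H \<delta> = (S - \<delta>) * ((1 + 2 * z) powr (K / 2 - 1) * (K * L z - (1 + 2 * z) * L' z))"
    by blast
  have "\<bar>H S - H \<delta>\<bar> \<le> (S - \<delta>) * (?c * ?e)"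
    unfolding z(3) abs_mult[of "S - \<delta>"] using bH[of z] z \<delta> by (intro mult_mono) auto
  moreover have "\<bar>H \<delta> - 1\<bar> \<le> ?start"
  proof -
    have p: "(1 + 2 * \<delta>) powr (K / 2) \<ge> 1" using \<delta> K0 by (intro ge_one_powr_ge_zero) auto
    have "\<bar>H \<delta> - 1\<bar> \<le> (1 + 2 * \<delta>) powr (K / 2) * (1 - L \<delta>) + ((1 + 2 * \<delta>) powr (K / 2) - 1)"
    proof -
      have "H \<delta> - 1 = - ((1 + 2 * \<delta>) powr (K / 2) * (1 - L \<delta>)) + ((1 + 2 * \<delta>) powr (K / 2) - 1)"
        by (simp add: H_def algebra_simps)
      moreover have "(1 + 2 * \<delta>) powr (K / 2) * (1 - L \<delta>) \<ge> 0" using p L1[OF \<delta>(1)] by auto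
      ultimately show ?thesis using p by linarith
    qed
    also have "\<dots> \<le> ?start" using L\<delta> p by (intro add_mono mult_left_mono) auto
    finally show ?thesis .
  qed
  ultimately show ?thesis unfolding H_def[symmetric] L_def[symmetric] by linarith
qed

end

theorem permutation_laplace_limit:
  fixes G :: "nat \<Rightarrow> nat \<Rightarrow> 'm::finite" and \<alpha> :: "nat \<Rightarrow> nat \<Rightarrow> 'a::euclidean_space"
  assumes ev: "\<forall>\<^sub>F n in sequentially. bounded_scores n (G n) (\<alpha> n) C \<rho> (\<epsilon> n)"
    and \<epsilon>: "\<epsilon> \<longlonglongrightarrow> 0" "\<And>n. \<epsilon> n \<ge> 0"
    and \<tau>: "(\<lambda>n. (\<Sum>s=1..n. (norm (\<alpha> n s))\<^sup>2) / real n) \<longlonglongrightarrow> \<tau>"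
    and S: "S > 0"
  shows "(\<lambda>n. perm_mean n (\<lambda>T. exp (- S * grouped_scores.Q n (G n) (\<alpha> n) T)))
    \<longlonglongrightarrow> (1 + 2 * S) powr (- ((real CARD('m) - 1) * \<tau>) / 2)"
proof -
  define K where "K = (real CARD('m) - 1) * \<tau>"
  define L where "L n = perm_mean n (\<lambda>T. exp (- S * grouped_scores.Q n (G n) (\<alpha> n) T))" for n
  have \<tau>0: "\<tau> \<ge> 0" by (rule LIMSEQ_le_const[OF \<tau>]) (auto intro!: exI[of _ 0] divide_nonneg_nonneg sum_nonneg)
  define start where "start \<delta> = (1 + 2 * \<delta>) powr (K / 2) * (\<delta> * (2 * C\<^sup>2 / \<rho>)) + ((1 + 2 * \<delta>) powr (K / 2) - 1)" for \<delta>
  define rest where "rest \<delta> n = (S - \<delta>) * ((1 + 2 * S) powr (K / 2) *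
       (3 * real CARD('m) * real DIM('a)^2 * C\<^sup>2 / (2 * \<rho> * sqrt (real n)) + 5 / (\<delta> * real n) + 2 * \<epsilon> n
     + 2 * sqrt S * sqrt (8 * C\<^sup>2 / \<rho>) ^ 3 / sqrt (real n) + real CARD('m) * \<bar>(\<Sum>s=1..n. (norm (\<alpha> n s))\<^sup>2) / real n - \<tau>\<bar>))" for \<delta> n
  have gap: "\<forall>\<^sub>F n in sequentially. \<bar>(1 + 2 * S) powr (K / 2) * L n - 1\<bar> \<le> start \<delta> + rest \<delta> n"
    if "0 < \<delta>" "\<delta> < S" for \<delta>
    using ev
  proof eventually_elim
    case (elim n)
    then interpret bounded_scores n "G n" "\<alpha> n" C \<rho> "\<epsilon> n" .
    show ?case
      using laplace_gap[OF that \<epsilon>(2) \<tau>0 K_def] unfolding start_def rest_def L_def mean_square_def .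
  qed
  have rest0: "rest \<delta> \<longlonglongrightarrow> 0" for \<delta>
  proof -
    have s: "(\<lambda>n. c / (d * sqrt (real n))) \<longlonglongrightarrow> 0" for c d
    proof -
      have "(\<lambda>n. (c / d) * (1 / sqrt (real n))) \<longlonglongrightarrow> (c / d) * 0"
        by (intro tendsto_mult tendsto_const) real_asymp
      then show ?thesis by simp
    qed
    have r: "(\<lambda>n. 5 / (\<delta> * real n)) \<longlonglongrightarrow> 0"
    proof -
      have "(\<lambda>n. (5 / \<delta>) * (1 / real n)) \<longlonglongrightarrow> (5 / \<delta>) * 0"
        by (intro tendsto_mult tendsto_const) real_asymp
      then show ?thesis by simp
    qed
    have "rest \<delta> \<longlonglongrightarrow> (S - \<delta>) * ((1 + 2 * S) powr (K / 2) * (0 + 0 + 2 * 0 + 0 + real CARD('m) * \<bar>\<tau> - \<tau>\<bar>))"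
      unfolding rest_def
      by (intro tendsto_mult tendsto_add tendsto_const s r \<epsilon> tendsto_rabs tendsto_diff \<tau>
           s[of _ 1, unfolded mult_1])
    then show ?thesis by simp
  qed
  have start0: "(start \<longlongrightarrow> 0) (at_right 0)"
  proof -
    have "(start \<longlongrightarrow> (1 + 2 * 0) powr (K / 2) * (0 * (2 * C\<^sup>2 / \<rho>)) + ((1 + 2 * 0) powr (K / 2) - 1)) (at_right 0)"
      unfolding start_def by (intro tendsto_intros) auto
    then show ?thesis by simp
  qed
  have lim1: "(\<lambda>n. (1 + 2 * S) powr (K / 2) * L n) \<longlonglongrightarrow> 1"
  proof (rule tendstoI)
    fix e :: real assume e: "e > 0"
    have "\<forall>\<^sub>F \<delta> in at_right 0. \<bar>start \<delta>\<bar> < e / 2"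
      using tendstoD[OF start0, of "e / 2"] e by (simp add: dist_real_def)
    moreover have "\<forall>\<^sub>F \<delta> in at_right 0. \<delta> < S" using S by (simp add: eventually_at_right) blast
    moreover have "\<forall>\<^sub>F \<delta> in at_right (0::real). 0 < \<delta>" by (simp add: eventually_at_right_less)
    ultimately have "\<forall>\<^sub>F \<delta> in at_right 0. \<bar>start \<delta>\<bar> < e / 2 \<and> \<delta> < S \<and> 0 < \<delta>" by eventually_elim auto
    then obtain \<delta> where \<delta>: "\<bar>start \<delta>\<bar> < e / 2" "\<delta> < S" "0 < \<delta>"
      using eventually_happens'[OF trivial_limit_at_right_real] by blast
    have "\<forall>\<^sub>F n in sequentially. \<bar>rest \<delta> n\<bar> < e / 2"
      using tendstoD[OF rest0, of "e / 2" \<delta>] e by (simp add: dist_real_def)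
    then show "\<forall>\<^sub>F n in sequentially. dist ((1 + 2 * S) powr (K / 2) * L n) 1 < e"
      using gap[OF \<delta>(3,2)] by eventually_elim (use \<delta>(1) in \<open>unfold dist_real_def, linarith\<close>)
  qed
  have "(\<lambda>n. (1 + 2 * S) powr (- K / 2) * ((1 + 2 * S) powr (K / 2) * L n)) \<longlonglongrightarrow> (1 + 2 * S) powr (- K / 2) * 1"
    by (intro tendsto_mult tendsto_const lim1)
  moreover have "(1 + 2 * S) powr (- K / 2) * ((1 + 2 * S) powr (K / 2) * L n) = L n" for n
    using S by (simp add: mult.assoc[symmetric] powr_add[symmetric])
  ultimately show ?thesis unfolding L_def[symmetric] K_def[symmetric] by (simp only: mult_1_right)
qed

declare One_nat_def [simp]

section \<open>Whitening\<close>

lemma inner_matrix_symmetric: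
  fixes D :: "real ^ 'k ^ 'k"
  assumes "transpose D = D" shows "(D *v x) \<bullet> y = x \<bullet> (D *v y)"
  using dot_lmul_matrix[of y D x] assms by (metis dot_lmul_matrix inner_commute vector_transpose_matrix)

lemma psd_kernel:
  fixes D :: "real ^ 'k ^ 'k"
  assumes sym: "transpose D = D" and psd: "\<And>x. 0 \<le> x \<bullet> (D *v x)" and x: "x \<bullet> (D *v x) = 0"
  shows "D *v x = 0"
proof (rule ccontr)
  assume "D *v x \<noteq> 0"
  define y where "y = D *v x"
  have y: "y \<bullet> y > 0" using \<open>D *v x \<noteq> 0\<close> by (simp add: y_def)
  define q where "q = y \<bullet> (D *v y)"
  have q: "q \<ge> 0" using psd by (simp add: q_def)
  define t where "t = - (y \<bullet> y) / (q + 1)"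
  have "0 \<le> (x + t *\<^sub>R y) \<bullet> (D *v (x + t *\<^sub>R y))" by (rule psd)
  also have "\<dots> = 2 * t * (y \<bullet> y) + t\<^sup>2 * q"
    using x inner_matrix_symmetric[OF sym, of x y]
    by (simp add: matrix_vector_right_distrib matrix_vector_mult_scaleR inner_add_left inner_add_right
        y_def[symmetric] q_def[symmetric] power2_eq_square algebra_simps)
  also have "\<dots> = t * (2 * (y \<bullet> y) + t * q)" by (simp add: power2_eq_square algebra_simps)
  also have "\<dots> < 0"
  proof -
    have "t < 0" using y q by (simp add: t_def divide_neg_pos)
    moreover have "t * q > - (y \<bullet> y) * 2"
    proof -
      have "- (t * q) = (y \<bullet> y) * (q / (q + 1))" by (simp add: t_def)
      also have "\<dots> \<le> (y \<bullet> y) * 1" using y q by (intro mult_left_mono) auto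
      finally show ?thesis using y by linarith
    qed
    ultimately show ?thesis by (intro mult_neg_pos) auto
  qed
  finally show False by simp
qed

text \<open>
  The form of \<open>D\<close> is positive definite on the range of \<open>D\<close>; an orthonormal subset of maximal size
  spans the range by one Gram-Schmidt step.
\<close>
lemma orthonormal_basis_of_form:
  fixes D :: "real ^ 'k ^ 'k"
  assumes sym: "transpose D = D" and psd: "\<And>x. 0 \<le> x \<bullet> (D *v x)"
  obtains W where "finite W" "W \<subseteq> range ((*v) D)" "span W = range ((*v) D)" "card W = rank D"
    "\<And>v w. v \<in> W \<Longrightarrow> w \<in> W \<Longrightarrow> v \<bullet> (D *v w) = of_bool (v = w)"
proof -
  define S where "S = range ((*v) D)"
  have S: "subspace S" unfolding S_def by (intro linear_subspace_image) auto
  have pd: "x = 0" if xS: "x \<in> S" and x0: "x \<bullet> (D *v x) = 0" for x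
  proof -
    obtain z where z: "x = D *v z" using xS by (auto simp: S_def)
    have "x \<bullet> x = (D *v x) \<bullet> z" using inner_matrix_symmetric[OF sym, of x z] z by simp
    then show ?thesis using psd_kernel[OF sym psd x0] by simp
  qed
  define ON where "ON W \<longleftrightarrow> W \<subseteq> S \<and> (\<forall>v\<in>W. \<forall>w\<in>W. v \<bullet> (D *v w) = of_bool (v = w))" for W
  have ind: "independent W" if "ON W" for W
  proof
    assume "dependent W"
    then obtain T u where T: "finite T" "T \<subseteq> W" "(\<Sum>v\<in>T. u v *\<^sub>R v) = 0" "\<exists>v\<in>T. u v \<noteq> 0"
      unfolding dependent_explicit by blast
    then obtain w where w: "w \<in> T" "u w \<noteq> 0" by blast
    have "0 = (\<Sum>v\<in>T. u v *\<^sub>R v) \<bullet> (D *v w)" by (simp add: T)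
    also have "\<dots> = (\<Sum>v\<in>T. u v * (v \<bullet> (D *v w)))" by (simp add: inner_sum_left)
    also have "\<dots> = (\<Sum>v\<in>T. if v = w then u v else 0)"
    proof (rule sum.cong[OF refl])
      fix v assume "v \<in> T"
      then have "v \<bullet> (D *v w) = of_bool (v = w)" using that T(2) w(1) unfolding ON_def by blast
      then show "u v * (v \<bullet> (D *v w)) = (if v = w then u v else 0)" by simp
    qed
    also have "\<dots> = u w" using w T by simp
    finally show False using w by simp
  qed
  have fin: "finite W \<and> card W \<le> DIM(real ^ 'k)" if "ON W" for W
    using ind[OF that] independent_bound by blast
  have "\<exists>W. ON W \<and> (\<forall>V. ON V \<longrightarrow> card V \<le> card W)"
  proof (rule Lattices_Big.ex_has_greatest_nat[of ON "{}" card "Suc DIM(real ^ 'k)"])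
    show "ON {}" by (simp add: ON_def)
    show "\<forall>W. ON W \<longrightarrow> card W < Suc DIM(real ^ 'k)" using fin le_imp_less_Suc by blast
  qed
  then obtain W where W: "ON W" and max: "\<And>V. ON V \<Longrightarrow> card V \<le> card W" by blast
  have WS: "W \<subseteq> S" and W1: "\<And>v w. v \<in> W \<Longrightarrow> w \<in> W \<Longrightarrow> v \<bullet> (D *v w) = of_bool (v = w)"
    using W by (auto simp: ON_def)
  have finW: "finite W" using fin[OF W] by simp
  have "S \<subseteq> span W"
  proof
    fix x assume x: "x \<in> S"
    define y where "y = x - (\<Sum>w\<in>W. (w \<bullet> (D *v x)) *\<^sub>R w)"
    have yS: "y \<in> S" unfolding y_def
      using x WS by (intro subspace_diff[OF S] subspace_sum[OF S] subspace_scale[OF S]) auto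
    have orth: "v \<bullet> (D *v y) = 0" if v: "v \<in> W" for v
    proof -
      have "v \<bullet> (D *v y) = v \<bullet> (D *v x) - (\<Sum>w\<in>W. (w \<bullet> (D *v x)) * (v \<bullet> (D *v w)))"
        unfolding y_def by (simp add: matrix_vector_mult_diff_distrib inner_diff_right
            linear_sum[OF matrix_vector_mul_linear] matrix_vector_mult_scaleR inner_sum_right)
      also have "(\<Sum>w\<in>W. (w \<bullet> (D *v x)) * (v \<bullet> (D *v w))) = (\<Sum>w\<in>W. if w = v then v \<bullet> (D *v x) else 0)"
        using v by (intro sum.cong) (auto simp: W1)
      finally show ?thesis using finW v by simp
    qed
    have "y = 0"
    proof (rule ccontr)
      assume "y \<noteq> 0"
      then have p: "y \<bullet> (D *v y) > 0" using pd[OF yS] psd[of y] by fastforce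
      define z where "z = (1 / sqrt (y \<bullet> (D *v y))) *\<^sub>R y"
      have zz: "z \<bullet> (D *v z) = 1"
        using p by (simp add: z_def matrix_vector_mult_scaleR flip: power2_eq_square)
      have vz: "v \<bullet> (D *v z) = 0" if "v \<in> W" for v
        using orth[OF that] by (simp add: z_def matrix_vector_mult_scaleR)
      have zv: "z \<bullet> (D *v v) = 0" if "v \<in> W" for v
        using vz[OF that] inner_matrix_symmetric[OF sym, of z v] by (simp add: inner_commute)
      have "z \<notin> W" using vz zz by force
      moreover have "ON (insert z W)"
        unfolding ON_def using WS W1 vz zv zz \<open>z \<notin> W\<close> yS subspace_scale[OF S]
        by (auto simp: z_def)
      ultimately show False using max[of "insert z W"] finW by simp
    qed
    then have "x = (\<Sum>w\<in>W. (w \<bullet> (D *v x)) *\<^sub>R w)" by (simp add: y_def)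
    then show "x \<in> span W" by (metis (no_types, lifting) span_base span_scale span_sum)
  qed
  then have span: "span W = S" using WS S by (simp add: span_minimal subset_antisym)
  have "card W = rank D"
    using dim_span_eq_card_independent[OF ind[OF W]] unfolding span rank_dim_range S_def by simp
  then show ?thesis using that[of W] finW WS span W1 by (auto simp: S_def)
qed

lemma moore_penrose_inverse_eqI:
  fixes A :: "real ^ 'n ^ 'm" and B :: "real ^ 'm ^ 'n"
  assumes "A ** B ** A = A" "B ** A ** B = B" "transpose (A ** B) = A ** B" "transpose (B ** A) = B ** A"
  shows "moore_penrose_inverse A = B"
  unfolding moore_penrose_inverse_def
proof (rule the_equality)
  show "A ** B ** A = A \<and> B ** A ** B = B \<and> transpose (A ** B) = A ** B \<and> transpose (B ** A) = B ** A"
    using assms by blast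
next
  fix C assume C: "A ** C ** A = A \<and> C ** A ** C = C \<and> transpose (A ** C) = A ** C \<and> transpose (C ** A) = C ** A"
  then have C1: "A ** C ** A = A" and C2: "C ** A ** C = C"
    and t: "transpose (A ** C) = A ** C" "transpose (C ** A) = C ** A" by blast+
  have "A ** C = A ** B ** A ** C" by (simp only: assms(1))
  also have "\<dots> = transpose (A ** B) ** transpose (A ** C)" unfolding t assms(3) by (simp only: matrix_mul_assoc)
  also have "\<dots> = transpose (A ** C ** A ** B)" by (simp only: matrix_transpose_mul matrix_mul_assoc)
  also have "\<dots> = A ** B" unfolding C1 by (rule assms)
  finally have AC: "A ** C = A ** B" .
  have "C ** A = C ** (A ** B ** A)" by (simp only: assms(1))
  also have "\<dots> = transpose (C ** A) ** transpose (B ** A)" unfolding t assms(4) by (simp only: matrix_mul_assoc)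
  also have "\<dots> = transpose (B ** (A ** C ** A))" by (simp only: matrix_transpose_mul matrix_mul_assoc)
  also have "\<dots> = B ** A" unfolding C1 by (rule assms)
  finally have CA: "C ** A = B ** A" .
  have "C = C ** A ** C" by (rule C2[symmetric])
  also have "\<dots> = B ** (A ** C)" unfolding CA by (simp only: matrix_mul_assoc)
  also have "\<dots> = B" unfolding AC by (simp only: matrix_mul_assoc assms(2))
  finally show "C = B" .
qed

text \<open>
  For a basis \<open>W\<close> of the range that is orthonormal for the form of \<open>D\<close>, the sum of the matrices
  \<open>w w\<^sup>T\<close> satisfies the four Penrose equations.
\<close>
lemma moore_penrose_form_basis:
  fixes D :: "real ^ 'k ^ 'k"
  assumes sym: "transpose D = D" 
    and W: "finite W" "W \<subseteq> range ((*v) D)" "span W = range ((*v) D)"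
    "\<And>v w. v \<in> W \<Longrightarrow> w \<in> W \<Longrightarrow> v \<bullet> (D *v w) = of_bool (v = w)"
  shows "moore_penrose_inverse D *v x = (\<Sum>w\<in>W. (w \<bullet> x) *\<^sub>R w)"
proof -
  define B :: "real ^ 'k ^ 'k" where "B = (\<chi> a b. \<Sum>w\<in>W. w $ a * w $ b)"
  have B: "B *v x = (\<Sum>w\<in>W. (w \<bullet> x) *\<^sub>R w)" for x
  proof -
    have "(B *v x) $ a = (\<Sum>w\<in>W. (w \<bullet> x) *\<^sub>R w) $ a" for a
    proof -
      have "(B *v x) $ a = (\<Sum>j\<in>UNIV. \<Sum>w\<in>W. w $ a * w $ j * x $ j)"
        unfolding B_def matrix_vector_mult_def by (simp add: sum_distrib_right)
      also have "\<dots> = (\<Sum>w\<in>W. \<Sum>j\<in>UNIV. w $ a * w $ j * x $ j)" by (rule sum.swap)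
      also have "\<dots> = (\<Sum>w\<in>W. (w \<bullet> x) *\<^sub>R w) $ a"
        unfolding inner_vec_def by (simp add: sum_component sum_distrib_left sum_distrib_right mult_ac)
      finally show ?thesis .
    qed
    then show ?thesis by (simp add: vec_eq_iff)
  qed
  have symB: "transpose B = B" by (simp add: B_def transpose_def mult.commute)
  let ?S = "range ((*v) D)"
  have S: "subspace ?S" by (intro linear_subspace_image) auto
  have BS: "B *v x \<in> ?S" for x
    unfolding B using W by (intro subspace_sum[OF S] subspace_scale[OF S]) auto
  have orth: "x = 0" if "x \<in> ?S" "\<And>w. w \<in> W \<Longrightarrow> w \<bullet> x = 0" for x
  proof -
    have "subspace {y. y \<bullet> x = 0}" by (rule subspace_hyperplane2)
    then have "span W \<subseteq> {y. y \<bullet> x = 0}" using that(2) by (intro span_minimal) auto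
    then show ?thesis using that(1) W(3) by auto
  qed
  have 1: "D *v (B *v z) = z" if z: "z \<in> ?S" for z
  proof -
    have "w \<bullet> (D *v (B *v z) - z) = 0" if w: "w \<in> W" for w
    proof -
      have "w \<bullet> (D *v (B *v z)) = (\<Sum>v\<in>W. (v \<bullet> z) * (w \<bullet> (D *v v)))"
        unfolding B by (simp add: linear_sum[OF matrix_vector_mul_linear] matrix_vector_mult_scaleR inner_sum_right)
      also have "\<dots> = (\<Sum>v\<in>W. if v = w then w \<bullet> z else 0)"
        using w by (intro sum.cong) (auto simp: W(4))
      finally show ?thesis using w W(1) by (simp add: inner_diff_right)
    qed
    then have "D *v (B *v z) - z = 0" using z by (intro orth subspace_diff[OF S]) auto
    then show ?thesis by simp
  qed
  have 2: "B *v (D *v z) = z" if z: "z \<in> ?S" for z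
  proof -
    have "w \<bullet> (D *v (B *v (D *v z) - z)) = 0" for w
      using 1[of "D *v z"] by (simp add: matrix_vector_mult_diff_distrib)
    let ?y = "B *v (D *v z) - z"
    have y: "?y \<in> ?S" using BS z by (intro subspace_diff[OF S])
    then obtain u where u: "?y = D *v u" by auto
    have "?y \<bullet> ?y = (D *v ?y) \<bullet> u" using inner_matrix_symmetric[OF sym, of ?y u] u by simp
    also have "D *v ?y = 0" using 1[of "D *v z"] by (simp add: matrix_vector_mult_diff_distrib)
    finally show ?thesis by simp
  qed
  have comm: "D *v (B *v x) = B *v (D *v x)" for x
  proof -
    have "w \<bullet> (D *v (B *v x) - B *v (D *v x)) = 0" if w: "w \<in> W" for w
    proof -
      have "w \<in> ?S" using w W by auto
      have "w \<bullet> (D *v (B *v x)) = (B *v (D *v w)) \<bullet> x"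
        by (simp add: inner_matrix_symmetric[OF sym] inner_matrix_symmetric[OF symB])
      also have "\<dots> = (D *v (B *v w)) \<bullet> x" using 1 2 \<open>w \<in> ?S\<close> by simp
      also have "\<dots> = w \<bullet> (B *v (D *v x))"
        by (simp add: inner_matrix_symmetric[OF sym] inner_matrix_symmetric[OF symB])
      finally show ?thesis by (simp add: inner_diff_right)
    qed
    then have "D *v (B *v x) - B *v (D *v x) = 0" using BS by (intro orth subspace_diff[OF S]) auto
    then show ?thesis by simp
  qed
  have c: "D ** B = B ** D" by (simp add: matrix_eq matrix_vector_mul_assoc[symmetric] comm)
  have "moore_penrose_inverse D = B"
  proof (rule moore_penrose_inverse_eqI)
    show "D ** B ** D = D" by (simp add: matrix_eq matrix_vector_mul_assoc[symmetric] 1)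
    show "B ** D ** B = B" using 2[OF BS] by (simp add: matrix_eq matrix_vector_mul_assoc[symmetric])
    show "transpose (D ** B) = D ** B" "transpose (B ** D) = B ** D"
      using c by (simp_all add: matrix_transpose_mul sym symB)
  qed
  then show ?thesis by (simp add: B)
qed

text \<open>
  \<open>L\<close> sends the form-orthonormal basis to orthonormal vectors, so that the form of the Moore-Penrose
  inverse becomes a squared norm; \<open>Lt\<close> is the adjoint of \<open>L\<close>. The last two clauses say that \<open>L\<close> transforms
  the covariance \<open>D\<close> into the orthogonal projection onto the range of \<open>L\<close>.
\<close>
lemma whitening:
  fixes D :: "real ^ 'k ^ 'k"
  assumes sym: "transpose D = D" and psd: "\<And>x. 0 \<le> x \<bullet> (D *v x)"
  obtains L Lt :: "real ^ 'k \<Rightarrow> real ^ 'k" where "linear L" "linear Lt" "\<And>x y. L x \<bullet> y = x \<bullet> Lt y"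
    "\<And>x. x \<bullet> (moore_penrose_inverse D *v x) = (norm (L x))\<^sup>2"
    "\<And>y. y \<in> range L \<Longrightarrow> Lt y \<bullet> (D *v Lt y) = (norm y)\<^sup>2"
    "(\<Sum>b\<in>Basis. Lt b \<bullet> (D *v Lt b)) = real (rank D)"
proof -
  obtain W where W: "finite W" "W \<subseteq> range ((*v) D)" "span W = range ((*v) D)" "card W = rank D"
    "\<And>v w. v \<in> W \<Longrightarrow> w \<in> W \<Longrightarrow> v \<bullet> (D *v w) = of_bool (v = w)"
    using orthonormal_basis_of_form[OF sym psd] by blast
  have "card W \<le> card (Basis :: (real ^ 'k) set)"
    unfolding W(4) using rank_bound[of D] by (simp only: DIM_cart DIM_real)
  then obtain \<phi> where \<phi>: "\<phi> ` W \<subseteq> (Basis :: (real ^ 'k) set)" "inj_on \<phi> W"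
    using card_le_inj[OF W(1) finite_Basis] by blast
  define L where "L x = (\<Sum>w\<in>W. (w \<bullet> x) *\<^sub>R \<phi> w)" for x :: "real ^ 'k"
  define Lt where "Lt y = (\<Sum>w\<in>W. (\<phi> w \<bullet> y) *\<^sub>R w)" for y :: "real ^ 'k"
  have \<phi>1: "\<phi> v \<bullet> \<phi> w = of_bool (v = w)" if "v \<in> W" "w \<in> W" for v w
    using \<phi> that inner_Basis[of "\<phi> v" "\<phi> w"] by (auto simp: inj_on_def image_subset_iff)
  have lin: "linear L" "linear Lt"
    unfolding L_def Lt_def by (auto intro!: linearI simp: inner_add_right scaleR_add_left sum.distrib scaleR_sum_right)
  have adj: "L x \<bullet> y = x \<bullet> Lt y" for x y
    by (simp add: L_def Lt_def inner_sum_left inner_sum_right inner_commute mult.commute)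
  have pick: "(\<Sum>v\<in>W. c v * of_bool (v = w)) = c w" if "w \<in> W" for c :: "_ \<Rightarrow> real" and w
    using that W(1) by (simp add: of_bool_def if_distrib[of "\<lambda>z. _ * z"] cong: if_cong)
  have normL: "(norm (\<Sum>w\<in>W. c w *\<^sub>R \<phi> w))\<^sup>2 = (\<Sum>w\<in>W. (c w)\<^sup>2)" for c :: "_ \<Rightarrow> real"
  proof -
    have "(norm (\<Sum>w\<in>W. c w *\<^sub>R \<phi> w))\<^sup>2 = (\<Sum>w\<in>W. c w * (\<Sum>v\<in>W. c v * of_bool (v = w)))"
      unfolding power2_norm_eq_inner inner_sum_left inner_sum_right
      by (auto simp: \<phi>1 sum_distrib_left intro!: sum.cong)
    then show ?thesis by (simp add: pick power2_eq_square)
  qed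
  have DLt: "Lt y \<bullet> (D *v Lt y) = (\<Sum>w\<in>W. (\<phi> w \<bullet> y)\<^sup>2)" for y
  proof -
    have "Lt y \<bullet> (D *v Lt y) = (\<Sum>w\<in>W. (\<phi> w \<bullet> y) * (\<Sum>v\<in>W. (\<phi> v \<bullet> y) * (v \<bullet> (D *v w))))"
      unfolding Lt_def by (simp add: linear_sum[OF matrix_vector_mul_linear] matrix_vector_mult_scaleR inner_sum_left inner_sum_right)
    also have "\<dots> = (\<Sum>w\<in>W. (\<phi> w \<bullet> y) * (\<Sum>v\<in>W. (\<phi> v \<bullet> y) * of_bool (v = w)))"
      by (intro sum.cong refl arg_cong2[where f="(*)"]) (auto simp: W(5))
    finally show ?thesis by (simp add: pick power2_eq_square)
  qed
  have mp: "moore_penrose_inverse D *v x = (\<Sum>w\<in>W. (w \<bullet> x) *\<^sub>R w)" for x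
    using W(5) by (intro moore_penrose_form_basis[OF sym W(1-3)])
  show ?thesis
  proof (rule that[OF lin adj])
    show "x \<bullet> (moore_penrose_inverse D *v x) = (norm (L x))\<^sup>2" for x
      unfolding mp L_def normL
      by (simp add: inner_sum_right power2_eq_square inner_commute)
    show "Lt y \<bullet> (D *v Lt y) = (norm y)\<^sup>2" if yL: "y \<in> range L" for y
    proof -
      obtain x where x: "y = L x" using yL by auto
      have "\<phi> w \<bullet> y = w \<bullet> x" if w: "w \<in> W" for w
      proof -
        have "\<phi> w \<bullet> y = (\<Sum>v\<in>W. (v \<bullet> x) * of_bool (v = w))"
          unfolding x L_def inner_sum_right using w by (auto simp: \<phi>1 intro!: sum.cong)
        then show ?thesis using pick[OF w] by simp
      qed
      then show ?thesis unfolding DLt unfolding x L_def normL by (simp add: x L_def)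
    qed
    have "(\<Sum>b\<in>Basis. Lt b \<bullet> (D *v Lt b)) = (\<Sum>w\<in>W. \<Sum>b\<in>Basis. (\<phi> w \<bullet> b)\<^sup>2)"
      unfolding DLt by (rule sum.swap)
    also have "\<dots> = (\<Sum>w\<in>W. 1)"
    proof (rule sum.cong[OF refl])
      fix w assume w: "w \<in> W"
      have "(\<Sum>b\<in>Basis. (\<phi> w \<bullet> b)\<^sup>2) = \<phi> w \<bullet> \<phi> w"
        by (subst euclidean_inner) (simp add: power2_eq_square)
      then show "(\<Sum>b\<in>Basis. (\<phi> w \<bullet> b)\<^sup>2) = 1" using \<phi>1[OF w w] by simp
    qed
    finally show "(\<Sum>b\<in>Basis. Lt b \<bullet> (D *v Lt b)) = real (rank D)" using W(4) by simp
  qed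
qed

section \<open>Null sets for surface measure\<close>

lemma space_sphere_borel [simp]: "space sphere_borel = sphere 0 1"
  by (simp add: sphere_borel_def space_restrict_space)

lemma sets_sphere_borel_iff: "N \<in> sets sphere_borel \<longleftrightarrow> N \<in> sets borel \<and> N \<subseteq> sphere 0 1"
  unfolding sphere_borel_def by (subst sets_restrict_space_iff) auto

lemma borel_imp_sphere_borel: "N \<in> sets borel \<Longrightarrow> N \<inter> sphere 0 1 \<in> sets sphere_borel"
  by (auto simp: sets_sphere_borel_iff)

lemma measurable_sgn_sphere: "sgn \<in> restrict_space lborel (ball 0 1 - {0}) \<rightarrow>\<^sub>M (sphere_borel :: (real ^ 'd) measure)"
  unfolding sphere_borel_def
proof (rule measurable_restrict_space2)
  show "sgn \<in> space (restrict_space lborel (ball 0 1 - {0})) \<rightarrow> sphere (0::real ^ 'd) 1"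
    by (auto simp: norm_sgn space_restrict_space)
  have "sgn \<in> borel_measurable (borel :: (real ^ 'd) measure)"
    unfolding sgn_div_norm by measurable
  then show "sgn \<in> borel_measurable (restrict_space lborel (ball (0::real ^ 'd) 1 - {0}))"
    by (intro measurable_restrict_space1) simp
qed

lemma sets_surface_measure [simp, measurable_cong]: "sets surface_measure = sets sphere_borel"
  by (simp add: surface_measure_def)

lemma space_surface_measure [simp]: "space surface_measure = sphere 0 1"
  using sets_eq_imp_space_eq[OF sets_surface_measure] by simp

definition unit_cone :: "(real ^ 'd) set \<Rightarrow> (real ^ 'd) set" where
  "unit_cone N = {y. y \<noteq> 0 \<and> norm y < 1 \<and> sgn y \<in> N}"

lemma unit_cone_borel:
  assumes "N \<in> sets sphere_borel" shows "unit_cone N \<in> sets borel"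
proof -
  have "sgn -` N \<inter> space (restrict_space lborel (ball 0 1 - {0})) \<in> sets (restrict_space lborel (ball 0 1 - {0}))"
    by (rule measurable_sets[OF measurable_sgn_sphere assms])
  moreover have "sgn -` N \<inter> space (restrict_space lborel (ball 0 1 - {0})) = unit_cone N"
    by (auto simp: unit_cone_def space_restrict_space)
  ultimately show ?thesis by (simp add: sets_restrict_space_iff)
qed

lemma emeasure_surface_measure:
  assumes "N \<in> sets sphere_borel"
  shows "emeasure surface_measure N = of_nat CARD('d) * emeasure lborel (unit_cone (N :: (real ^ 'd) set))"
proof -
  have "sgn -` N \<inter> space (restrict_space lborel (ball 0 1 - {0})) = unit_cone N"
    by (auto simp: unit_cone_def space_restrict_space)
  moreover have "emeasure (restrict_space lborel (ball 0 1 - {0})) (unit_cone N) = emeasure lborel (unit_cone N)"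
    by (rule emeasure_restrict_space) (auto simp: unit_cone_def)
  ultimately show ?thesis
    using assms by (simp add: surface_measure_def emeasure_distr[OF measurable_sgn_sphere assms])
qed

lemma surface_null_iff:
  "N \<in> sets sphere_borel \<Longrightarrow> emeasure surface_measure N = 0 \<longleftrightarrow> emeasure lborel (unit_cone N) = 0"
  by (simp add: emeasure_surface_measure)

lemma finite_surface_measure: "emeasure (surface_measure :: (real ^ 'd) measure) (sphere 0 1) \<noteq> \<infinity>"
proof -
  have "emeasure lborel (unit_cone (sphere (0::real ^ 'd) 1)) \<le> emeasure lborel (ball (0::real ^ 'd) 1)"
    by (rule emeasure_mono) (auto simp: unit_cone_def)
  also have "\<dots> < \<infinity>" by (rule emeasure_lborel_ball_finite)
  finally have "emeasure lborel (unit_cone (sphere (0::real ^ 'd) 1)) < \<infinity>" .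
  then show ?thesis
    by (subst emeasure_surface_measure) (auto simp: sets_sphere_borel_iff ennreal_mult_eq_top_iff)
qed

lemma emeasure_lborel_open_pos:
  fixes U :: "'a::euclidean_space set"
  assumes "open U" "x \<in> U" shows "emeasure lborel U > 0"
proof -
  have "U \<noteq> {}" using assms by auto
  then have "\<not> negligible U" using assms open_not_negligible by blast
  then have "U \<notin> null_sets lebesgue" by (simp add: negligible_iff_null_sets)
  then have "emeasure lborel U \<noteq> 0" using assms by (auto simp: null_sets_def)
  then show ?thesis by (simp add: zero_less_iff_neq_zero)
qed

lemma surface_open_pos:
  fixes x :: "real ^ 'd"
  assumes x: "x \<in> sphere 0 1" and \<delta>: "\<delta> > 0"
  shows "emeasure surface_measure (ball x \<delta> \<inter> sphere 0 1) > 0"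
proof -
  let ?U = "(ball 0 1 - {0}) \<inter> sgn -` ball x \<delta>"
  have c: "continuous_on (ball 0 1 - {0}) (sgn :: real ^ 'd \<Rightarrow> _)"
    unfolding sgn_div_norm by (intro continuous_intros) auto
  have "open ?U"
    by (rule continuous_open_preimage[OF c]) auto
  moreover have "(1/2) *\<^sub>R x \<in> ?U"
    using x \<delta> by (auto simp: sgn_div_norm)
  ultimately have "emeasure lborel ?U > 0" by (rule emeasure_lborel_open_pos)
  moreover have "?U = unit_cone (ball x \<delta> \<inter> sphere 0 1)" by (auto simp: unit_cone_def norm_sgn)
  ultimately have "emeasure lborel (unit_cone (ball x \<delta> \<inter> sphere 0 1)) > 0" by (simp only:)
  moreover have "ball x \<delta> \<inter> sphere 0 1 \<in> sets sphere_borel" by (rule borel_imp_sphere_borel) simp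
  ultimately show ?thesis
    by (simp only: emeasure_surface_measure ennreal_zero_less_mult_iff) simp
qed

text \<open>
  Average over translations along \<open>e\<close> and apply Fubini.
\<close>
lemma null_of_countable_lines:
  fixes E :: "'a::euclidean_space set"
  assumes E[measurable]: "E \<in> sets borel" and lines: "\<And>y. countable {t. y + t *\<^sub>R e \<in> E}"
  shows "emeasure lborel E = 0"
proof -
  define f where "f t y = (indicator {0..1} t * indicator E (y + t *\<^sub>R e) :: ennreal)" for t :: real and y :: 'a
  have [measurable]: "case_prod f \<in> borel_measurable (lborel \<Otimes>\<^sub>M lborel)"
    unfolding f_def split_beta' by measurable
  have shift: "(\<integral>\<^sup>+ y. indicator E (y + c) \<partial>lborel) = emeasure lborel E" for c :: 'a
  proof -
    have "emeasure lborel E = (\<integral>\<^sup>+ y. indicator E y \<partial>distr lborel borel ((+) c))"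
      by (simp add: lborel_distr_plus)
    also have "\<dots> = (\<integral>\<^sup>+ y. indicator E (c + y) \<partial>lborel)"
      by (subst nn_integral_distr) auto
    finally show ?thesis by (simp add: add.commute)
  qed
  have "emeasure lborel E = (\<integral>\<^sup>+ t. indicator {0..1::real} t * emeasure lborel E \<partial>lborel)"
    by (subst nn_integral_multc) auto
  also have "\<dots> = (\<integral>\<^sup>+ t. \<integral>\<^sup>+ y. f t y \<partial>lborel \<partial>lborel)"
    unfolding f_def by (subst nn_integral_cmult) (auto simp: shift)
  also have "\<dots> = (\<integral>\<^sup>+ y. \<integral>\<^sup>+ t. f t y \<partial>lborel \<partial>lborel)"
    by (rule lborel_pair.Fubini'[symmetric]) measurable
  also have "\<dots> = (\<integral>\<^sup>+ y. 0 \<partial>(lborel :: 'a measure))"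
  proof (rule nn_integral_cong)
    fix y
    have "AE t in lborel. f t y = 0"
    proof -
      have "emeasure lborel {t. y + t *\<^sub>R e \<in> E} = 0" by (rule emeasure_lborel_countable[OF lines])
      moreover have "{t. y + t *\<^sub>R e \<in> E} \<in> sets lborel" by measurable
      ultimately have "AE t in lborel. t \<notin> {t. y + t *\<^sub>R e \<in> E}" 
        by (intro AE_not_in) (auto simp: null_sets_def)
      then show ?thesis by eventually_elim (simp add: f_def)
    qed
    then have "(\<integral>\<^sup>+ t. f t y \<partial>lborel) = (\<integral>\<^sup>+ t. 0 \<partial>(lborel :: real measure))" by (rule nn_integral_cong_AE)
    then show "(\<integral>\<^sup>+ t. f t y \<partial>lborel) = 0" by simp
  qed
  finally show ?thesis by simp
qed

text \<open>
  A line in direction \<open>e\<close> that misses the origin projects radially to half of a great circle, so the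
  cone over \<open>N\<close> meets it in a countable set.
\<close>
lemma surface_null_of_countable_great_circles:
  fixes N :: "(real ^ 'd) set" and e :: "real ^ 'd"
  assumes N: "N \<in> sets sphere_borel" and e: "norm e = 1" "e \<notin> N" "- e \<notin> N"
    and circ: "\<And>q. norm q = 1 \<Longrightarrow> q \<bullet> e = 0 \<Longrightarrow>
      countable {\<omega>. - (pi/2) < \<omega> \<and> \<omega> < pi/2 \<and> cos \<omega> *\<^sub>R q + sin \<omega> *\<^sub>R e \<in> N}"
  shows "emeasure surface_measure N = 0"
  unfolding surface_null_iff[OF N]
proof (rule null_of_countable_lines[OF unit_cone_borel[OF N]])
  fix y :: "real ^ 'd"
  define q0 where "q0 = y - (y \<bullet> e) *\<^sub>R e"
  have ee: "e \<bullet> e = 1" using e by (simp add: dot_square_norm)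
  have line: "y + t *\<^sub>R e = q0 + (y \<bullet> e + t) *\<^sub>R e" for t by (simp add: q0_def algebra_simps)
  show "countable {t. y + t *\<^sub>R e \<in> unit_cone N}"
  proof (cases "q0 = 0")
    case True
    have "y + t *\<^sub>R e \<notin> unit_cone N" for t
    proof -
      have "sgn e = e" using e by (simp add: sgn_div_norm)
      then have "sgn (y + t *\<^sub>R e) = sgn (y \<bullet> e + t) *\<^sub>R e" "y \<bullet> e + t = 0 \<Longrightarrow> y + t *\<^sub>R e = 0"
        unfolding line True by (simp_all only: sgn_scaleR add_0_left) simp
      then show ?thesis
        using e by (cases "y \<bullet> e + t" "0::real" rule: linorder_cases) (auto simp: unit_cone_def)
    qed
    then show ?thesis by simp
  next
    case False
    define \<rho> where "\<rho> = norm q0"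
    define q where "q = q0 /\<^sub>R \<rho>"
    have \<rho>: "\<rho> > 0" using False by (simp add: \<rho>_def)
    have q: "norm q = 1" "q \<bullet> e = 0" "q0 = \<rho> *\<^sub>R q"
      using False ee by (auto simp: q_def \<rho>_def q0_def inner_diff_left)
    have eq: "\<exists>\<omega>. - (pi/2) < \<omega> \<and> \<omega> < pi/2 \<and> sgn (y + t *\<^sub>R e) = cos \<omega> *\<^sub>R q + sin \<omega> *\<^sub>R e \<and> t = \<rho> * tan \<omega> - y \<bullet> e" for t
    proof -
      define z where "z = (y \<bullet> e + t) / \<rho>"
      define \<omega> where "\<omega> = arctan z"
      let ?r = "\<rho> * sqrt (1 + z\<^sup>2)"
      have r: "?r > 0" using \<rho> by (simp add: add_pos_nonneg)
      have n: "norm (cos \<omega> *\<^sub>R q + sin \<omega> *\<^sub>R e) = 1"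
      proof -
        have "(norm (cos \<omega> *\<^sub>R q + sin \<omega> *\<^sub>R e))\<^sup>2 = (cos \<omega>)\<^sup>2 * (q \<bullet> q) + (sin \<omega>)\<^sup>2 * (e \<bullet> e)"
          unfolding power2_norm_eq_inner using q(2)
          by (simp add: inner_add_left inner_add_right inner_commute power2_eq_square)
        also have "\<dots> = 1" using q(1) ee by (simp add: dot_square_norm)
        finally show ?thesis by (metis norm_eq_1 power2_norm_eq_inner)
      qed
      have s: "1 + z\<^sup>2 > 0" by (simp add: add_pos_nonneg)
      have "y + t *\<^sub>R e = \<rho> *\<^sub>R (q + z *\<^sub>R e)"
        unfolding line q(3) using \<rho> by (simp add: z_def scaleR_add_right)
      also have "q + z *\<^sub>R e = sqrt (1 + z\<^sup>2) *\<^sub>R (cos \<omega> *\<^sub>R q + sin \<omega> *\<^sub>R e)"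
        using s by (simp add: \<omega>_def cos_arctan sin_arctan scaleR_add_right)
      finally have "sgn (y + t *\<^sub>R e) = cos \<omega> *\<^sub>R q + sin \<omega> *\<^sub>R e"
        using r n \<rho> s by (simp add: sgn_scaleR) (simp add: sgn_div_norm)
      moreover have "t = \<rho> * tan \<omega> - y \<bullet> e" using \<rho> by (simp add: \<omega>_def z_def tan_arctan)
      ultimately show ?thesis using arctan_bounded[of z] by (auto simp: \<omega>_def)
    qed
    have "{t. y + t *\<^sub>R e \<in> unit_cone N} \<subseteq> (\<lambda>\<omega>. \<rho> * tan \<omega> - y \<bullet> e) `
        {\<omega>. - (pi/2) < \<omega> \<and> \<omega> < pi/2 \<and> cos \<omega> *\<^sub>R q + sin \<omega> *\<^sub>R e \<in> N}"
    proof
      fix t assume "t \<in> {t. y + t *\<^sub>R e \<in> unit_cone N}"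
      then have "sgn (y + t *\<^sub>R e) \<in> N" by (simp add: unit_cone_def)
      with eq[of t] show "t \<in> (\<lambda>\<omega>. \<rho> * tan \<omega> - y \<bullet> e) `
        {\<omega>. - (pi/2) < \<omega> \<and> \<omega> < pi/2 \<and> cos \<omega> *\<^sub>R q + sin \<omega> *\<^sub>R e \<in> N}" by auto
    qed
    then show ?thesis by (rule countable_subset) (intro countable_image circ q)
  qed
qed

lemma countable_isolated_points:
  fixes A :: "real set"
  assumes "\<And>a. a \<in> A \<Longrightarrow> \<exists>\<delta>>0. \<forall>b\<in>A. \<bar>b - a\<bar> < \<delta> \<longrightarrow> b = a"
  shows "countable A"
proof -
  define C where "C p r = {a \<in> A. p < a \<and> a < r \<and> (\<forall>b\<in>A. p < b \<and> b < r \<longrightarrow> b = a)}" for p r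
  have "A \<subseteq> (\<Union>p\<in>\<rat>. \<Union>r\<in>\<rat>. C p r)"
  proof
    fix a assume a: "a \<in> A"
    then obtain \<delta> where \<delta>: "\<delta> > 0" "\<And>b. b \<in> A \<Longrightarrow> \<bar>b - a\<bar> < \<delta> \<Longrightarrow> b = a" using assms by blast
    obtain p where p: "p \<in> \<rat>" "a - \<delta> < p" "p < a" using Rats_dense_in_real[of "a - \<delta>" a] \<delta> by auto
    obtain r where r: "r \<in> \<rat>" "a < r" "r < a + \<delta>" using Rats_dense_in_real[of a "a + \<delta>"] \<delta> by auto
    have "b = a" if "b \<in> A" "p < b" "b < r" for b
      using \<delta>(2)[OF that(1)] that p r by linarith
    then show "a \<in> (\<Union>p\<in>\<rat>. \<Union>r\<in>\<rat>. C p r)"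
      unfolding C_def using a p r by blast
  qed
  moreover have "countable (C p r)" for p r
  proof (rule countable_finite)
    have "C p r \<subseteq> {a}" if "a \<in> C p r" for a using that unfolding C_def by blast
    then show "finite (C p r)" by (metis all_not_in_conv finite.emptyI finite.insertI finite_subset)
  qed
  ultimately show ?thesis
    by (rule countable_subset[OF _ countable_UN[OF countable_rat countable_UN[OF countable_rat]]])
qed

lemma isolated_level_points:
  fixes h :: "real \<Rightarrow> real"
  assumes "(h has_real_derivative D) (at a)" "D \<noteq> 0"
  shows "\<exists>\<delta>>0. \<forall>b. \<bar>b - a\<bar> < \<delta> \<longrightarrow> h b = h a \<longrightarrow> b = a"
proof -
  have "((\<lambda>b. (h b - h a) / (b - a)) \<longlongrightarrow> D) (at a)"
    using assms(1) by (simp add: has_field_derivative_iff)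
  then have "\<forall>\<^sub>F b in at a. (h b - h a) / (b - a) \<noteq> 0"
    using assms(2) by (rule tendsto_imp_eventually_ne)
  then obtain \<delta> where "\<delta> > 0" "\<And>b. b \<noteq> a \<Longrightarrow> dist b a < \<delta> \<Longrightarrow> (h b - h a) / (b - a) \<noteq> 0"
    unfolding eventually_at by auto
  then show ?thesis by (intro exI[of _ \<delta>]) (force simp: dist_real_def)
qed

section \<open>Geometry of the transport cost\<close>

lemma mult_cos_le_sin:
  fixes x :: real assumes "0 \<le> x" "x \<le> pi" shows "x * cos x \<le> sin x"
proof -
  have "\<exists>y. ((\<lambda>x. sin x - x * cos x) has_real_derivative y) (at t) \<and> 0 \<le> y" if "0 \<le> t" "t \<le> x" for t
  proof (intro exI conjI)
    show "((\<lambda>x. sin x - x * cos x) has_real_derivative (t * sin t)) (at t)"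
      by (auto intro!: derivative_eq_intros)
    show "0 \<le> t * sin t" using that assms by (intro mult_nonneg_nonneg sin_ge_zero) auto
  qed
  from DERIV_nonneg_imp_nondecreasing[OF assms(1) this] show ?thesis by simp
qed

lemma convex_arccos_square: "convex_on {-1<..<1} (\<lambda>u. (arccos u)\<^sup>2)"
proof -
  define f' where "f' u = - 2 * arccos u / sqrt (1 - u\<^sup>2)" for u :: real
  define f'' where "f'' u = 2 * (1 - arccos u * u / sqrt (1 - u\<^sup>2)) / (1 - u\<^sup>2)" for u :: real
  have pos: "1 - u\<^sup>2 > 0" if "-1 < u" "u < 1" for u :: real
  proof -
    have "(1 - u) * (1 + u) > 0" using that by (intro mult_pos_pos) auto
    then show ?thesis by (simp add: power2_eq_square algebra_simps)
  qed
  show ?thesis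
  proof (rule f''_ge0_imp_convex[where f'=f' and f''=f''])
    show "((\<lambda>u. (arccos u)\<^sup>2) has_real_derivative f' u) (at u)" if "u \<in> {-1<..<1}" for u
      using DERIV_power[OF DERIV_arccos[of u], of 2] that unfolding f'_def by (simp add: divide_inverse mult_ac)
    show "(f' has_real_derivative f'' u) (at u)" if "u \<in> {-1<..<1}" for u
    proof -
      have p: "1 - u\<^sup>2 > 0" using that pos by auto
      define w where "w = sqrt (1 - u\<^sup>2)"
      have w: "w > 0" "w * w = 1 - u\<^sup>2" using p by (auto simp: w_def)
      have da: "(arccos has_real_derivative inverse (- w)) (at u)"
        using DERIV_arccos[of u] that by (simp add: w_def)
      have d1: "((\<lambda>u. 1 - u\<^sup>2) has_real_derivative (- 2 * u)) (at u)"
        by (auto intro!: derivative_eq_intros)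
      have dw: "((\<lambda>u. sqrt (1 - u\<^sup>2)) has_real_derivative (inverse w / 2 * (- 2 * u))) (at u)"
        using DERIV_chain2[OF DERIV_real_sqrt[OF p] d1] by (simp add: w_def)
      have "(f' has_real_derivative (((- 2) * inverse (- w)) * w - ((- 2) * arccos u) * (inverse w / 2 * (- 2 * u))) / (w * w)) (at u)"
        unfolding f'_def using DERIV_divide[OF DERIV_cmult[OF da, of "-2"] dw] w(1) unfolding w_def[symmetric] by simp
      also have "(((- 2) * inverse (- w)) * w - ((- 2) * arccos u) * (inverse w / 2 * (- 2 * u))) / (w * w) = f'' u"
        unfolding f''_def w_def[symmetric] w(2)[symmetric] using w(1) by (simp add: field_simps)
      finally show ?thesis .
    qed
    show "0 \<le> f'' u" if "u \<in> {-1<..<1}" for u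
    proof -
      have p: "1 - u\<^sup>2 > 0" using that pos by auto
      have "arccos u * u \<le> sqrt (1 - u\<^sup>2)"
        using mult_cos_le_sin[of "arccos u"] that arccos_bounded[of u] by (simp add: sin_arccos)
      then have "0 \<le> 1 - arccos u * u / sqrt (1 - u\<^sup>2)" using p by simp
      then show ?thesis unfolding f''_def using p by (intro divide_nonneg_nonneg mult_nonneg_nonneg) auto
    qed
  qed auto
qed

lemma arccos_square_convex:
  fixes v w l :: real
  assumes v: "-1 \<le> v" "v \<le> 1" and w: "-1 \<le> w" "w \<le> 1" and l: "0 \<le> l" "l \<le> 1"
  shows "(arccos (l * v + (1 - l) * w))\<^sup>2 \<le> l * (arccos v)\<^sup>2 + (1 - l) * (arccos w)\<^sup>2"
proof -
  define r where "r n = 1 - inverse (real (Suc n))" for n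
  have r: "0 \<le> r n" "r n < 1" for n by (auto simp: r_def field_simps)
  have rl: "r \<longlonglongrightarrow> 1"
    unfolding r_def using tendsto_diff[OF tendsto_const[of 1] LIMSEQ_inverse_real_of_nat] by simp
  have in1: "\<bar>z\<bar> \<le> 1 \<Longrightarrow> \<bar>r n * z\<bar> < 1" for n z
    using r[of n] mult_left_mono[of "\<bar>z\<bar>" 1 "r n"] by (auto simp: abs_mult)
  have u: "\<bar>l * v + (1 - l) * w\<bar> \<le> 1"
  proof -
    have "l * v + (1 - l) * w \<le> l * 1 + (1 - l) * 1" using assms by (intro add_mono mult_left_mono) auto
    moreover have "l * v + (1 - l) * w \<ge> l * (-1) + (1 - l) * (-1)" using assms by (intro add_mono mult_left_mono) auto
    ultimately show ?thesis by simp
  qed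
  have lim: "(\<lambda>n. (arccos (r n * z))\<^sup>2) \<longlonglongrightarrow> (arccos z)\<^sup>2" if "\<bar>z\<bar> \<le> 1" for z
  proof -
    have "(\<lambda>n. arccos (r n * z)) \<longlonglongrightarrow> arccos (1 * z)"
    proof (rule continuous_on_tendsto_compose[OF continuous_on_arccos'])
      show "(\<lambda>n. r n * z) \<longlonglongrightarrow> 1 * z" by (intro tendsto_intros rl)
      show "\<forall>\<^sub>F n in sequentially. r n * z \<in> {- 1..1}"
        using less_imp_le[OF in1[OF that]] by (intro always_eventually allI) (auto simp: abs_le_iff)
    qed (use that in auto)
    then show ?thesis by (intro tendsto_power) simp
  qed
  show ?thesis
  proof (rule LIMSEQ_le)
    show "(\<lambda>n. (arccos (r n * (l * v + (1 - l) * w)))\<^sup>2) \<longlonglongrightarrow> (arccos (l * v + (1 - l) * w))\<^sup>2" by (rule lim[OF u])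
    show "(\<lambda>n. l * (arccos (r n * v))\<^sup>2 + (1 - l) * (arccos (r n * w))\<^sup>2) \<longlonglongrightarrow> l * (arccos v)\<^sup>2 + (1 - l) * (arccos w)\<^sup>2"
      using v w by (intro tendsto_intros lim) auto
    have "(arccos (r n * (l * v + (1 - l) * w)))\<^sup>2 \<le> l * (arccos (r n * v))\<^sup>2 + (1 - l) * (arccos (r n * w))\<^sup>2" for n
    proof -
      have "\<bar>r n * v\<bar> < 1" "\<bar>r n * w\<bar> < 1" using in1 v w by auto
      then have "r n * v \<in> {-1<..<1}" "r n * w \<in> {-1<..<1}" by (auto simp: abs_less_iff)
      from convex_onD[OF convex_arccos_square _ _ this(2,1), of l] l
      show ?thesis by (simp add: algebra_simps)
    qed
    then show "\<exists>N. \<forall>n\<ge>N. (arccos (r n * (l * v + (1 - l) * w)))\<^sup>2 \<le> l * (arccos (r n * v))\<^sup>2 + (1 - l) * (arccos (r n * w))\<^sup>2"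
      by blast
  qed
qed

lemma arccos_cos_square_le: "(arccos (cos t))\<^sup>2 \<le> t\<^sup>2"
proof -
  have "arccos (cos t) \<le> \<bar>t\<bar>"
  proof (cases "\<bar>t\<bar> \<le> pi")
    case True
    then show ?thesis using arccos_cos_eq_abs[of t] by simp
  next
    case False
    then show ?thesis using arccos_ubound[of "cos t"] by simp
  qed
  moreover have "0 \<le> arccos (cos t)" by (rule arccos_lbound) auto
  ultimately show ?thesis using power_mono[of "arccos (cos t)" "\<bar>t\<bar>" 2] by simp
qed

lemma abs_inner_unit_le: "norm x = 1 \<Longrightarrow> norm y = 1 \<Longrightarrow> \<bar>x \<bullet> y\<bar> \<le> 1" for x y :: "'a::real_inner"
  using Cauchy_Schwarz_ineq2[of x y] by simp

text \<open>
  The squared distance from \<open>x\<close> to a point at distance \<open>\<tau>\<close> from \<open>y\<close> is at most what the Euclidean law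
  of cosines gives, the sphere having nonnegative curvature. By the spherical law of cosines, its cosine
  interpolates linearly, in the cosine \<open>\<kappa>\<close> of the angle at \<open>y\<close>, between the cosines of \<open>a - \<tau>\<close> and
  \<open>a + \<tau>\<close>; convexity of the squared arc cosine does the rest.
\<close>
lemma hinge_comparison:
  fixes x y e :: "real ^ 'd"
  assumes x: "norm x = 1" and y: "norm y = 1" and \<kappa>: "\<bar>\<kappa>\<bar> \<le> 1" "x \<bullet> e = sin (arccos (x \<bullet> y)) * \<kappa>"
  shows "cost x (cos \<tau> *\<^sub>R y + sin \<tau> *\<^sub>R e) \<le> cost x y - arccos (x \<bullet> y) * \<kappa> * \<tau> + \<tau>\<^sup>2 / 2"
proof -
  define a where "a = arccos (x \<bullet> y)"
  have xe: "x \<bullet> e = sin a * \<kappa>" unfolding a_def by (rule \<kappa>(2))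
  have xy: "x \<bullet> y = cos a" using abs_inner_unit_le[OF x y] by (simp add: a_def cos_arccos_abs)
  define l where "l = (1 + \<kappa>) / 2"
  have l: "0 \<le> l" "l \<le> 1" using \<kappa>(1) by (auto simp: l_def)
  have "x \<bullet> (cos \<tau> *\<^sub>R y + sin \<tau> *\<^sub>R e) = cos a * cos \<tau> + sin a * sin \<tau> * \<kappa>"
    using xe by (simp add: inner_add_right xy)
  also have "\<dots> = l * cos (a - \<tau>) + (1 - l) * cos (a + \<tau>)"
    by (simp add: l_def cos_diff cos_add field_simps)
  finally have eq: "x \<bullet> (cos \<tau> *\<^sub>R y + sin \<tau> *\<^sub>R e) = l * cos (a - \<tau>) + (1 - l) * cos (a + \<tau>)" .
  have "(arccos (l * cos (a - \<tau>) + (1 - l) * cos (a + \<tau>)))\<^sup>2 \<le>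
      l * (arccos (cos (a - \<tau>)))\<^sup>2 + (1 - l) * (arccos (cos (a + \<tau>)))\<^sup>2"
    using l by (intro arccos_square_convex) auto
  also have "\<dots> \<le> l * (a - \<tau>)\<^sup>2 + (1 - l) * (a + \<tau>)\<^sup>2"
    using l by (intro add_mono mult_left_mono arccos_cos_square_le) auto
  also have "\<dots> = a\<^sup>2 - 2 * (a * \<kappa> * \<tau>) + \<tau>\<^sup>2" by (simp add: l_def power2_eq_square field_simps)
  finally show ?thesis unfolding cost_def eq a_def[symmetric] by simp
qed

text \<open>
  The inverse of the Riemannian exponential map at \<open>y\<close>; minus this vector is the gradient of
  \<open>cost x\<close> at \<open>y\<close>.
\<close>
definition log_map :: "real ^ 'd \<Rightarrow> real ^ 'd \<Rightarrow> real ^ 'd" where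
  "log_map x y = (1 / sinc (arccos (x \<bullet> y))) *\<^sub>R (x - (x \<bullet> y) *\<^sub>R y)"

lemma inner_log_map: "norm y = 1 \<Longrightarrow> log_map x y \<bullet> y = 0"
  by (simp add: log_map_def inner_diff_left dot_square_norm)

lemma arccos_less_pi: "-1 < u \<Longrightarrow> u \<le> 1 \<Longrightarrow> arccos u < pi"
  using arccos_less_arccos[of "-1" u] by simp

lemma sinc_pos: "0 \<le> t \<Longrightarrow> t < pi \<Longrightarrow> sinc t > 0" for t :: real
  by (auto simp: sin_gt_zero)

lemma norm_tangential:
  fixes x y :: "real ^ 'd"
  assumes "norm x = 1" "norm y = 1"
  shows "norm (x - (x \<bullet> y) *\<^sub>R y) = sin (arccos (x \<bullet> y))"
proof -
  have "(norm (x - (x \<bullet> y) *\<^sub>R y))\<^sup>2 = 1 - (x \<bullet> y)\<^sup>2"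
    using assms unfolding power2_norm_eq_inner norm_eq_1
    by (simp add: inner_diff_left inner_diff_right inner_commute power2_eq_square)
  then have "norm (x - (x \<bullet> y) *\<^sub>R y) = sqrt (1 - (x \<bullet> y)\<^sup>2)" by (metis norm_ge_zero real_sqrt_unique)
  then show ?thesis using abs_inner_unit_le[OF assms] by (simp add: sin_arccos_abs)
qed

lemma norm_log_map:
  fixes x y :: "real ^ 'd"
  assumes "norm x = 1" "norm y = 1" "x \<bullet> y > -1"
  shows "norm (log_map x y) = arccos (x \<bullet> y)"
proof -
  let ?a = "arccos (x \<bullet> y)"
  have a: "0 \<le> ?a" "?a < pi"
    using abs_inner_unit_le[OF assms(1,2)] assms(3) arccos_lbound arccos_less_pi by (auto simp: abs_le_iff)
  show ?thesis
    using sin_gt_zero[of ?a] a by (auto simp: log_map_def norm_tangential[OF assms(1,2)])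
qed

lemma log_map_inj:
  fixes x x' y :: "real ^ 'd"
  assumes "norm x = 1" "norm x' = 1" "norm y = 1" "x \<bullet> y > -1" "x' \<bullet> y > -1" "log_map x y = log_map x' y"
  shows "x = x'"
proof -
  have a: "arccos (x \<bullet> y) = arccos (x' \<bullet> y)"
    using norm_log_map assms by metis
  then have c: "x \<bullet> y = x' \<bullet> y"
    using abs_inner_unit_le[OF assms(1,3)] abs_inner_unit_le[OF assms(2,3)] arccos_eq_iff by blast
  have "sinc (arccos (x \<bullet> y)) > 0"
    using abs_inner_unit_le[OF assms(1,3)] assms(4)
    by (intro sinc_pos arccos_lbound arccos_less_pi) (auto simp: abs_le_iff)
  then have "x - (x \<bullet> y) *\<^sub>R y = x' - (x \<bullet> y) *\<^sub>R y"
    using assms(6) unfolding log_map_def c by (metis divide_eq_0_iff less_irrefl real_vector.scale_left_imp_eq zero_neq_one scaleR_cancel_left)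
  then show ?thesis by simp
qed

lemma continuous_on_log_map:
  fixes f g :: "'a::topological_space \<Rightarrow> real ^ 'd"
  assumes "continuous_on A f" "continuous_on A g" 
    and "\<And>z. z \<in> A \<Longrightarrow> norm (f z) = 1" "\<And>z. z \<in> A \<Longrightarrow> norm (g z) = 1" "\<And>z. z \<in> A \<Longrightarrow> f z \<bullet> g z > -1"
  shows "continuous_on A (\<lambda>z. log_map (f z) (g z))"
proof -
  have b: "-1 \<le> f z \<bullet> g z" "f z \<bullet> g z \<le> 1" if "z \<in> A" for z
    using abs_inner_unit_le[OF assms(3,4)[OF that]] by (auto simp: abs_le_iff)
  have "sinc (arccos (f z \<bullet> g z)) \<noteq> 0" if "z \<in> A" for z
    using sinc_pos[of "arccos (f z \<bullet> g z)"] arccos_lbound[OF b[OF that]] arccos_less_pi[OF assms(5)[OF that] b(2)[OF that]]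
    by force
  moreover have "continuous_on A (\<lambda>z. arccos (f z \<bullet> g z))"
    using b by (intro continuous_on_arccos continuous_on_inner assms) auto
  ultimately show ?thesis
    unfolding log_map_def
    by (intro continuous_on_scaleR continuous_on_divide continuous_on_const continuous_on_sinc
        continuous_on_diff continuous_on_inner assms) auto
qed

lemma cost_upper_tangent:
  fixes x y e :: "real ^ 'd"
  assumes x: "norm x = 1" and y: "norm y = 1" and e: "norm e = 1" "e \<bullet> y = 0" and xy: "x \<bullet> y > -1"
  shows "cost x (cos \<tau> *\<^sub>R y + sin \<tau> *\<^sub>R e) \<le> cost x y - (log_map x y \<bullet> e) * \<tau> + \<tau>\<^sup>2 / 2"
proof -
  let ?a = "arccos (x \<bullet> y)"
  have a: "0 \<le> ?a" "?a < pi"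
    using abs_inner_unit_le[OF x y] xy arccos_lbound arccos_less_pi by (auto simp: abs_le_iff)
  have xe: "x \<bullet> e = (x - (x \<bullet> y) *\<^sub>R y) \<bullet> e" using e by (simp add: inner_diff_left inner_commute[of y e])
  have b: "\<bar>x \<bullet> e\<bar> \<le> sin ?a"
    unfolding xe using Cauchy_Schwarz_ineq2[of "x - (x \<bullet> y) *\<^sub>R y" e] norm_tangential[OF x y] e(1) by simp
  have l: "log_map x y \<bullet> e = (1 / sinc ?a) * (x \<bullet> e)"
    unfolding log_map_def inner_scaleR_left xe[symmetric] ..
  define \<kappa> where "\<kappa> = (if ?a = 0 then 0 else (x \<bullet> e) / sin ?a)"
  have s: "sin ?a > 0" if "?a \<noteq> 0" using a that by (intro sin_gt_zero) auto
  have "\<bar>\<kappa>\<bar> \<le> 1" using b s by (auto simp: \<kappa>_def)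
  moreover have "x \<bullet> e = sin ?a * \<kappa>" using b s by (auto simp: \<kappa>_def)
  moreover have "?a * \<kappa> = log_map x y \<bullet> e" unfolding l using b s by (auto simp: \<kappa>_def)
  ultimately show ?thesis using hinge_comparison[OF x y, of \<kappa> e \<tau>] by simp
qed

text \<open>
  At the antipode the cost has a concave kink, and every value between the one-sided derivatives is
  an upper slope.
\<close>
lemma cost_upper_antipodal:
  fixes x e :: "real ^ 'd"
  assumes x: "norm x = 1" and e: "e \<bullet> x = 0" and \<kappa>: "\<bar>\<kappa>\<bar> \<le> 1"
  shows "cost x (cos \<tau> *\<^sub>R (- x) + sin \<tau> *\<^sub>R e) \<le> cost x (- x) - pi * \<kappa> * \<tau> + \<tau>\<^sup>2 / 2"
  using hinge_comparison[of x "- x" \<kappa> e \<tau>] x e \<kappa> by (simp add: dot_square_norm inner_commute)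

section \<open>Slopes along great circles\<close>

definition great_circle :: "real ^ 'd \<Rightarrow> real ^ 'd \<Rightarrow> real \<Rightarrow> real ^ 'd" where
  "great_circle q e \<omega> = cos \<omega> *\<^sub>R q + sin \<omega> *\<^sub>R e"

definition circle_tangent :: "real ^ 'd \<Rightarrow> real ^ 'd \<Rightarrow> real \<Rightarrow> real ^ 'd" where
  "circle_tangent q e \<omega> = cos \<omega> *\<^sub>R e - sin \<omega> *\<^sub>R q"

lemma great_circle_shift:
  "great_circle q e (\<omega> + \<tau>) = cos \<tau> *\<^sub>R great_circle q e \<omega> + sin \<tau> *\<^sub>R circle_tangent q e \<omega>"
  by (simp add: great_circle_def circle_tangent_def cos_add sin_add algebra_simps)

lemma great_circle_unit:
  assumes "norm q = 1" "norm e = 1" "q \<bullet> e = 0"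
  shows "norm (great_circle q e \<omega>) = 1" "norm (circle_tangent q e \<omega>) = 1" 
    "circle_tangent q e \<omega> \<bullet> great_circle q e \<omega> = 0" "great_circle q e \<omega> \<bullet> e = sin \<omega>"
    "v \<bullet> great_circle q e \<omega> = 0 \<Longrightarrow> cos \<omega> * (v \<bullet> circle_tangent q e \<omega>) = v \<bullet> e"
proof -
  have i: "q \<bullet> q = 1" "e \<bullet> e = 1" "e \<bullet> q = 0" using assms by (auto simp: dot_square_norm inner_commute)
  have cs: "cos \<omega> * cos \<omega> + sin \<omega> * sin \<omega> = 1" by (metis sin_cos_squared_add3)
  show "norm (great_circle q e \<omega>) = 1" "norm (circle_tangent q e \<omega>) = 1"
    unfolding norm_eq_1 great_circle_def circle_tangent_def
    using i assms(3) cs by (simp_all add: inner_add_left inner_add_right inner_diff_left inner_diff_right algebra_simps)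
  show "circle_tangent q e \<omega> \<bullet> great_circle q e \<omega> = 0" "great_circle q e \<omega> \<bullet> e = sin \<omega>"
    unfolding great_circle_def circle_tangent_def
    using i assms(3) by (simp_all add: inner_add_left inner_add_right inner_diff_left inner_diff_right)
  have "e = cos \<omega> *\<^sub>R circle_tangent q e \<omega> + sin \<omega> *\<^sub>R great_circle q e \<omega>"
  proof -
    have "cos \<omega> *\<^sub>R circle_tangent q e \<omega> + sin \<omega> *\<^sub>R great_circle q e \<omega> = (cos \<omega> * cos \<omega>) *\<^sub>R e + (sin \<omega> * sin \<omega>) *\<^sub>R e"
      by (simp add: great_circle_def circle_tangent_def algebra_simps)
    then show ?thesis by (simp only: scaleR_add_left[symmetric] cs scaleR_one)
  qed
  then show "cos \<omega> * (v \<bullet> circle_tangent q e \<omega>) = v \<bullet> e" if "v \<bullet> great_circle q e \<omega> = 0"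
    by (metis add.right_neutral inner_add_right inner_scaleR_right mult_zero_right that)
qed

text \<open>
  \<open>p\<close> is a supergradient of the semiconcave function \<open>cost x\<close> along the great circle, with semiconcavity
  constant one.
\<close>
definition circle_slope :: "real ^ 'd \<Rightarrow> real ^ 'd \<Rightarrow> real ^ 'd \<Rightarrow> real \<Rightarrow> real \<Rightarrow> bool" where
  "circle_slope q e x \<omega> p \<longleftrightarrow> (\<forall>\<tau>. cost x (great_circle q e (\<omega> + \<tau>)) \<le> cost x (great_circle q e \<omega>) + p * \<tau> + \<tau>\<^sup>2 / 2)"

lemma circle_slope_log_map:
  assumes "norm q = 1" "norm e = 1" "q \<bullet> e = 0" "norm x = 1" "x \<bullet> great_circle q e \<omega> > -1"
  shows "circle_slope q e x \<omega> (- (log_map x (great_circle q e \<omega>) \<bullet> circle_tangent q e \<omega>))"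
  unfolding circle_slope_def great_circle_shift
  using cost_upper_tangent[OF assms(4) great_circle_unit(1,2,3)[OF assms(1-3)] assms(5)] by simp

lemma circle_slope_antipodal:
  assumes "norm q = 1" "norm e = 1" "q \<bullet> e = 0" "x = - great_circle q e \<omega>" "\<bar>\<kappa>\<bar> \<le> 1"
  shows "circle_slope q e x \<omega> (- (pi * \<kappa>))"
proof -
  have x: "great_circle q e \<omega> = - x" using assms(4) by simp
  have "norm x = 1" "circle_tangent q e \<omega> \<bullet> x = 0"
    using great_circle_unit(1,3)[OF assms(1-3), of \<omega>] unfolding x by auto
  then show ?thesis
    unfolding circle_slope_def great_circle_shift x
    using cost_upper_antipodal[of x "circle_tangent q e \<omega>" \<kappa>] assms(5) by simp
qed

text \<open>
  Adding the semiconcavity bounds at two points to the monotonicity shows that slope minus angle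
  decreases along the circle. Hence the slope intervals of different points are disjoint, and only
  countably many of them can be nondegenerate.
\<close>
lemma countable_ambiguous_slopes:
  assumes mono: "\<And>x y x' y'. (x, y) \<in> \<Gamma> \<Longrightarrow> (x', y') \<in> \<Gamma> \<Longrightarrow> cost x y + cost x' y' \<le> cost x y' + cost x' y"
  shows "countable {\<omega>. \<exists>x x' p p'. (x, great_circle q e \<omega>) \<in> \<Gamma> \<and> (x', great_circle q e \<omega>) \<in> \<Gamma> \<and>
     circle_slope q e x \<omega> p \<and> circle_slope q e x' \<omega> p' \<and> p < p'}" (is "countable ?A")
proof -
  have dec: "p' - \<omega>' \<le> p - \<omega>" if "\<omega> < \<omega>'" "(x, great_circle q e \<omega>) \<in> \<Gamma>" "(x', great_circle q e \<omega>') \<in> \<Gamma>"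
    "circle_slope q e x \<omega> p" "circle_slope q e x' \<omega>' p'" for \<omega> \<omega>' x x' p p'
  proof -
    define \<tau> where "\<tau> = \<omega>' - \<omega>"
    have \<tau>: "\<tau> > 0" using that(1) by (simp add: \<tau>_def)
    have 1: "cost x (great_circle q e \<omega>') \<le> cost x (great_circle q e \<omega>) + p * \<tau> + \<tau>\<^sup>2 / 2"
      using that(4)[unfolded circle_slope_def, rule_format, of \<tau>] by (simp add: \<tau>_def)
    have 2: "cost x' (great_circle q e \<omega>) \<le> cost x' (great_circle q e \<omega>') - p' * \<tau> + \<tau>\<^sup>2 / 2"
      using that(5)[unfolded circle_slope_def, rule_format, of "- \<tau>"]
      by (simp add: \<tau>_def power2_commute right_diff_distrib)
    have "0 \<le> (p - p') * \<tau> + \<tau>\<^sup>2"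
      using 1 2 mono[OF that(2,3)] by (simp add: left_diff_distrib)
    also have "\<dots> = (p - p' + \<tau>) * \<tau>" by (simp add: power2_eq_square algebra_simps)
    finally have "0 \<le> p - p' + \<tau>" using \<tau> by (simp add: zero_le_mult_iff)
    then show ?thesis by (simp add: \<tau>_def)
  qed
  define sep where "sep \<omega> r \<longleftrightarrow> r \<in> \<rat> \<and> (\<exists>x x' p p'. (x, great_circle q e \<omega>) \<in> \<Gamma> \<and> (x', great_circle q e \<omega>) \<in> \<Gamma> \<and>
     circle_slope q e x \<omega> p \<and> circle_slope q e x' \<omega> p' \<and> p - \<omega> < r \<and> r < p' - \<omega>)" for \<omega> r
  have "\<exists>r. sep \<omega> r" if \<omega>: "\<omega> \<in> ?A" for \<omega>
  proof -
    obtain x x' p p' where *: "(x, great_circle q e \<omega>) \<in> \<Gamma>" "(x', great_circle q e \<omega>) \<in> \<Gamma>"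
     "circle_slope q e x \<omega> p" "circle_slope q e x' \<omega> p'" "p < p'" using \<omega> by blast
    then obtain r where "r \<in> \<rat>" "p - \<omega> < r" "r < p' - \<omega>" using Rats_dense_in_real[of "p - \<omega>" "p' - \<omega>"] by auto
    then show ?thesis using * unfolding sep_def by blast
  qed
  then have "\<forall>\<omega>\<in>?A. \<exists>r. sep \<omega> r" by blast
  from bchoice[OF this] obtain r where r: "\<And>\<omega>. \<omega> \<in> ?A \<Longrightarrow> sep \<omega> (r \<omega>)" by blast
  have less: "r \<omega>' < r \<omega>" if A: "\<omega> \<in> ?A" "\<omega>' \<in> ?A" "\<omega> < \<omega>'" for \<omega> \<omega>'
  proof -
    obtain x p where 1: "(x, great_circle q e \<omega>) \<in> \<Gamma>" "circle_slope q e x \<omega> p" "p - \<omega> < r \<omega>"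
      using r[OF A(1)] unfolding sep_def by blast
    obtain x' p' where 2: "(x', great_circle q e \<omega>') \<in> \<Gamma>" "circle_slope q e x' \<omega>' p'" "r \<omega>' < p' - \<omega>'"
      using r[OF A(2)] unfolding sep_def by blast
    show ?thesis using dec[OF A(3) 1(1) 2(1) 1(2) 2(2)] 1(3) 2(3) by linarith
  qed
  have "inj_on r ?A"
  proof (rule inj_onI, rule ccontr)
    fix v w assume vw: "v \<in> ?A" "w \<in> ?A" "r v = r w" "v \<noteq> w"
    then consider "v < w" | "w < v" by linarith
    then show False using less[OF vw(1,2)] less[OF vw(2,1)] vw(3) by cases auto
  qed
  moreover have "countable (r ` ?A)"
  proof (rule countable_subset[OF _ countable_rat], rule image_subsetI)
    fix \<omega> assume "\<omega> \<in> ?A"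
    from r[OF this] show "r \<omega> \<in> \<rat>" unfolding sep_def by blast
  qed
  ultimately show ?thesis by (rule countable_image_inj_on[rotated])
qed

section \<open>Null sets defined by the transport cost\<close>

lemma axis_unit: "norm (axis k (1::real)) = 1"
  by simp

lemma borel_compact_UN: "(\<And>j::nat. compact (U j)) \<Longrightarrow> (\<Union>j. U j) \<in> sets borel" for U :: "nat \<Rightarrow> 'a::t2_space set"
  by (intro sets.countable_UN) (auto intro: borel_compact)

lemma axis_neq:
  assumes "k1 \<noteq> k2"
  shows "axis k1 (1::real) \<noteq> axis k2 1" "axis k1 (1::real) \<noteq> - axis k2 1"
proof -
  have "axis k1 (1::real) $ k1 = 1" "axis k2 (1::real) $ k1 = 0" using assms by (auto simp: axis_def)
  then show "axis k1 (1::real) \<noteq> axis k2 1" "axis k1 (1::real) \<noteq> - axis k2 1" by (force, force)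
qed

lemma compact_of_closed_subset: "compact K \<Longrightarrow> closed C \<Longrightarrow> C \<subseteq> K \<Longrightarrow> compact C"
  for C K :: "'a::t2_space set"
  using compact_Int_closed[of K C] by (simp add: Int_absorb1)

text \<open>
  Two preimages of a point have different logarithms there, so along some coordinate direction they
  give two slopes; a preimage antipodal to its image gives two slopes by itself. Compactness
  makes the exceptional set a countable union of compact sets.
\<close>
lemma ambiguous_fibre_null:
  fixes F :: "real ^ 'd \<Rightarrow> real ^ 'd"
  assumes d: "CARD('d) \<ge> 2"
    and F: "continuous_on (sphere 0 1) F" "F ` sphere 0 1 \<subseteq> sphere 0 1"
    and mono: "\<And>x x'. norm x = 1 \<Longrightarrow> norm x' = 1 \<Longrightarrow> cost x (F x) + cost x' (F x') \<le> cost x (F x') + cost x' (F x)"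
  obtains N where "N \<in> sets sphere_borel" "emeasure surface_measure N = 0"
    "\<And>x x'. norm x = 1 \<Longrightarrow> norm x' = 1 \<Longrightarrow> F x = F x' \<Longrightarrow> F x \<notin> N \<Longrightarrow> x = x'"
proof -
  let ?S = "sphere (0::real ^ 'd) 1"
  define \<Gamma> where "\<Gamma> = (\<lambda>x. (x, F x)) ` ?S"
  have FS: "norm (F x) = 1" if "norm x = 1" for x using F(2) that by (auto simp: image_subset_iff)
  have ambiguous: "countable {\<omega>. \<exists>x x' p p'. (x, great_circle q e \<omega>) \<in> \<Gamma> \<and> (x', great_circle q e \<omega>) \<in> \<Gamma> \<and>
     circle_slope q e x \<omega> p \<and> circle_slope q e x' \<omega> p' \<and> p < p'}" for q e
    by (rule countable_ambiguous_slopes) (auto simp: \<Gamma>_def intro: mono)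
  define A where "A = F ` {x \<in> ?S. F x = - x}"
  have A_compact: "compact A"
    unfolding A_def
  proof (rule compact_continuous_image)
    show "continuous_on {x \<in> ?S. F x = - x} F" using F(1) by (rule continuous_on_subset) auto
    have "closed {x \<in> ?S. F x = - x}"
      by (intro continuous_closed_preimage_constant[of ?S "\<lambda>x. F x + x" 0, simplified eq_neg_iff_add_eq_0[symmetric]])
         (intro continuous_intros F, auto)
    then show "compact {x \<in> ?S. F x = - x}"
      by (rule compact_of_closed_subset[OF compact_sphere[of 0 1]]) auto
  qed
  have A_null: "emeasure surface_measure (A - {axis k 1, - axis k 1}) = 0" for k :: 'd
  proof (rule surface_null_of_countable_great_circles[where e="axis k 1"])
    show "A - {axis k 1, - axis k 1} \<in> sets sphere_borel"
      using A_compact FS by (auto simp: sets_sphere_borel_iff A_def borel_compact)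
    fix q :: "real ^ 'd" assume q: "norm q = 1" "q \<bullet> axis k 1 = 0"
    show "countable {\<omega>. - (pi/2) < \<omega> \<and> \<omega> < pi/2 \<and> cos \<omega> *\<^sub>R q + sin \<omega> *\<^sub>R axis k 1 \<in> A - {axis k 1, - axis k 1}}"
    proof (rule countable_subset[OF _ ambiguous[of q "axis k 1"]], rule subsetI, unfold mem_Collect_eq)
      fix \<omega> assume "- (pi/2) < \<omega> \<and> \<omega> < pi/2 \<and> cos \<omega> *\<^sub>R q + sin \<omega> *\<^sub>R axis k 1 \<in> A - {axis k 1, - axis k 1}"
      then have "great_circle q (axis k 1) \<omega> \<in> A" by (simp add: great_circle_def)
      then obtain x where x: "norm x = 1" "F x = - x" "F x = great_circle q (axis k 1) \<omega>" by (auto simp: A_def)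
      then have xx: "x = - great_circle q (axis k 1) \<omega>" by (metis minus_minus)
      have "(x, great_circle q (axis k 1) \<omega>) \<in> \<Gamma>" using x by (auto simp: \<Gamma>_def image_iff)
      moreover have "circle_slope q (axis k 1) x \<omega> (- (pi * 1))" "circle_slope q (axis k 1) x \<omega> (- (pi * (-1)))"
        by (rule circle_slope_antipodal[OF q(1) axis_unit q(2) xx], simp)+
      moreover have "- (pi * 1) < - (pi * (-1))" by simp
      ultimately show "\<exists>x x' p p'. (x, great_circle q (axis k 1) \<omega>) \<in> \<Gamma> \<and> (x', great_circle q (axis k 1) \<omega>) \<in> \<Gamma> \<and>
         circle_slope q (axis k 1) x \<omega> p \<and> circle_slope q (axis k 1) x' \<omega> p' \<and> p < p'" by blast
    qed
  qed auto
  define R where "R k j = {z \<in> ?S \<times> ?S. F (fst z) = F (snd z) \<and>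
      fst z \<bullet> F (fst z) \<ge> -1 + inverse (real (Suc j)) \<and> snd z \<bullet> F (snd z) \<ge> -1 + inverse (real (Suc j)) \<and>
      \<bar>log_map (fst z) (F (fst z)) $ k - log_map (snd z) (F (snd z)) $ k\<bar> \<ge> inverse (real (Suc j))}" for k :: 'd and j :: nat
  define B where "B k = (\<Union>j. (\<lambda>z. F (fst z)) ` R k j)" for k
  have R_compact: "compact (R k j)" for k j
  proof -
    let ?D = "{z \<in> ?S \<times> ?S. F (fst z) = F (snd z) \<and>
      fst z \<bullet> F (fst z) \<ge> -1 + inverse (real (Suc j)) \<and> snd z \<bullet> F (snd z) \<ge> -1 + inverse (real (Suc j))}"
    have cF: "continuous_on (?S \<times> ?S) (\<lambda>z. F (fst z))" "continuous_on (?S \<times> ?S) (\<lambda>z. F (snd z))"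
      by (intro continuous_on_compose2[OF F(1)] continuous_intros; auto)+
    have cl: "closed (?S \<times> ?S)" by (intro closed_Times) auto
    have D: "closed ?D"
    proof -
      have 1: "closed {z \<in> ?S \<times> ?S. F (fst z) - F (snd z) = 0}"
        by (rule continuous_closed_preimage_constant) (intro continuous_intros cF cl)+
      have 2: "closed {z \<in> ?S \<times> ?S. fst z \<bullet> F (fst z) \<ge> -1 + inverse (real (Suc j))}"
        by (rule continuous_on_closed_Collect_le[OF _ _ cl]) (intro continuous_intros cF)+
      have 3: "closed {z \<in> ?S \<times> ?S. snd z \<bullet> F (snd z) \<ge> -1 + inverse (real (Suc j))}"
        by (rule continuous_on_closed_Collect_le[OF _ _ cl]) (intro continuous_intros cF)+
      have "?D = {z \<in> ?S \<times> ?S. F (fst z) - F (snd z) = 0} \<inter> {z \<in> ?S \<times> ?S. fst z \<bullet> F (fst z) \<ge> -1 + inverse (real (Suc j))}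
         \<inter> {z \<in> ?S \<times> ?S. snd z \<bullet> F (snd z) \<ge> -1 + inverse (real (Suc j))}" by auto
      then show ?thesis using closed_Int[OF closed_Int[OF 1 2] 3] by (simp only:)
    qed
    have gt: "z \<in> ?D \<Longrightarrow> fst z \<bullet> F (fst z) > -1 \<and> snd z \<bullet> F (snd z) > -1" for z
      using inverse_positive_iff_positive[of "real (Suc j)"] by (auto simp del: inverse_positive_iff_positive of_nat_Suc)
    have "continuous_on ?D (\<lambda>z. log_map (fst z) (F (fst z)))" "continuous_on ?D (\<lambda>z. log_map (snd z) (F (snd z)))"
      using gt FS by (intro continuous_on_log_map continuous_on_subset[OF cF(1)] continuous_on_subset[OF cF(2)] continuous_intros; auto)+
    then have 4: "closed {z \<in> ?D. inverse (real (Suc j)) \<le> \<bar>log_map (fst z) (F (fst z)) $ k - log_map (snd z) (F (snd z)) $ k\<bar>}"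
      by (intro continuous_on_closed_Collect_le[OF _ _ D] continuous_intros)
    have "R k j = {z \<in> ?D. inverse (real (Suc j)) \<le> \<bar>log_map (fst z) (F (fst z)) $ k - log_map (snd z) (F (snd z)) $ k\<bar>}"
      by (auto simp: R_def)
    then have "closed (R k j)" using 4 by (simp only:)
    moreover have "R k j \<subseteq> ?S \<times> ?S" by (auto simp: R_def)
    moreover have "compact (?S \<times> ?S)" by (intro compact_Times compact_sphere)
    ultimately show ?thesis using compact_of_closed_subset by blast
  qed
  have FR_compact: "compact ((\<lambda>z. F (fst z)) ` R k j)" for k j
    by (intro compact_continuous_image R_compact continuous_on_compose2[OF F(1)] continuous_intros) (auto simp: R_def)
  have BS: "B k \<subseteq> ?S" for k using FS by (auto simp: B_def R_def)
  have B_borel: "B k \<in> sets sphere_borel" for k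
    using BS borel_compact_UN[OF FR_compact] unfolding B_def by (auto simp: sets_sphere_borel_iff)
  have B_iff: "y \<in> B k \<longleftrightarrow> (\<exists>x x'. norm x = 1 \<and> norm x' = 1 \<and> F x = y \<and> F x' = y \<and> x \<bullet> y > -1 \<and> x' \<bullet> y > -1 \<and>
     log_map x y $ k \<noteq> log_map x' y $ k)" for y k
  proof
    assume "y \<in> B k"
    then obtain j z where z: "z \<in> R k j" "y = F (fst z)" by (auto simp: B_def)
    define i where "i = inverse (real (Suc j))"
    have "i > 0" by (simp add: i_def)
    then have "fst z \<bullet> y > -1" "snd z \<bullet> y > -1" "log_map (fst z) y $ k \<noteq> log_map (snd z) y $ k"
      "norm (fst z) = 1" "norm (snd z) = 1" "F (snd z) = y"
      using z unfolding R_def i_def[symmetric] by auto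
    then show "\<exists>x x'. norm x = 1 \<and> norm x' = 1 \<and> F x = y \<and> F x' = y \<and> x \<bullet> y > -1 \<and> x' \<bullet> y > -1 \<and>
       log_map x y $ k \<noteq> log_map x' y $ k"
      by (intro exI[of _ "fst z"] exI[of _ "snd z"] conjI) (simp_all only: z(2))
  next
    assume "\<exists>x x'. norm x = 1 \<and> norm x' = 1 \<and> F x = y \<and> F x' = y \<and> x \<bullet> y > -1 \<and> x' \<bullet> y > -1 \<and>
       log_map x y $ k \<noteq> log_map x' y $ k"
    then obtain x x' where x: "norm x = 1" "norm x' = 1" "F x = y" "F x' = y" "x \<bullet> y > -1" "x' \<bullet> y > -1"
       "log_map x y $ k \<noteq> log_map x' y $ k" by blast
    define m where "m = min (min (x \<bullet> y + 1) (x' \<bullet> y + 1)) \<bar>log_map x y $ k - log_map x' y $ k\<bar>"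
    have "m > 0" using x by (auto simp: m_def)
    then obtain j where j: "inverse (real (Suc j)) < m" using reals_Archimedean by blast
    then have "(x, x') \<in> R k j" using x unfolding R_def m_def by (auto simp del: of_nat_Suc)
    then have "F (fst (x, x')) \<in> (\<lambda>z. F (fst z)) ` R k j" by (rule imageI)
    then show "y \<in> B k" using x(3) unfolding B_def by auto
  qed
  have B_null: "emeasure surface_measure (B k) = 0" for k
  proof (rule surface_null_of_countable_great_circles[where e="axis k 1", OF B_borel axis_unit])
    have "log_map x y $ k = 0" if "y = axis k 1 \<or> y = - axis k 1" for x y :: "real ^ 'd"
      using inner_log_map[of y x] that by (auto simp: inner_axis)
    then show "axis k 1 \<notin> B k" "- axis k 1 \<notin> B k" unfolding B_iff by auto
    fix q :: "real ^ 'd" assume q: "norm q = 1" "q \<bullet> axis k 1 = 0"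
    let ?e = "axis k (1::real)"
    show "countable {\<omega>. - (pi/2) < \<omega> \<and> \<omega> < pi/2 \<and> cos \<omega> *\<^sub>R q + sin \<omega> *\<^sub>R ?e \<in> B k}"
    proof (rule countable_subset[OF _ ambiguous[of q ?e]], rule subsetI, unfold mem_Collect_eq)
      fix \<omega> assume \<omega>: "- (pi/2) < \<omega> \<and> \<omega> < pi/2 \<and> cos \<omega> *\<^sub>R q + sin \<omega> *\<^sub>R ?e \<in> B k"
      let ?y = "great_circle q ?e \<omega>" and ?t = "circle_tangent q ?e \<omega>"
      have "?y \<in> B k" using \<omega> by (simp add: great_circle_def)
      then obtain x x' where x: "norm x = 1" "norm x' = 1" "F x = ?y" "F x' = ?y" "x \<bullet> ?y > -1" "x' \<bullet> ?y > -1"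
        "log_map x ?y $ k \<noteq> log_map x' ?y $ k" unfolding B_iff by blast
      have \<Gamma>: "(x, ?y) \<in> \<Gamma>" "(x', ?y) \<in> \<Gamma>" using x by (auto simp: \<Gamma>_def image_iff)
      have sl: "circle_slope q ?e x \<omega> (- (log_map x ?y \<bullet> ?t))" "circle_slope q ?e x' \<omega> (- (log_map x' ?y \<bullet> ?t))"
        using circle_slope_log_map[OF q(1) axis_unit q(2)] x by auto
      have u: "norm ?y = 1" by (rule great_circle_unit[OF q(1) axis_unit q(2)])
      have c: "cos \<omega> * (log_map z ?y \<bullet> ?t) = log_map z ?y $ k" for z
        using great_circle_unit(5)[OF q(1) axis_unit q(2) inner_log_map[OF u]] by (simp add: inner_axis)
      have "log_map x ?y \<bullet> ?t \<noteq> log_map x' ?y \<bullet> ?t" using c[of x] c[of x'] x(7) by auto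
      then consider "- (log_map x ?y \<bullet> ?t) < - (log_map x' ?y \<bullet> ?t)" | "- (log_map x' ?y \<bullet> ?t) < - (log_map x ?y \<bullet> ?t)"
        by linarith
      then show "\<exists>x x' p p'. (x, ?y) \<in> \<Gamma> \<and> (x', ?y) \<in> \<Gamma> \<and> circle_slope q ?e x \<omega> p \<and> circle_slope q ?e x' \<omega> p' \<and> p < p'"
        using \<Gamma> sl by cases blast+
    qed
  qed
  obtain k1 k2 :: 'd where k: "k1 \<noteq> k2"
    using d by (metis UNIV_I card_2_iff' card_le_Suc0_iff_eq finite_code not_less_eq_eq numeral_2_eq_2)
  define N where "N = A \<union> (\<Union>k. B k)"
  have A_borel: "A \<in> sets sphere_borel" using A_compact FS by (auto simp: sets_sphere_borel_iff A_def borel_compact)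
  have A1: "A - {axis k 1, - axis k 1} \<in> null_sets surface_measure" for k :: 'd
    using A_null A_borel by (auto simp: null_sets_def sets_sphere_borel_iff)
  have A2: "A \<subseteq> (A - {axis k1 1, - axis k1 1}) \<union> (A - {axis k2 1, - axis k2 1})"
  proof
    fix v assume v: "v \<in> A"
    show "v \<in> (A - {axis k1 1, - axis k1 1}) \<union> (A - {axis k2 1, - axis k2 1})"
    proof (cases "v = axis k1 1 \<or> v = - axis k1 1")
      case True
      then have "v \<noteq> axis k2 1" "v \<noteq> - axis k2 1"
        using axis_neq[OF k] by (metis minus_minus)+
      then show ?thesis using v by blast
    qed (use v in blast)
  qed
  have "A \<in> sets surface_measure" using A_borel by simp
  then have A0: "A \<in> null_sets surface_measure"
    by (rule null_sets_subset[OF null_sets.Un[OF A1 A1] _ A2])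
  have "B k \<in> null_sets surface_measure" for k using B_borel B_null by (auto simp: null_sets_def)
  then have "(\<Union>k\<in>UNIV. B k) \<in> null_sets surface_measure"
    by (intro null_sets.finite_UN) auto
  then have "N \<in> null_sets surface_measure" unfolding N_def using A0 by auto
  moreover have "x = x'" if x: "norm x = 1" "norm x' = 1" "F x = F x'" "F x \<notin> N" for x x'
  proof -
    have anti: "F z \<in> A" if "norm z = 1" "z \<bullet> F z \<le> -1" for z
    proof -
      have "(norm (z + F z))\<^sup>2 = 2 + 2 * (z \<bullet> F z)"
        unfolding power2_norm_eq_inner using that(1) FS[OF that(1)]
        by (simp add: inner_add_left inner_add_right inner_commute norm_eq_1)
      then have "(norm (z + F z))\<^sup>2 \<le> 0" using that(2) by simp
      then have "F z = - z" by (simp add: add_eq_0_iff)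
      then show ?thesis using that(1) by (auto simp: A_def)
    qed
    have nA: "F x \<notin> A" and nB: "F x \<notin> B k" for k using x(4) unfolding N_def by blast+
    have g1: "x \<bullet> F x > -1" using anti[OF x(1)] nA by linarith
    have "\<not> x' \<bullet> F x' \<le> -1" using anti[OF x(2)] nA x(3) by metis
    then have g2: "x' \<bullet> F x > -1" using x(3) by simp
    have "log_map x (F x) $ k = log_map x' (F x) $ k" for k
    proof (rule ccontr)
      assume "log_map x (F x) $ k \<noteq> log_map x' (F x) $ k"
      then have "F x \<in> B k"
        unfolding B_iff using x(1,2) x(3)[symmetric] g1 g2 by (intro exI[of _ x] exI[of _ x'] conjI refl)
      then show False using nB by blast
    qed
    then have "log_map x (F x) = log_map x' (F x)" by (simp add: vec_eq_iff)
    then show ?thesis by (rule log_map_inj[OF x(1,2) FS[OF x(1)] g1 g2])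
  qed
  ultimately show ?thesis using that[of N] by (auto simp: null_sets_def)
qed

lemma point_null:
  fixes a :: "real ^ 'd"
  assumes d: "CARD('d) \<ge> 2" and a: "norm a = 1"
  shows "{a} \<in> null_sets surface_measure"
proof -
  obtain k1 k2 :: 'd where "k1 \<noteq> k2"
    using d by (metis UNIV_I card_2_iff' card_le_Suc0_iff_eq finite_code not_less_eq_eq numeral_2_eq_2)
  then have *: "axis k1 (1::real) $ k2 = 0" "axis k2 (1::real) $ k2 = 1" by (auto simp: axis_def)
  have "\<exists>k. axis k 1 \<noteq> a \<and> - axis k 1 \<noteq> a"
  proof (cases "axis k1 1 = a \<or> - axis k1 1 = a")
    case True
    then have "a $ k2 = 0" using * by auto
    then have "axis k2 1 \<noteq> a" "- axis k2 1 \<noteq> a" using * by auto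
    then show ?thesis by blast
  qed blast
  then obtain k :: 'd where k: "axis k 1 \<noteq> a" "- axis k 1 \<noteq> a" by blast
  have "emeasure surface_measure {a} = 0"
  proof (rule surface_null_of_countable_great_circles[where e="axis k 1"])
    show "{a} \<in> sets sphere_borel" using a by (auto simp: sets_sphere_borel_iff)
    fix q :: "real ^ 'd" assume q: "norm q = 1" "q \<bullet> axis k 1 = 0"
    have "{\<omega>. - (pi/2) < \<omega> \<and> \<omega> < pi/2 \<and> cos \<omega> *\<^sub>R q + sin \<omega> *\<^sub>R axis k 1 \<in> {a}} \<subseteq> {arcsin (a \<bullet> axis k 1)}"
      using great_circle_unit(4)[OF q(1) axis_unit q(2)] by (auto simp: great_circle_def arcsin_sin)
    then show "countable {\<omega>. - (pi/2) < \<omega> \<and> \<omega> < pi/2 \<and> cos \<omega> *\<^sub>R q + sin \<omega> *\<^sub>R axis k 1 \<in> {a}}"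
      by (rule countable_subset) simp
  qed (use k in auto)
  then show ?thesis using a by (auto simp: null_sets_def sets_sphere_borel_iff)
qed

lemma cost_derivative:
  assumes "norm q = 1" "norm e = 1" "q \<bullet> e = 0" "norm a = 1"
    and "-1 < great_circle q e \<omega> \<bullet> a" "great_circle q e \<omega> \<bullet> a < 1"
  shows "((\<lambda>\<omega>. cost (great_circle q e \<omega>) a) has_real_derivative
     - (log_map a (great_circle q e \<omega>) \<bullet> circle_tangent q e \<omega>)) (at \<omega>)"
proof -
  let ?u = "\<lambda>\<omega>. great_circle q e \<omega> \<bullet> a"
  let ?y = "great_circle q e \<omega>" and ?t = "circle_tangent q e \<omega>"
  have du: "(?u has_real_derivative (?t \<bullet> a)) (at \<omega>)"
    unfolding great_circle_def circle_tangent_def inner_add_left inner_scaleR_left inner_diff_left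
    by (auto intro!: derivative_eq_intros)
  have "((\<lambda>\<omega>. arccos (?u \<omega>)) has_real_derivative (inverse (- sqrt (1 - (?u \<omega>)\<^sup>2)) * (?t \<bullet> a))) (at \<omega>)"
    by (rule DERIV_chain2[OF DERIV_arccos du]) (use assms in auto)
  from DERIV_cdivide[OF DERIV_power[OF this, of 2], of 2]
  have "((\<lambda>\<omega>. cost (great_circle q e \<omega>) a) has_real_derivative
     (arccos (?u \<omega>) * (inverse (- sqrt (1 - (?u \<omega>)\<^sup>2)) * (?t \<bullet> a)))) (at \<omega>)"
    unfolding cost_def by (rule DERIV_cong) simp
  moreover have "log_map a ?y \<bullet> ?t = arccos (?u \<omega>) * (inverse (sqrt (1 - (?u \<omega>)\<^sup>2)) * (?t \<bullet> a))"
  proof -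
    have s: "sin (arccos (?u \<omega>)) = sqrt (1 - (?u \<omega>)\<^sup>2)" using assms(5,6) by (intro sin_arccos) auto
    have "arccos (?u \<omega>) \<noteq> 0" using assms(5,6) arccos_eq_0_iff[of "?u \<omega>"] by auto
    then have "1 / sinc (arccos (?u \<omega>)) = arccos (?u \<omega>) * inverse (sqrt (1 - (?u \<omega>)\<^sup>2))"
      by (simp add: s divide_inverse)
    moreover have "?y \<bullet> ?t = 0" using great_circle_unit(3)[OF assms(1-3)] by (simp add: inner_commute)
    ultimately show ?thesis
      unfolding log_map_def inner_commute[of a ?y] by (simp add: inner_diff_left inner_commute[of a ?t])
  qed
  ultimately show ?thesis by simp
qed

lemma cost_continuous: "continuous_on A f \<Longrightarrow> continuous_on A g \<Longrightarrow> (\<And>z. z \<in> A \<Longrightarrow> norm (f z) = 1) \<Longrightarrow> (\<And>z. z \<in> A \<Longrightarrow> norm (g z) = 1)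
   \<Longrightarrow> continuous_on A (\<lambda>z. cost (f z) (g z))"
  unfolding cost_def using abs_inner_unit_le
  by (intro continuous_intros) (force simp: abs_le_iff)+

text \<open>
  At a point where the logarithms of \<open>a\<close> and \<open>b\<close> differ in coordinate \<open>k\<close>, the difference has nonzero
  derivative along the great circle in direction \<open>k\<close>, so its level points are isolated there.
\<close>
lemma cost_difference_level_null:
  fixes a b :: "real ^ 'd"
  assumes d: "CARD('d) \<ge> 2" and a: "norm a = 1" and b: "norm b = 1" and ab: "a \<noteq> b"
  shows "{z \<in> sphere 0 1. cost z a - cost z b = c} \<in> null_sets surface_measure"
proof -
  let ?S = "sphere (0::real ^ 'd) 1"
  define L where "L = {z \<in> ?S. cost z a - cost z b = c}"
  have L_closed: "closed L"
    unfolding L_def by (rule continuous_closed_preimage_constant) (auto intro!: continuous_intros cost_continuous simp: a b)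
  define U where "U = {z. norm z = 1 \<longrightarrow> (-1 < z \<bullet> a \<and> z \<bullet> a < 1 \<and> -1 < z \<bullet> b \<and> z \<bullet> b < 1)}"
  define W where "W k = {z \<in> L. (-1 < z \<bullet> a \<and> z \<bullet> a < 1 \<and> -1 < z \<bullet> b \<and> z \<bullet> b < 1) \<and> log_map a z $ k \<noteq> log_map b z $ k}" for k
  have W_borel: "W k \<in> sets sphere_borel" for k
  proof -
    define R where "R j = {z \<in> L. (-1 + inverse (real (Suc j)) \<le> z \<bullet> a \<and> z \<bullet> a \<le> 1 - inverse (real (Suc j)) \<and>
       -1 + inverse (real (Suc j)) \<le> z \<bullet> b \<and> z \<bullet> b \<le> 1 - inverse (real (Suc j)))}" for j
    define R' where "R' j = {z \<in> R j. inverse (real (Suc j)) \<le> \<bar>log_map a z $ k - log_map b z $ k\<bar>}" for j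
    have cl: "closed (R j)" for j
    proof -
      have "R j = L \<inter> {z. -1 + inverse (real (Suc j)) \<le> z \<bullet> a} \<inter> {z. z \<bullet> a \<le> 1 - inverse (real (Suc j))} \<inter>
         {z. -1 + inverse (real (Suc j)) \<le> z \<bullet> b} \<inter> {z. z \<bullet> b \<le> 1 - inverse (real (Suc j))}"
        by (auto simp: R_def)
      then show ?thesis
        by (auto intro!: closed_Int L_closed closed_Collect_le continuous_intros simp del: of_nat_Suc)
    qed
    have "closed (R' j)" for j
      unfolding R'_def
    proof (intro continuous_on_closed_Collect_le[OF _ _ cl] continuous_intros continuous_on_log_map)
      fix z assume z: "z \<in> R j"
      have "0 < inverse (real (Suc j))" by simp
      moreover have "-1 + inverse (real (Suc j)) \<le> z \<bullet> a" "-1 + inverse (real (Suc j)) \<le> z \<bullet> b"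
        using z unfolding R_def by blast+
      ultimately show "a \<bullet> z > -1" "b \<bullet> z > -1" unfolding inner_commute[of a z] inner_commute[of b z] by linarith+
      show "norm z = 1" "norm z = 1" using z by (auto simp: R_def L_def)
    qed (auto simp: a b)
    then have "(\<Union>j. R' j) \<in> sets borel" by (intro sets.countable_UN) (auto intro: borel_closed)
    moreover have "W k = (\<Union>j. R' j)"
    proof (intro equalityI subsetI)
      fix z assume z: "z \<in> W k"
      define m where "m = min (min (min (z \<bullet> a + 1) (1 - z \<bullet> a)) (min (z \<bullet> b + 1) (1 - z \<bullet> b))) \<bar>log_map a z $ k - log_map b z $ k\<bar>"
      have "m > 0" using z by (auto simp: m_def W_def)
      then obtain j where "inverse (real (Suc j)) < m" using reals_Archimedean by blast
      then have "z \<in> R' j" using z unfolding R'_def R_def m_def W_def by (auto simp del: of_nat_Suc)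
      then show "z \<in> (\<Union>j. R' j)" by blast
    next
      fix z assume "z \<in> (\<Union>j. R' j)"
      then obtain j where z: "z \<in> R' j" by blast
      define i where "i = inverse (real (Suc j))"
      have "i > 0" by (simp add: i_def)
      then show "z \<in> W k" using z unfolding R'_def R_def W_def i_def[symmetric] by auto
    qed
    ultimately show ?thesis by (auto simp: sets_sphere_borel_iff W_def L_def)
  qed
  have W_null: "W k \<in> null_sets surface_measure" for k
  proof -
    let ?e = "axis k (1::real)"
    have "emeasure surface_measure (W k) = 0"
    proof (rule surface_null_of_countable_great_circles[where e="?e", OF W_borel axis_unit])
      have z: "log_map x y $ k = 0" if "y = axis k 1 \<or> y = - axis k 1" for x y :: "real ^ 'd"
        using inner_log_map[of y x] that by (auto simp: inner_axis)
      show "?e \<notin> W k" "- ?e \<notin> W k" using z unfolding W_def by auto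
      fix q :: "real ^ 'd" assume q: "norm q = 1" "q \<bullet> ?e = 0"
      let ?g = "great_circle q ?e" and ?t = "circle_tangent q ?e"
      let ?h = "\<lambda>\<omega>. cost (?g \<omega>) a - cost (?g \<omega>) b"
      show "countable {\<omega>. - (pi/2) < \<omega> \<and> \<omega> < pi/2 \<and> cos \<omega> *\<^sub>R q + sin \<omega> *\<^sub>R ?e \<in> W k}" (is "countable ?A")
      proof (rule countable_isolated_points)
        fix \<omega> assume \<omega>: "\<omega> \<in> ?A"
        then have W: "?g \<omega> \<in> W k" by (simp add: great_circle_def)
        have u: "norm (?g \<omega>) = 1" by (rule great_circle_unit[OF q(1) axis_unit q(2)])
        have c: "cos \<omega> * (log_map z (?g \<omega>) \<bullet> ?t \<omega>) = log_map z (?g \<omega>) $ k" for z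
          using great_circle_unit(5)[OF q(1) axis_unit q(2) inner_log_map[OF u]] by (simp add: inner_axis)
        have "(?h has_real_derivative (- (log_map a (?g \<omega>) \<bullet> ?t \<omega>) - - (log_map b (?g \<omega>) \<bullet> ?t \<omega>))) (at \<omega>)"
          by (intro DERIV_diff cost_derivative q axis_unit a b) (use W in \<open>auto simp: W_def\<close>)
        moreover have "- (log_map a (?g \<omega>) \<bullet> ?t \<omega>) - - (log_map b (?g \<omega>) \<bullet> ?t \<omega>) \<noteq> 0"
          using W c[of a] c[of b] by (auto simp: W_def)
        ultimately obtain \<delta> where \<delta>: "\<delta> > 0" "\<And>\<omega>'. \<bar>\<omega>' - \<omega>\<bar> < \<delta> \<Longrightarrow> ?h \<omega>' = ?h \<omega> \<Longrightarrow> \<omega>' = \<omega>"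
          using isolated_level_points by meson
        have level: "?h \<omega>' = c" if "\<omega>' \<in> ?A" for \<omega>'
          using that by (auto simp: W_def L_def great_circle_def)
        show "\<exists>\<delta>>0. \<forall>\<omega>'\<in>?A. \<bar>\<omega>' - \<omega>\<bar> < \<delta> \<longrightarrow> \<omega>' = \<omega>"
        proof (intro exI[of _ \<delta>] conjI ballI impI)
          fix \<omega>' assume "\<omega>' \<in> ?A" "\<bar>\<omega>' - \<omega>\<bar> < \<delta>"
          then show "\<omega>' = \<omega>" using \<delta>(2) level[of \<omega>'] level[OF \<omega>] by simp
        qed (rule \<delta>(1))
      qed
    qed
    then show ?thesis using W_borel by (simp add: null_sets_def)
  qed
  have "L \<subseteq> {a} \<union> {-a} \<union> {b} \<union> {-b} \<union> (\<Union>k\<in>UNIV. W k)"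
  proof
    fix z assume z: "z \<in> L"
    have nz: "norm z = 1" using z by (auto simp: L_def)
    show "z \<in> {a} \<union> {-a} \<union> {b} \<union> {-b} \<union> (\<Union>k\<in>UNIV. W k)"
    proof (rule ccontr)
      assume n: "z \<notin> {a} \<union> {-a} \<union> {b} \<union> {-b} \<union> (\<Union>k\<in>UNIV. W k)"
      have strict: "-1 < z \<bullet> v \<and> z \<bullet> v < 1" if "norm v = 1" "z \<noteq> v" "z \<noteq> - v" for v
      proof -
        have "(norm (z + v))\<^sup>2 = 2 + 2 * (z \<bullet> v)" "(norm (z - v))\<^sup>2 = 2 - 2 * (z \<bullet> v)"
          unfolding power2_norm_eq_inner using that(1) nz
          by (simp_all add: inner_add_left inner_add_right inner_diff_left inner_diff_right inner_commute norm_eq_1)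
        moreover have "norm (z + v) > 0" "norm (z - v) > 0" using that by (auto simp: add_eq_0_iff2)
        ultimately show ?thesis using zero_less_power[of "norm (z + v)" 2] zero_less_power[of "norm (z - v)" 2] by linarith
      qed
      have sa: "-1 < z \<bullet> a \<and> z \<bullet> a < 1" and sb: "-1 < z \<bullet> b \<and> z \<bullet> b < 1" using strict n a b by auto
      then have "log_map a z $ k = log_map b z $ k" for k using n z by (auto simp: W_def)
      then have "log_map a z = log_map b z" by (simp add: vec_eq_iff)
      then have "a = b" using log_map_inj[OF a b nz] sa sb by (auto simp: inner_commute)
      then show False using ab by simp
    qed
  qed
  moreover have "{a} \<union> {-a} \<union> {b} \<union> {-b} \<union> (\<Union>k\<in>UNIV. W k) \<in> null_sets surface_measure"
    using a b by (intro null_sets.Un null_sets.finite_UN W_null point_null[OF d]) auto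
  moreover have "L \<in> sets surface_measure"
    using L_closed by (auto simp: sets_sphere_borel_iff L_def intro: borel_closed)
  ultimately show ?thesis unfolding L_def[symmetric] by (metis null_sets_subset)
qed

section \<open>Realising a law on the sphere from an atomless variable\<close>

text \<open>
  The probability integral transform.
\<close>
lemma (in prob_space) prob_cdf_le:
  fixes f :: "'a \<Rightarrow> real"
  assumes f[measurable]: "f \<in> borel_measurable M" and atomless: "\<And>c. prob {x \<in> space M. f x = c} = 0"
    and t: "0 \<le> t" "t \<le> 1"
  shows "prob {x \<in> space M. cdf (distr M borel f) (f x) \<le> t} = t"
proof -
  define D where "D = distr M borel f"
  interpret D: real_distribution D unfolding D_def by (rule real_distribution_distr) simp
  have pr: "measure D B = prob {x \<in> space M. f x \<in> B}" if "B \<in> sets borel" for B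
    unfolding D_def using that by (subst measure_distr) (auto intro!: arg_cong[where f=prob])
  have cont: "isCont (cdf D) x" for x
    unfolding D.isCont_cdf using pr[of "{x}"] atomless[of x] by simp
  have [measurable]: "cdf D \<in> borel_measurable borel"
    by (intro borel_measurable_continuous_onI) (simp add: cont continuous_at_imp_continuous_on)
  have q: "\<exists>s. cdf D s = u" if u: "0 < u" "u < 1" for u
  proof -
    have "\<forall>\<^sub>F x in at_bot. cdf D x < u" using order_tendstoD(2)[OF D.cdf_lim_at_bot] u by blast
    then obtain a where a: "cdf D a < u" by (auto simp: eventually_at_bot_linorder)
    have "\<forall>\<^sub>F x in at_top. cdf D x > u" using order_tendstoD(1)[OF D.cdf_lim_at_top_prob] u by blast
    then obtain b where b: "cdf D b > u" by (auto simp: eventually_at_top_linorder)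
    have "a \<le> b" using a b D.cdf_nondecreasing[of b a] by linarith
    then show ?thesis using IVT[of "cdf D" a u b] a b cont by auto
  qed
  define H where "H u = measure D {x. cdf D x \<le> u}" for u
  have H_mono: "H u \<le> H v" if "u \<le> v" for u v
    unfolding H_def using that by (intro D.finite_measure_mono) (auto, measurable)
  have H_lower: "u \<le> H u" if u: "0 < u" "u < 1" for u
  proof -
    obtain s where s: "cdf D s = u" using q u by blast
    have "u = measure D {..s}" using s by (simp add: cdf_def)
    also have "\<dots> \<le> H u"
      unfolding H_def using D.cdf_nondecreasing[of _ s] s by (intro D.finite_measure_mono) (auto, measurable)
    finally show ?thesis .
  qed
  have H_upper: "H u \<le> v" if u: "0 < v" "v < 1" "u < v" for u v
  proof -
    obtain s where s: "cdf D s = v" using q u by blast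
    have "x \<le> s" if "cdf D x \<le> u" for x
    proof (rule ccontr)
      assume "\<not> x \<le> s"
      then have "cdf D s \<le> cdf D x" by (intro D.cdf_nondecreasing) auto
      then show False using that s u by simp
    qed
    then have "H u \<le> measure D {..s}"
      unfolding H_def by (intro D.finite_measure_mono) auto
    then show ?thesis using s by (simp add: cdf_def)
  qed
  have "H t = t"
  proof (rule antisym)
    show "H t \<le> t"
    proof (cases "t = 1")
      case True
      then show ?thesis unfolding H_def by simp
    next
      case False
      show ?thesis
      proof (rule dense_ge_bounded)
        show "t < 1" using False t by simp
        fix v assume "t < v" "v < 1"
        then show "H t \<le> v" using t by (intro H_upper) auto
      qed
    qed
    show "t \<le> H t"
    proof (cases "t = 0")
      case True
      then show ?thesis unfolding H_def by simp
    next
      case False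
      show ?thesis
      proof (rule dense_le_bounded)
        show "0 < t" using False t by simp
        fix v assume v: "0 < v" "v < t"
        then have "v \<le> H v" using t by (intro H_lower) auto
        also have "\<dots> \<le> H t" using v by (intro H_mono) auto
        finally show "v \<le> H t" .
      qed
    qed
  qed
  moreover have "{x. cdf D x \<le> t} \<in> sets borel" by measurable
  ultimately show ?thesis using pr[of "{x. cdf D x \<le> t}"] unfolding H_def D_def by simp
qed

lemma (in prob_space) atomless_split:
  fixes f :: "'a \<Rightarrow> real"
  assumes f[measurable]: "f \<in> borel_measurable M" and atomless: "\<And>c. prob {x \<in> space M. f x = c} = 0"
    and t: "0 \<le> t" "t \<le> 1"
  obtains A where "A \<in> sets M" "prob A = t"
proof
  show "prob {x \<in> space M. cdf (distr M borel f) (f x) \<le> t} = t" by (rule prob_cdf_le[OF assms])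
  interpret D: real_distribution "distr M borel f" by (rule real_distribution_distr) simp
  have [measurable]: "cdf (distr M borel f) \<in> borel_measurable borel"
    by (intro borel_measurable_mono) (simp add: mono_def D.cdf_nondecreasing)
  show "{x \<in> space M. cdf (distr M borel f) (f x) \<le> t} \<in> sets M" by measurable
qed

lemma (in prob_space) atomless_realises_real:
  fixes f :: "'a \<Rightarrow> real"
  assumes f[measurable]: "f \<in> borel_measurable M" and atomless: "\<And>c. prob {x \<in> space M. f x = c} = 0"
    and \<nu>: "real_distribution \<nu>"
  obtains S where "S \<in> borel_measurable M" "distr M borel S = \<nu>"
proof -
  interpret \<nu>: cdf_distribution \<nu> by (simp add: cdf_distribution_def \<nu>)
  interpret D: real_distribution "distr M borel f" by (rule real_distribution_distr) simp
  define h where "h x = cdf (distr M borel f) (f x)" for x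
  have [measurable]: "cdf (distr M borel f) \<in> borel_measurable borel"
    by (intro borel_measurable_mono) (simp add: mono_def D.cdf_nondecreasing)
  have h[measurable]: "h \<in> borel_measurable M" unfolding h_def by measurable
  have hle: "prob {x \<in> space M. h x \<le> t} = t" if "0 \<le> t" "t \<le> 1" for t
    unfolding h_def using prob_cdf_le[OF f atomless that] .
  define g where "g u = indicator {0<..<1} u *\<^sub>R \<nu>.I u" for u :: real
  have g[measurable]: "g \<in> borel_measurable borel"
    using \<nu>.measurable_CI unfolding g_def[abs_def] by (subst (asm) borel_measurable_restrict_space_iff) auto
  have h0: "AE x in M. 0 < h x"
  proof -
    have "prob {x \<in> space M. h x \<le> 0} = 0" by (rule hle) auto
    then have "AE x in M. x \<notin> {x \<in> space M. h x \<le> 0}"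
      by (intro AE_not_in) (auto simp: null_sets_def emeasure_eq_measure)
    moreover have "AE x in M. x \<in> space M" by (rule AE_space)
    ultimately show ?thesis by eventually_elim auto
  qed
  have h1: "AE x in M. h x < 1"
  proof -
    have "prob {x \<in> space M. h x < 1} \<ge> 1"
    proof (rule dense_le_bounded[of 0])
      fix t :: real assume t: "0 < t" "t < 1"
      then have "t = prob {x \<in> space M. h x \<le> t}" using hle[of t] by simp
      also have "\<dots> \<le> prob {x \<in> space M. h x < 1}" using t by (intro finite_measure_mono) auto
      finally show "t \<le> prob {x \<in> space M. h x < 1}" .
    qed simp
    then have "prob {x \<in> space M. h x < 1} = 1" by (intro antisym prob_le_1)
    then show ?thesis by (subst (asm) prob_Collect_eq_1) auto
  qed
  have "distr M borel (\<lambda>x. g (h x)) = \<nu>"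
  proof (rule cdf_unique)
    show "real_distribution (distr M borel (\<lambda>x. g (h x)))" by (rule real_distribution_distr) simp
    show "cdf (distr M borel (\<lambda>x. g (h x))) = cdf \<nu>"
    proof
      fix y
      have "cdf (distr M borel (\<lambda>x. g (h x))) y = prob {x \<in> space M. g (h x) \<le> y}"
        unfolding cdf_def by (subst measure_distr) (auto intro!: arg_cong[where f=prob])
      also have "\<dots> = prob {x \<in> space M. h x \<le> cdf \<nu> y}"
      proof (rule measure_eq_AE)
        show "AE x in M. (x \<in> {x \<in> space M. g (h x) \<le> y}) = (x \<in> {x \<in> space M. h x \<le> cdf \<nu> y})"
          using h0 h1
        proof eventually_elim
          case (elim x)
          then show ?case using \<nu>.pseudoinverse[of "h x" y] by (simp add: g_def)
        qed
      qed measurable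
      also have "\<dots> = cdf \<nu> y" by (rule hle) (auto simp: \<nu>.cdf_bounded_prob cdf_def)
      finally show "cdf (distr M borel (\<lambda>x. g (h x))) y = cdf \<nu> y" .
    qed
  qed (rule \<nu>)
  then show ?thesis by (intro that[of "\<lambda>x. g (h x)"]) auto
qed

lemma binary_digits:
  fixes t :: real
  assumes "0 \<le> t" "t < 1"
  defines "b \<equiv> \<lambda>l::nat. \<lfloor>2 ^ Suc l * t\<rfloor> - 2 * \<lfloor>2 ^ l * t\<rfloor>"
  shows "b l \<in> {0, 1}" "(\<lambda>l. of_int (b l) / 2 ^ Suc l) sums t"
proof -
  show "b l \<in> {0, 1}"
  proof -
    have "2 * \<lfloor>2 ^ l * t\<rfloor> \<le> \<lfloor>2 ^ Suc l * t\<rfloor>" by (simp add: le_floor_iff)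
    moreover have "\<lfloor>2 ^ Suc l * t\<rfloor> < 2 * \<lfloor>2 ^ l * t\<rfloor> + 2" unfolding floor_less_iff by (simp, linarith?)
    ultimately show ?thesis by (auto simp: b_def)
  qed
  have part: "(\<Sum>l<n. of_int (b l) / 2 ^ Suc l) = of_int \<lfloor>2 ^ n * t\<rfloor> / (2::real) ^ n" for n
  proof (induction n)
    case 0
    have "\<lfloor>t\<rfloor> = 0" using assms by (simp add: floor_eq_iff)
    then show ?case by simp
  next
    case (Suc n)
    then show ?case by (simp add: b_def field_simps)
  qed
  have "(\<lambda>n. t - (\<Sum>l<n. of_int (b l) / 2 ^ Suc l)) \<longlonglongrightarrow> 0"
  proof (rule tendsto_sandwich[OF _ _ tendsto_const])
    show "\<forall>\<^sub>F n in sequentially. 0 \<le> t - (\<Sum>l<n. of_int (b l) / 2 ^ Suc l)"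
      unfolding part by (intro always_eventually allI) (simp add: field_simps)
    show "\<forall>\<^sub>F n in sequentially. t - (\<Sum>l<n. of_int (b l) / 2 ^ Suc l) \<le> (1 / 2) ^ n"
    proof (intro always_eventually allI)
      fix n
      have "2 ^ n * t \<le> of_int \<lfloor>2 ^ n * t\<rfloor> + 1" by linarith
      then have "t \<le> (of_int \<lfloor>2 ^ n * t\<rfloor> + 1) / 2 ^ n" by (simp add: field_simps)
      then show "t - (\<Sum>l<n. of_int (b l) / 2 ^ Suc l) \<le> (1 / 2) ^ n"
        unfolding part by (simp add: add_divide_distrib power_divide)
    qed
    show "(\<lambda>n. (1 / 2 :: real) ^ n) \<longlonglongrightarrow> 0" by (rule LIMSEQ_power_zero) simp
  qed
  from tendsto_diff[OF tendsto_const[of t] this]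
  show "(\<lambda>l. of_int (b l) / 2 ^ Suc l) sums t" unfolding sums_def by simp
qed

text \<open>
  Reads off the digits of a Cantor number: a digit is one exactly if the remainder exceeds one half.
\<close>
primrec ternary_rest :: "real \<Rightarrow> nat \<Rightarrow> real" where
  "ternary_rest r 0 = r"
| "ternary_rest r (Suc n) = 3 * ternary_rest r n - (if ternary_rest r n > 1 / 2 then 2 else 0)"

definition ternary_bit :: "nat \<Rightarrow> real \<Rightarrow> real" where
  "ternary_bit n r = (if ternary_rest r n > 1 / 2 then 1 else 0)"

lemma ternary_bit_measurable [measurable]: "ternary_bit n \<in> borel_measurable borel"
proof -
  have "(\<lambda>r. ternary_rest r n) \<in> borel_measurable borel" by (induction n) auto
  then show ?thesis unfolding ternary_bit_def[abs_def] by measurable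
qed

lemma ternary_decode:
  fixes c :: "nat \<Rightarrow> real"
  assumes c: "\<And>n. c n \<in> {0, 1}"
  shows "ternary_bit n (\<Sum>k. 2 * c k / 3 ^ Suc k) = c n"
proof -
  define R where "R n = (\<Sum>k. 2 * c (n + k) / 3 ^ Suc k)" for n
  have geo: "(\<lambda>k. 2 / 3 ^ Suc k :: real) sums 1"
    using sums_mult[OF geometric_sums[of "1/3 :: real"], of "2/3"] by (simp add: power_divide)
  have le: "2 * c (n + k) / 3 ^ Suc k \<le> 2 / 3 ^ Suc k" and ge: "0 \<le> 2 * c (n + k) / 3 ^ Suc k" for n k
    using c[of "n + k"] by auto
  have sm: "summable (\<lambda>k. 2 * c (n + k) / 3 ^ Suc k)" for n
  proof (rule summable_comparison_test'[OF sums_summable[OF geo], of 0])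
    fix k show "norm (2 * c (n + k) / 3 ^ Suc k) \<le> 2 / 3 ^ Suc k"
      using le[of n k] ge[of n k] by (simp only: real_norm_def abs_of_nonneg)
  qed
  have R01: "0 \<le> R n" "R n \<le> 1" for n
    unfolding R_def using suminf_nonneg[OF sm] ge suminf_le[OF le sm sums_summable[OF geo]] sums_unique[OF geo] by auto
  have step: "R n = 2 * c n / 3 + R (Suc n) / 3" for n
  proof -
    have "R n = (\<Sum>k. 2 * c (n + Suc k) / 3 ^ Suc (Suc k)) + 2 * c (n + 0) / 3 ^ Suc 0"
      unfolding R_def using suminf_split_head[OF sm[of n]] by linarith
    also have "(\<Sum>k. 2 * c (n + Suc k) / 3 ^ Suc (Suc k)) = (\<Sum>k. (2 * c (Suc n + k) / 3 ^ Suc k) / 3)"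
      by (simp add: field_simps)
    also have "\<dots> = R (Suc n) / 3" unfolding R_def by (rule suminf_divide[OF sm])
    finally show ?thesis by simp
  qed
  have bit: "R n > 1 / 2 \<longleftrightarrow> c n = 1" for n
    using step[of n] R01[of "Suc n"] c[of n] by auto
  have "ternary_rest (R 0) n = R n" for n
  proof (induction n)
    case (Suc n)
    then show ?case using bit[of n] step[of n] c[of n] by auto
  qed simp
  then have "ternary_bit n (R 0) = c n" using bit[of n] c[of n] by (auto simp: ternary_bit_def)
  then show ?thesis by (simp add: R_def)
qed

text \<open>
  Interleave the binary digits of the coordinates into the ternary digits of a Cantor number.
\<close>
lemma sphere_coding:
  obtains j :: "real ^ 'd \<Rightarrow> real" and k :: "real \<Rightarrow> real ^ 'd"
  where "j \<in> borel_measurable borel" "k \<in> borel_measurable borel" "\<And>x. norm x = 1 \<Longrightarrow> k (j x) = x"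
proof -
  obtain e :: "'d \<Rightarrow> nat" where e: "bij_betw e UNIV {0..<CARD('d)}"
    using ex_bij_betw_finite_nat[of "UNIV :: 'd set"] by auto
  define D where "D = CARD('d)"
  have D: "D > 0" by (simp add: D_def)
  define t where "t x i = (x $ i + 1) / 4" for x :: "real ^ 'd" and i
  define b where "b l u = real_of_int (\<lfloor>2 ^ Suc l * u\<rfloor> - 2 * \<lfloor>2 ^ l * u\<rfloor>)" for l :: nat and u :: real
  define c where "c x n = (if norm x = 1 then b (n div D) (t x (inv_into UNIV e (n mod D))) else 0)" for x n
  define j where "j x = (\<Sum>n. 2 * c x n / 3 ^ Suc n)" for x
  define k where "k r = (\<Sum>i\<in>UNIV. (4 * (\<Sum>l. ternary_bit (D * l + e i) r / 2 ^ Suc l) - 1) *\<^sub>R axis i 1 :: real ^ 'd)" for r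
  have t: "0 \<le> t x i" "t x i < 1" if "norm x = 1" for x i
    using component_le_norm_cart[of x i] that by (auto simp: t_def)
  have b_meas: "b l \<in> borel_measurable borel" for l unfolding b_def[abs_def] by measurable
  have c_meas: "(\<lambda>x. c x n) \<in> borel_measurable borel" for n
    unfolding c_def t_def using b_meas by measurable
  have "j \<in> borel_measurable borel" unfolding j_def[abs_def] using c_meas by measurable
  moreover have "k \<in> borel_measurable borel" unfolding k_def[abs_def] by measurable
  moreover have "k (j x) = x" if x: "norm x = 1" for x
  proof -
    have "real_of_int z \<in> {0, 1}" if "z \<in> {0, 1}" for z using that by auto
    from this[OF binary_digits(1)[OF t[OF x]]] have b01: "b l (t x i) \<in> {0, 1}" for l i
      unfolding b_def .
    have c01: "c x n \<in> {0, 1}" for n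
      using b01[of "n div D" "inv_into UNIV e (n mod D)"] x unfolding c_def by presburger
    have dig: "(\<Sum>l. ternary_bit (D * l + e i) (j x) / 2 ^ Suc l) = t x i" for i
    proof -
      have ei: "e i < D" using e by (auto simp: bij_betw_def D_def)
      have "inv_into UNIV e (e i) = i" using e by (auto simp: bij_betw_def intro: inv_into_f_f)
      then have "c x (D * l + e i) = b l (t x i)" for l
        using ei D x by (simp add: c_def)
      then have "(\<Sum>l. ternary_bit (D * l + e i) (j x) / 2 ^ Suc l) = (\<Sum>l. b l (t x i) / 2 ^ Suc l)"
        unfolding j_def ternary_decode[OF c01] by simp
      also have "\<dots> = t x i" using binary_digits(2)[OF t[OF x, of i]] unfolding b_def by (rule sums_unique[symmetric])
      finally show ?thesis .
    qed
    have kji: "k (j x) $ i = 4 * (\<Sum>l. ternary_bit (D * l + e i) (j x) / 2 ^ Suc l) - 1" for i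
      by (simp add: k_def sum_component axis_def if_distrib[of "\<lambda>z. _ * z"] cong: if_cong)
    have "k (j x) $ i = x $ i" for i
    proof -
      have "4 * t x i - 1 = x $ i" unfolding t_def by (simp add: field_simps)
      then show ?thesis using kji[of i] unfolding dig by (rule trans[rotated])
    qed
    then show ?thesis by (simp add: vec_eq_iff)
  qed
  ultimately show ?thesis using that by blast
qed

lemma (in prob_space) atomless_realises_sphere:
  fixes f :: "'a \<Rightarrow> real" and \<nu> :: "(real ^ 'd) measure"
  assumes f[measurable]: "f \<in> borel_measurable M" and atomless: "\<And>c. prob {x \<in> space M. f x = c} = 0"
    and \<nu>: "prob_space \<nu>" "sets \<nu> = sets sphere_borel"
  obtains S where "S \<in> M \<rightarrow>\<^sub>M sphere_borel" "distr M sphere_borel S = \<nu>"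
proof -
  interpret \<nu>: prob_space \<nu> by fact
  have sp: "space \<nu> = sphere 0 1" using sets_eq_imp_space_eq[OF \<nu>(2)] by simp
  obtain j :: "real ^ 'd \<Rightarrow> real" and k where jk: "j \<in> borel_measurable borel" "k \<in> borel_measurable borel"
     "\<And>x. norm x = 1 \<Longrightarrow> k (j x) = x" using sphere_coding by blast
  have jm: "j \<in> borel_measurable \<nu>"
    using jk(1) unfolding measurable_cong_sets[OF \<nu>(2) refl] sphere_borel_def by (rule measurable_restrict_space1)
  obtain T where T: "T \<in> borel_measurable M" "distr M borel T = distr \<nu> borel j"
    using atomless_realises_real[OF f atomless \<nu>.real_distribution_distr[OF jm]] by blast
  obtain p where p: "p \<in> sphere (0 :: real ^ 'd) 1" using \<nu>.not_empty unfolding sp by blast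
  define k' where "k' r = (if k r \<in> sphere 0 1 then k r else p)" for r
  have k': "k' \<in> borel \<rightarrow>\<^sub>M sphere_borel"
  proof -
    have "k -` sphere 0 1 \<inter> space borel \<in> sets borel" using jk(2) by (rule measurable_sets) (simp add: borel_closed)
    moreover have "k -` sphere 0 1 \<inter> space borel = {r \<in> space borel. k r \<in> sphere 0 1}" by auto
    ultimately have "{r \<in> space borel. k r \<in> sphere 0 1} \<in> sets borel" by (simp only:)
    then have "k' \<in> borel_measurable borel" unfolding k'_def[abs_def] using jk(2) by (intro measurable_If) auto
    then show ?thesis unfolding sphere_borel_def using p by (intro measurable_restrict_space2) (auto simp: k'_def)
  qed
  have "distr M sphere_borel (\<lambda>x. k' (T x)) = distr (distr M borel T) sphere_borel k'"
    using distr_distr[OF k' T(1)] by (simp add: o_def)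
  also have "\<dots> = distr \<nu> sphere_borel (\<lambda>x. k' (j x))"
    unfolding T(2) using distr_distr[OF k' jm] by (simp add: o_def)
  also have "\<dots> = distr \<nu> \<nu> (\<lambda>x. x)"
    using \<nu>(2) sp jk(3) by (intro distr_cong) (auto simp: k'_def)
  also have "\<dots> = \<nu>" by (rule distr_id)
  finally have "distr M sphere_borel (\<lambda>x. k' (T x)) = \<nu>" .
  moreover have "(\<lambda>x. k' (T x)) \<in> M \<rightarrow>\<^sub>M sphere_borel" using T(1) k' by measurable
  ultimately show ?thesis using that by blast
qed

section \<open>Optimal maps have monotone graphs\<close>

lemma bounded_densityD:
  fixes P :: "(real ^ 'd) measure"
  assumes "P \<in> bounded_density_class"
  shows "prob_space P" "sets P = sets sphere_borel" "space P = sphere 0 1"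
    "\<And>N. N \<in> null_sets surface_measure \<Longrightarrow> N \<in> null_sets P"
    "\<And>A. A \<in> sets sphere_borel \<Longrightarrow> emeasure surface_measure A > 0 \<Longrightarrow> emeasure P A > 0"
proof -
  obtain f c C where f: "f \<in> borel_measurable surface_measure" "0 < c"
     "AE z in surface_measure. c \<le> f z \<and> f z \<le> C" "P = density surface_measure (\<lambda>z. ennreal (f z))"
    and P: "prob_space P"
    using assms unfolding bounded_density_class_def by blast
  show "prob_space P" by fact
  show sets: "sets P = sets sphere_borel" by (simp add: f(4))
  show "space P = sphere 0 1" by (simp add: f(4))
  show "N \<in> null_sets P" if "N \<in> null_sets surface_measure" for N
  proof -
    have "absolutely_continuous surface_measure P"
      unfolding f(4) by (rule absolutely_continuousI_density) (use f(1) in measurable)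
    then show ?thesis using that by (auto simp: absolutely_continuous_def)
  qed
  show "emeasure P A > 0" if A: "A \<in> sets sphere_borel" "emeasure surface_measure A > 0" for A
  proof -
    have "ennreal c * emeasure surface_measure A = (\<integral>\<^sup>+z. ennreal c * indicator A z \<partial>surface_measure)"
      using A by (simp add: nn_integral_cmult_indicator)
    also have "\<dots> \<le> (\<integral>\<^sup>+z. ennreal (f z) * indicator A z \<partial>surface_measure)"
      using f(3) by (intro nn_integral_mono_AE) (auto elim!: eventually_mono intro!: mult_right_mono ennreal_leI)
    also have "\<dots> = emeasure P A"
      unfolding f(4) using f(1) A by (subst emeasure_density) auto
    finally show ?thesis using A(2) f(2) by (metis ennreal_zero_less_mult_iff ennreal_less_zero_iff less_le_trans)
  qed
qed

lemma prob_uniform_sphere: "prob_space (uniform_sphere :: (real ^ 'd) measure)"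
  unfolding uniform_sphere_def
proof (rule prob_space_uniform_measure)
  have "emeasure surface_measure (ball (axis undefined 1) 1 \<inter> sphere (0::real ^ 'd) 1) > 0"
    by (rule surface_open_pos) auto
  also have "emeasure surface_measure (ball (axis undefined 1) 1 \<inter> sphere (0::real ^ 'd) 1) \<le> emeasure surface_measure (sphere (0::real ^ 'd) 1)"
    by (rule emeasure_mono) (auto simp: sets_sphere_borel_iff)
  finally show "emeasure surface_measure (sphere (0::real ^ 'd) 1) \<noteq> 0" by simp
qed (rule finite_surface_measure)

lemma sets_uniform_sphere [simp]: "sets uniform_sphere = sets sphere_borel"
  by (simp add: uniform_sphere_def)

lemma space_uniform_sphere [simp]: "space uniform_sphere = sphere 0 1"
  by (simp add: uniform_sphere_def)

lemma uniform_sphere_null: "N \<in> null_sets surface_measure \<Longrightarrow> N \<in> null_sets uniform_sphere"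
  by (auto simp: null_sets_def uniform_sphere_def measurable_sets emeasure_uniform_measure sets_sphere_borel_iff Int_absorb1)

lemma measurable_on_sphere:
  fixes f :: "real ^ 'd \<Rightarrow> 'b::topological_space"
  shows "continuous_on (sphere 0 1) f \<Longrightarrow> f \<in> borel_measurable sphere_borel"
  unfolding sphere_borel_def by (rule borel_measurable_continuous_on_restrict)

lemma cost_measurable:
  fixes f g :: "'a \<Rightarrow> real ^ 'd"
  assumes f: "f \<in> M \<rightarrow>\<^sub>M sphere_borel" and g: "g \<in> M \<rightarrow>\<^sub>M sphere_borel"
  shows "(\<lambda>x. cost (f x) (g x)) \<in> borel_measurable M"
proof -
  define a where "a u = arccos (max (-1) (min 1 u))" for u :: real
  have "continuous_on UNIV a" unfolding a_def[abs_def] by (intro continuous_intros) auto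
  then have a: "a \<in> borel_measurable borel" by (rule borel_measurable_continuous_onI)
  have fg: "f \<in> borel_measurable M" "g \<in> borel_measurable M"
    using f g by (auto simp: sphere_borel_def measurable_restrict_space2_iff)
  have "(\<lambda>x. (a (f x \<bullet> g x))\<^sup>2 / 2) \<in> borel_measurable M"
    using a fg by measurable
  moreover have "cost (f x) (g x) = (a (f x \<bullet> g x))\<^sup>2 / 2" if "x \<in> space M" for x
  proof -
    have "norm (f x) = 1" "norm (g x) = 1" using measurable_space[OF f that] measurable_space[OF g that] by auto
    then have "\<bar>f x \<bullet> g x\<bar> \<le> 1" by (rule abs_inner_unit_le)
    then have "max (-1) (min 1 (f x \<bullet> g x)) = f x \<bullet> g x" by (auto simp: max_def min_def abs_le_iff)
    then show ?thesis by (simp add: cost_def a_def)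
  qed
  ultimately show ?thesis by (subst measurable_cong) auto
qed

lemma cost_bounds: "norm y = 1 \<Longrightarrow> norm z = 1 \<Longrightarrow> 0 \<le> cost y z \<and> cost y z \<le> pi\<^sup>2 / 2"
  using arccos_ubound[of "y \<bullet> z"] arccos_lbound[of "y \<bullet> z"] abs_inner_unit_le[of y z]
  by (auto simp: cost_def abs_le_iff intro!: power_mono)

lemma level_function:
  assumes d: "CARD('d) \<ge> 2"
  obtains f :: "real ^ 'd \<Rightarrow> real" where "f \<in> borel_measurable sphere_borel"
    "\<And>c. {z \<in> sphere 0 1. f z = c} \<in> null_sets surface_measure"
proof -
  define a :: "real ^ 'd" where "a = axis undefined 1"
  have a: "norm a = 1" "norm (- a) = 1" by (auto simp: a_def)
  have ne: "a \<noteq> - a"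
  proof
    assume "a = - a"
    then have "a $ undefined = (- a) $ undefined" by (rule arg_cong)
    then show False by (simp add: a_def axis_def)
  qed
  have "(\<lambda>z. cost z a - cost z (- a)) \<in> borel_measurable sphere_borel"
    by (rule measurable_on_sphere) (auto intro!: continuous_intros cost_continuous simp: a)
  then show ?thesis using that cost_difference_level_null[OF d a ne] by blast
qed

text \<open>
  If swapping the images of \<open>x\<close> and \<open>x2\<close> lowered the cost, it would do so uniformly near these points.
  Take sets \<open>A\<close> and \<open>B\<close> of equal mass near \<open>x\<close> and \<open>x2\<close>, and send \<open>A\<close> to the image law of \<open>B\<close> and
  conversely; this is possible since the law is atomless. The new map has the same image law and a
  smaller cost.
\<close>
lemma optimal_monotone:
  fixes P :: "(real ^ 'd) measure"
  assumes d: "CARD('d) \<ge> 2" and P: "P \<in> bounded_density_class"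
    and F: "continuous_on (sphere 0 1) F" "optimal_transport_map P F"
    and x: "norm x = 1" "norm x2 = 1"
  shows "cost x (F x) + cost x2 (F x2) \<le> cost x (F x2) + cost x2 (F x)"
proof (rule ccontr)
  assume neg: "\<not> cost x (F x) + cost x2 (F x2) \<le> cost x (F x2) + cost x2 (F x)"
  let ?S = "sphere (0::real ^ 'd) 1"
  note PD = bounded_densityD[OF P]
  interpret P: prob_space P by (rule PD(1))
  have Fm: "F \<in> sphere_borel \<rightarrow>\<^sub>M sphere_borel" and FP: "distr P sphere_borel F = uniform_sphere"
    and Fopt: "\<And>S. S \<in> transport_maps P \<Longrightarrow> (\<integral>z. cost z (F z) \<partial>P) \<le> (\<integral>z. cost z (S z) \<partial>P)"
    using F(2) unfolding optimal_transport_map_def transport_maps_def by auto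
  have FmP[measurable]: "F \<in> P \<rightarrow>\<^sub>M sphere_borel" using Fm by (simp add: measurable_cong_sets[OF PD(2) refl])
  have FS: "norm (F z) = 1" if "norm z = 1" for z using measurable_space[OF Fm, of z] that by simp
  have ne: "x \<noteq> x2" using neg by auto
  define \<epsilon> where "\<epsilon> = (cost x (F x) + cost x2 (F x2) - cost x (F x2) - cost x2 (F x)) / 8"
  have \<epsilon>: "\<epsilon> > 0" using neg by (simp add: \<epsilon>_def)
  have "uniformly_continuous_on (?S \<times> ?S) (\<lambda>z. cost (fst z) (snd z))"
    by (intro compact_uniformly_continuous cost_continuous continuous_intros compact_Times compact_sphere) auto
  then obtain \<eta> where \<eta>: "\<eta> > 0" and unif: "\<And>z z'. z \<in> ?S \<times> ?S \<Longrightarrow> z' \<in> ?S \<times> ?S \<Longrightarrow> dist z' z < \<eta> \<Longrightarrow> dist (cost (fst z') (snd z')) (cost (fst z) (snd z)) < \<epsilon>"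
    using \<epsilon> unfolding uniformly_continuous_on_def by metis
  have near: "\<bar>cost z y - cost z' y'\<bar> < \<epsilon>" if "norm z = 1" "norm y = 1" "norm z' = 1" "norm y' = 1" "dist z z' < \<eta> / 2" "dist y y' < \<eta> / 2"
    for z y z' y' :: "real ^ 'd"
  proof -
    have "dist (z, y) (z', y') \<le> dist z z' + dist y y'"
      unfolding dist_Pair_Pair by (rule sqrt_sum_squares_le_sum) auto
    then have "dist (z, y) (z', y') < \<eta>" using that by linarith
    with unif[of "(z', y')" "(z, y)"] that(1-4) show ?thesis by (simp add: dist_real_def)
  qed
  have cont: "\<exists>\<delta>>0. \<forall>z. norm z = 1 \<longrightarrow> dist z w < \<delta> \<longrightarrow> dist (F z) (F w) < \<eta> / 2" if "norm w = 1" for w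
  proof -
    have "w \<in> ?S" "0 < \<eta> / 2" using that \<eta> by auto
    then obtain \<delta> where "\<delta> > 0" "\<forall>z\<in>?S. dist z w < \<delta> \<longrightarrow> dist (F z) (F w) < \<eta> / 2"
      using F(1) unfolding continuous_on_iff by blast
    then show ?thesis by (intro exI[of _ \<delta>]) simp
  qed
  obtain \<delta>1 where \<delta>1: "\<delta>1 > 0" "\<And>z. norm z = 1 \<Longrightarrow> dist z x < \<delta>1 \<Longrightarrow> dist (F z) (F x) < \<eta> / 2" using cont[OF x(1)] by blast
  obtain \<delta>2 where \<delta>2: "\<delta>2 > 0" "\<And>z. norm z = 1 \<Longrightarrow> dist z x2 < \<delta>2 \<Longrightarrow> dist (F z) (F x2) < \<eta> / 2" using cont[OF x(2)] by blast
  define \<delta> where "\<delta> = Min {\<delta>1, \<delta>2, \<eta> / 2, dist x x2 / 2}"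
  have \<delta>: "\<delta> > 0" "\<delta> \<le> \<delta>1" "\<delta> \<le> \<delta>2" "\<delta> \<le> \<eta> / 2" "\<delta> \<le> dist x x2 / 2"
    using \<delta>1 \<delta>2 \<eta> ne by (auto simp: \<delta>_def)
  define A0 where "A0 = ball x \<delta> \<inter> ?S"
  define B0 where "B0 = ball x2 \<delta> \<inter> ?S"
  have AB0: "A0 \<in> sets P" "B0 \<in> sets P" unfolding PD(2) A0_def B0_def by (auto intro: borel_imp_sphere_borel)
  have pos: "P.prob A0 > 0" "P.prob B0 > 0"
  proof -
    have "emeasure P A0 > 0" "emeasure P B0 > 0"
      using PD(5) surface_open_pos \<delta>(1) x AB0 unfolding A0_def B0_def PD(2) by auto
    then show "P.prob A0 > 0" "P.prob B0 > 0" by (auto simp: P.emeasure_eq_measure)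
  qed
  obtain f :: "real ^ 'd \<Rightarrow> real" where f: "f \<in> borel_measurable sphere_borel" "\<And>c. {z \<in> ?S. f z = c} \<in> null_sets surface_measure"
    using level_function[OF d] by blast
  have fP: "f \<in> borel_measurable P" using f(1) by (simp add: measurable_cong_sets[OF PD(2) refl])
  have cond: "prob_space (uniform_measure P E)" "\<And>c. measure (uniform_measure P E) {z \<in> space (uniform_measure P E). f z = c} = 0"
    "f \<in> borel_measurable (uniform_measure P E)"
    if E: "E \<in> sets P" "P.prob E > 0" for E
  proof -
    have e: "emeasure P E \<noteq> 0" "emeasure P E \<noteq> \<infinity>" using E by (auto simp: P.emeasure_eq_measure)
    then show "prob_space (uniform_measure P E)" by (rule prob_space_uniform_measure)
    show "f \<in> borel_measurable (uniform_measure P E)" using fP by simp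
    fix c
    have N: "{z \<in> ?S. f z = c} \<in> null_sets P" using PD(4) f(2) by blast
    then have NE: "{z \<in> ?S. f z = c} \<in> sets P" by (rule null_setsD2)
    have "E \<inter> {z \<in> ?S. f z = c} \<in> null_sets P"
      by (rule null_sets_subset[OF N]) (use E(1) NE in auto)
    then have "P.prob (E \<inter> {z \<in> ?S. f z = c}) = 0" by (rule measure_eq_0_null_sets)
    then show "measure (uniform_measure P E) {z \<in> space (uniform_measure P E). f z = c} = 0"
      using measure_uniform_measure[OF e NE] by (simp add: PD(3))
  qed
  \<comment> \<open>Equal masses allow the two pieces to exchange their image laws.\<close>
  define m where "m = min (P.prob A0) (P.prob B0)"
  have m: "m > 0" using pos by (simp add: m_def)
  have split: "\<exists>A. A \<in> sets P \<and> A \<subseteq> E \<and> P.prob A = m" if E: "E \<in> sets P" "m \<le> P.prob E" for E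
  proof -
    have Ep: "P.prob E > 0" using m E by simp
    interpret U: prob_space "uniform_measure P E" by (rule cond(1)[OF E(1) Ep])
    obtain A where A: "A \<in> sets (uniform_measure P E)" "measure (uniform_measure P E) A = m / P.prob E"
      using U.atomless_split[OF cond(3,2)[OF E(1) Ep], of "m / P.prob E"] m E Ep by auto
    have "P.prob (E \<inter> A) = m" using A Ep E by (simp add: P.emeasure_eq_measure)
    then show ?thesis using A(1) E(1) by (intro exI[of _ "E \<inter> A"]) auto
  qed
  obtain A where A: "A \<in> sets P" "A \<subseteq> A0" "P.prob A = m" using split[OF AB0(1)] by (auto simp: m_def)
  obtain B where B: "B \<in> sets P" "B \<subseteq> B0" "P.prob B = m" using split[OF AB0(2)] by (auto simp: m_def)
  have disj: "A \<inter> B = {}"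
  proof -
    have "z \<notin> B0" if z: "z \<in> A0" for z
    proof
      assume "z \<in> B0"
      then have "dist x z < \<delta>" "dist x2 z < \<delta>" using z by (auto simp: A0_def B0_def)
      then show False using dist_triangle2[of x x2 z] \<delta>(5) by linarith
    qed
    then show ?thesis using A(2) B(2) by blast
  qed
  have mA: "P.prob A > 0" "P.prob B > 0" using A B m by auto
  have realise: "\<exists>S. S \<in> P \<rightarrow>\<^sub>M sphere_borel \<and> (\<forall>E\<in>sets sphere_borel. P.prob (C \<inter> (S -` E \<inter> space P)) = P.prob (C' \<inter> (F -` E \<inter> space P)))"
    if C: "C \<in> sets P" "P.prob C = m" "C' \<in> sets P" "P.prob C' = m" for C C'
  proof -
    have Cp: "P.prob C > 0" "P.prob C' > 0" using C m by auto
    interpret U: prob_space "uniform_measure P C" by (rule cond(1)[OF C(1) Cp(1)])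
    interpret U': prob_space "uniform_measure P C'" by (rule cond(1)[OF C(3) Cp(2)])
    have Fu: "F \<in> uniform_measure P C' \<rightarrow>\<^sub>M sphere_borel" using FmP by simp
    obtain S where S: "S \<in> uniform_measure P C \<rightarrow>\<^sub>M sphere_borel" "distr (uniform_measure P C) sphere_borel S = distr (uniform_measure P C') sphere_borel F"
      by (rule U.atomless_realises_sphere[OF cond(3)[OF C(1) Cp(1)] cond(2)[OF C(1) Cp(1)] U'.prob_space_distr[OF Fu] sets_distr])
    have Sm: "S \<in> P \<rightarrow>\<^sub>M sphere_borel" using S(1) by simp
    have "P.prob (C \<inter> (S -` E \<inter> space P)) = P.prob (C' \<inter> (F -` E \<inter> space P))" if E: "E \<in> sets sphere_borel" for E
    proof -
      have "measure (distr (uniform_measure P C) sphere_borel S) E = measure (distr (uniform_measure P C') sphere_borel F) E" by (simp only: S(2))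
      then have "P.prob (C \<inter> (S -` E \<inter> space P)) / P.prob C = P.prob (C' \<inter> (F -` E \<inter> space P)) / P.prob C'"
        using E S(1) Fu C Cp measurable_sets[OF Sm E] measurable_sets[OF FmP E]
        by (simp add: measure_distr P.emeasure_eq_measure)
      then show ?thesis using C Cp by simp
    qed
    then show ?thesis using Sm by blast
  qed
  obtain SA where SA[measurable]: "SA \<in> P \<rightarrow>\<^sub>M sphere_borel" and SA_law: "\<And>E. E \<in> sets sphere_borel \<Longrightarrow> P.prob (A \<inter> (SA -` E \<inter> space P)) = P.prob (B \<inter> (F -` E \<inter> space P))"
    using realise[OF A(1,3) B(1,3)] by blast
  obtain SB where SB[measurable]: "SB \<in> P \<rightarrow>\<^sub>M sphere_borel" and SB_law: "\<And>E. E \<in> sets sphere_borel \<Longrightarrow> P.prob (B \<inter> (SB -` E \<inter> space P)) = P.prob (A \<inter> (F -` E \<inter> space P))"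
    using realise[OF B(1,3) A(1,3)] by blast
  define S where "S z = (if z \<in> A then SA z else if z \<in> B then SB z else F z)" for z
  have Sz: "z \<in> A \<Longrightarrow> S z = SA z" "z \<in> B \<Longrightarrow> S z = SB z" "z \<notin> A \<Longrightarrow> z \<notin> B \<Longrightarrow> S z = F z" for z
    using disj by (auto simp: S_def disjoint_iff)
  have Sm[measurable]: "S \<in> P \<rightarrow>\<^sub>M sphere_borel"
    unfolding S_def[abs_def] using A(1) B(1) by (intro measurable_If_set SA SB FmP) auto
  have S_transport: "S \<in> transport_maps P"
  proof -
    have "distr P sphere_borel S = distr P sphere_borel F"
    proof (rule measure_eqI)
      fix E assume "E \<in> sets (distr P sphere_borel S)"
      then have E: "E \<in> sets sphere_borel" by simp
      have decomp: "P.prob (R -` E \<inter> space P) = P.prob (A \<inter> (R -` E \<inter> space P)) + P.prob (B \<inter> (R -` E \<inter> space P))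
          + P.prob ((space P - A - B) \<inter> (R -` E \<inter> space P))" if R: "R \<in> P \<rightarrow>\<^sub>M sphere_borel" for R
      proof -
        let ?R = "R -` E \<inter> space P"
        have RE: "?R \<in> sets P" by (rule measurable_sets[OF R E])
        have "P.prob ?R = P.prob ((A \<inter> ?R) \<union> ((B \<inter> ?R) \<union> ((space P - A - B) \<inter> ?R)))"
          by (rule arg_cong[where f=P.prob]) auto
        also have "\<dots> = P.prob (A \<inter> ?R) + P.prob ((B \<inter> ?R) \<union> ((space P - A - B) \<inter> ?R))"
          using RE A(1) B(1) disj by (intro P.finite_measure_Union) auto
        also have "P.prob ((B \<inter> ?R) \<union> ((space P - A - B) \<inter> ?R)) = P.prob (B \<inter> ?R) + P.prob ((space P - A - B) \<inter> ?R)"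
          using RE A(1) B(1) by (intro P.finite_measure_Union) auto
        finally show ?thesis by simp
      qed
      have "A \<inter> (S -` E \<inter> space P) = A \<inter> (SA -` E \<inter> space P)" "B \<inter> (S -` E \<inter> space P) = B \<inter> (SB -` E \<inter> space P)"
        "(space P - A - B) \<inter> (S -` E \<inter> space P) = (space P - A - B) \<inter> (F -` E \<inter> space P)"
        using Sz by auto
      then have "P.prob (S -` E \<inter> space P) = P.prob (F -` E \<inter> space P)"
        unfolding decomp[OF Sm] decomp[OF FmP] by (simp add: SA_law[OF E] SB_law[OF E])
      then show "emeasure (distr P sphere_borel S) E = emeasure (distr P sphere_borel F) E"
        by (simp add: emeasure_distr[OF Sm E] emeasure_distr[OF FmP E] P.emeasure_eq_measure)
    qed simp
    then show ?thesis using FP Sm by (simp add: transport_maps_def measurable_cong_sets[OF PD(2) refl, symmetric])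
  qed
  have close: "AE z in P. z \<in> C \<longrightarrow> dist (T z) w < \<eta> / 2"
    if T: "T \<in> P \<rightarrow>\<^sub>M sphere_borel" and C: "C \<in> sets P" "P.prob C = m" "P.prob C' = m" "C' \<in> sets P"
      and law: "\<And>E. E \<in> sets sphere_borel \<Longrightarrow> P.prob (C \<inter> (T -` E \<inter> space P)) = P.prob (C' \<inter> (F -` E \<inter> space P))"
      and im: "\<And>z. z \<in> C' \<Longrightarrow> dist (F z) w < \<eta> / 2" for T C C' w
  proof -
    let ?E = "ball w (\<eta> / 2) \<inter> ?S"
    have E: "?E \<in> sets sphere_borel" by (rule borel_imp_sphere_borel) simp
    have TE: "T -` ?E \<inter> space P \<in> sets P" by (rule measurable_sets[OF T E])
    have "C' \<inter> (F -` ?E \<inter> space P) = C'"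
      using im sets.sets_into_space[OF C(4)] FS PD(3) by (auto simp: dist_commute)
    then have "P.prob (C \<inter> (T -` ?E \<inter> space P)) = P.prob C" using law[OF E] C by simp
    then have "P.prob (C - (C \<inter> (T -` ?E \<inter> space P))) = 0"
      using C(1) TE by (subst P.finite_measure_Diff) auto
    then have "C - (C \<inter> (T -` ?E \<inter> space P)) \<in> null_sets P"
      using C(1) TE by (auto simp: null_sets_def P.emeasure_eq_measure)
    then have "AE z in P. z \<notin> C - (C \<inter> (T -` ?E \<inter> space P))" by (rule AE_not_in)
    then show ?thesis using AE_space by eventually_elim (auto simp: dist_commute)
  qed
  have FA: "dist (F z) (F x) < \<eta> / 2" "dist z x < \<eta> / 2" "norm z = 1" if "z \<in> A" for z
  proof -
    have "dist z x < \<delta>" "norm z = 1" using that A(2) by (auto simp: A0_def dist_commute)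
    then show "dist (F z) (F x) < \<eta> / 2" "dist z x < \<eta> / 2" "norm z = 1" using \<delta>1(2)[of z] \<delta> by linarith+
  qed
  have FB: "dist (F z) (F x2) < \<eta> / 2" "dist z x2 < \<eta> / 2" "norm z = 1" if "z \<in> B" for z
  proof -
    have "dist z x2 < \<delta>" "norm z = 1" using that B(2) by (auto simp: B0_def dist_commute)
    then show "dist (F z) (F x2) < \<eta> / 2" "dist z x2 < \<eta> / 2" "norm z = 1" using \<delta>2(2)[of z] \<delta> by linarith+
  qed
  have closeA: "AE z in P. z \<in> A \<longrightarrow> dist (SA z) (F x2) < \<eta> / 2"
    by (rule close[OF SA A(1,3) B(3,1) SA_law FB(1)])
  have closeB: "AE z in P. z \<in> B \<longrightarrow> dist (SB z) (F x) < \<eta> / 2"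
    by (rule close[OF SB B(1,3) A(3,1) SB_law FA(1)])
  let ?a = "cost x (F x) - cost x (F x2) - 2 * \<epsilon>" and ?b = "cost x2 (F x2) - cost x2 (F x) - 2 * \<epsilon>"
  let ?D = "\<lambda>z. cost z (F z) - cost z (S z)"
  have idm: "(\<lambda>z. z) \<in> P \<rightarrow>\<^sub>M sphere_borel" by (rule measurable_ident_sets[OF PD(2)])
  have int: "integrable P (\<lambda>z. cost z (R z))" if "R \<in> P \<rightarrow>\<^sub>M sphere_borel" for R
  proof (rule P.integrable_const_bound[where B="pi\<^sup>2 / 2"])
    show "AE z in P. norm (cost z (R z)) \<le> pi\<^sup>2 / 2"
    proof (rule AE_I2)
      fix z assume z: "z \<in> space P"
      then have "norm z = 1" "norm (R z) = 1" using PD(3) measurable_space[OF that z] by auto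
      then show "norm (cost z (R z)) \<le> pi\<^sup>2 / 2" using cost_bounds[of z "R z"] by simp
    qed
  qed (rule cost_measurable[OF idm that])
  have "(\<integral>z. ?a * indicator A z + ?b * indicator B z \<partial>P) \<le> (\<integral>z. ?D z \<partial>P)"
  proof (rule integral_mono_AE)
    show "integrable P (\<lambda>z. ?a * indicator A z + ?b * indicator B z)"
      using A(1) B(1) by (intro Bochner_Integration.integrable_add integrable_mult_right P.integrable_const_bound[where B=1]) auto
    show "integrable P ?D" using int[OF FmP] int[OF Sm] by simp
    show "AE z in P. ?a * indicator A z + ?b * indicator B z \<le> ?D z"
      using closeA closeB AE_space
    proof eventually_elim
      case (elim z)
      have nS: "norm (SA z) = 1" "norm (SB z) = 1" using measurable_space[OF SA elim(3)] measurable_space[OF SB elim(3)] by auto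
      consider "z \<in> A" | "z \<in> B" "z \<notin> A" | "z \<notin> A" "z \<notin> B" by blast
      then show ?case
      proof cases
        case 1
        have "\<bar>cost z (F z) - cost x (F x)\<bar> < \<epsilon>" using FA[OF 1] FS x by (intro near) auto
        moreover have "\<bar>cost z (SA z) - cost x (F x2)\<bar> < \<epsilon>" using FA[OF 1] FS x nS elim 1 by (intro near) auto
        moreover have "z \<notin> B" using disj 1 by blast
        ultimately show ?thesis using 1 Sz(1)[OF 1] by simp
      next
        case 2
        have "\<bar>cost z (F z) - cost x2 (F x2)\<bar> < \<epsilon>" using FB[OF 2(1)] FS x by (intro near) auto
        moreover have "\<bar>cost z (SB z) - cost x2 (F x)\<bar> < \<epsilon>" using FB[OF 2(1)] FS x nS elim 2 by (intro near) auto
        ultimately show ?thesis using 2 Sz(2)[OF 2(1)] by simp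
      qed (simp add: Sz)
    qed
  qed
  also have "(\<integral>z. ?a * indicator A z + ?b * indicator B z \<partial>P) = ?a * m + ?b * m"
    using A(1,3) B(1,3) by (subst Bochner_Integration.integral_add) (auto simp: P.emeasure_eq_measure)
  also have "(\<integral>z. ?D z \<partial>P) = (\<integral>z. cost z (F z) \<partial>P) - (\<integral>z. cost z (S z) \<partial>P)"
    using int[OF FmP] int[OF Sm] by simp
  also have "\<dots> \<le> 0" using Fopt[OF S_transport] by simp
  also have "?a * m + ?b * m = 4 * \<epsilon> * m" by (simp add: \<epsilon>_def field_simps)
  finally show False using \<epsilon> m by (simp add: mult_le_0_iff)
qed

text \<open>
  Up to a null set the preimage of the image of a closed set \<open>K\<close> is \<open>K\<close>, so the mass of \<open>K\<close> is the
  uniform mass of its image.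
\<close>
theorem same_df_imp_same_law:
  fixes P1 P2 :: "(real ^ 'd) measure"
  assumes d: "CARD('d) \<ge> 2" and P: "P1 \<in> bounded_density_class" "P2 \<in> bounded_density_class"
    and F: "directional_df P1 F1" "directional_df P2 F2" and eq: "\<And>z. z \<in> sphere 0 1 \<Longrightarrow> F1 z = F2 z"
  shows "P1 = P2"
proof -
  let ?S = "sphere (0::real ^ 'd) 1"
  have F1: "continuous_on ?S F1" "optimal_transport_map P1 F1" "F1 \<in> sphere_borel \<rightarrow>\<^sub>M sphere_borel"
    "distr P1 sphere_borel F1 = uniform_sphere"
    using F(1) by (auto simp: directional_df_def optimal_transport_map_def transport_maps_def)
  have F2: "F2 \<in> sphere_borel \<rightarrow>\<^sub>M sphere_borel" "distr P2 sphere_borel F2 = uniform_sphere"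
    using F(2) by (auto simp: directional_df_def optimal_transport_map_def transport_maps_def)
  have F12: "distr P2 sphere_borel F1 = uniform_sphere"
    unfolding F2(2)[symmetric] using eq bounded_densityD(3)[OF P(2)] by (intro distr_cong) auto
  have FS: "F1 ` ?S \<subseteq> ?S" using measurable_space[OF F1(3)] by (auto simp: image_subset_iff)
  obtain N where N: "N \<in> sets sphere_borel" "emeasure surface_measure N = 0"
    "\<And>x x'. norm x = 1 \<Longrightarrow> norm x' = 1 \<Longrightarrow> F1 x = F1 x' \<Longrightarrow> F1 x \<notin> N \<Longrightarrow> x = x'"
    using ambiguous_fibre_null[OF d F1(1) FS optimal_monotone[OF d P(1) F1(1,2)]] by blast
  have N0: "N \<in> null_sets uniform_sphere" using N by (intro uniform_sphere_null) (auto simp: null_sets_def)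
  have main: "emeasure Q K = emeasure uniform_sphere (F1 ` K)"
    if Q: "sets Q = sets sphere_borel" "distr Q sphere_borel F1 = uniform_sphere" and K: "closed K" "K \<subseteq> ?S" for Q K
  proof -
    have sp: "space Q = ?S" using sets_eq_imp_space_eq[OF Q(1)] by simp
    have FQ: "F1 \<in> Q \<rightarrow>\<^sub>M sphere_borel" using F1(3) by (simp add: measurable_cong_sets[OF Q(1) refl])
    have "compact K" using K compact_of_closed_subset[OF compact_sphere] by blast
    then have "compact (F1 ` K)" using F1(1) K by (intro compact_continuous_image) (auto intro: continuous_on_subset)
    then have FK: "F1 ` K \<in> sets sphere_borel" using FS K by (auto simp: sets_sphere_borel_iff intro: borel_compact)
    have KQ: "K \<in> sets Q" using K by (auto simp: Q(1) sets_sphere_borel_iff intro: borel_closed)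
    have NQ: "F1 -` N \<inter> space Q \<in> null_sets Q"
      using N0 measurable_sets[OF FQ N(1)] unfolding Q(2)[symmetric] by (auto simp: null_sets_def emeasure_distr[OF FQ N(1)])
    have "emeasure uniform_sphere (F1 ` K) = emeasure Q (F1 -` (F1 ` K) \<inter> space Q)"
      unfolding Q(2)[symmetric] by (rule emeasure_distr[OF FQ FK])
    also have "\<dots> = emeasure Q K"
    proof (rule emeasure_eq_AE)
      show "AE z in Q. (z \<in> F1 -` (F1 ` K) \<inter> space Q) = (z \<in> K)"
        using AE_not_in[OF NQ] AE_space
      proof eventually_elim
        case (elim z)
        then have z: "norm z = 1" "F1 z \<notin> N" by (auto simp: sp)
        show ?case
        proof
          assume "z \<in> F1 -` (F1 ` K) \<inter> space Q"
          then obtain w where w: "w \<in> K" "F1 z = F1 w" by auto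
          then have "z = w" using N(3)[of z w] z K by auto
          then show "z \<in> K" using w by simp
        qed (use elim in auto)
      qed
    qed (use KQ measurable_sets[OF FQ FK] in auto)
    finally show ?thesis by simp
  qed
  have ext: "distr P1 borel (\<lambda>x. x) = distr P2 borel (\<lambda>x. x)"
  proof -
    have idm: "(\<lambda>x. x) \<in> borel_measurable Q" if "sets Q = sets sphere_borel" for Q :: "(real ^ 'd) measure"
      unfolding measurable_cong_sets[OF that refl] sphere_borel_def by (rule measurable_restrict_space1) simp
    have val: "emeasure (distr Q borel (\<lambda>x. x)) C = emeasure Q (C \<inter> ?S)"
      if "sets Q = sets sphere_borel" "closed C" for Q and C :: "(real ^ 'd) set"
      using sets_eq_imp_space_eq[OF that(1)] that(2)
      by (subst emeasure_distr[OF idm[OF that(1)]]) (auto intro!: arg_cong[where f="emeasure Q"])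
    interpret P1: prob_space P1 by (rule bounded_densityD(1)[OF P(1)])
    show ?thesis
    proof (rule measure_eqI_generator_eq[where E="Collect closed" and \<Omega>=UNIV and A="\<lambda>_. UNIV"])
      show "Int_stable (Collect (closed :: (real ^ 'd) set \<Rightarrow> bool))" by (auto simp: Int_stable_def)
      fix C :: "(real ^ 'd) set" assume "C \<in> Collect closed"
      then have C: "closed C" "closed (C \<inter> ?S)" "C \<inter> ?S \<subseteq> ?S" by auto
      show "emeasure (distr P1 borel (\<lambda>x. x)) C = emeasure (distr P2 borel (\<lambda>x. x)) C"
        using val[OF bounded_densityD(2)[OF P(1)] C(1)] val[OF bounded_densityD(2)[OF P(2)] C(1)]
          main[OF bounded_densityD(2)[OF P(1)] F1(4) C(2,3)] main[OF bounded_densityD(2)[OF P(2)] F12 C(2,3)] by simp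
    next
      show "emeasure (distr P1 borel (\<lambda>x. x)) UNIV \<noteq> \<infinity>"
        using val[OF bounded_densityD(2)[OF P(1)], of UNIV] by (simp add: P1.emeasure_eq_measure)
    qed (auto simp: borel_eq_closed)
  qed
  show "P1 = P2"
  proof (rule measure_eqI)
    show s: "sets P1 = sets P2" using bounded_densityD(2)[OF P(1)] bounded_densityD(2)[OF P(2)] by simp
    fix A assume A: "A \<in> sets P1"
    have "emeasure Q A = emeasure (distr Q borel (\<lambda>x. x)) A" if Q: "sets Q = sets sphere_borel" for Q
    proof -
      have "(\<lambda>x. x) \<in> borel_measurable Q"
        unfolding measurable_cong_sets[OF Q refl] sphere_borel_def by (rule measurable_restrict_space1) simp
      moreover have "A \<in> sets borel" "A \<subseteq> space Q"
        using A bounded_densityD(2)[OF P(1)] sets_eq_imp_space_eq[OF Q] by (auto simp: sets_sphere_borel_iff)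
      ultimately show ?thesis by (subst emeasure_distr) (auto simp: Int_absorb2)
    qed
    then show "emeasure P1 A = emeasure P2 A"
      using ext bounded_densityD(2)[OF P(1)] bounded_densityD(2)[OF P(2)] by metis
  qed
qed

declare One_nat_def [simp del]

section \<open>Ranks are uniformly distributed\<close>

definition total_cost :: "nat \<Rightarrow> (nat \<Rightarrow> real ^ 'd) \<Rightarrow> (nat \<Rightarrow> real ^ 'd) \<Rightarrow> (nat \<Rightarrow> nat) \<Rightarrow> real" where
  "total_cost n g y T = (\<Sum>l=1..n. cost (y l) (g (T l)))"

text \<open>
  The samples for which \<open>T\<close> is the only optimal assignment.
\<close>
definition strictly_optimal :: "nat \<Rightarrow> (nat \<Rightarrow> real ^ 'd) \<Rightarrow> (nat \<Rightarrow> nat) \<Rightarrow> (nat \<Rightarrow> real ^ 'd) set" where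
  "strictly_optimal n g T = {y \<in> {1..n} \<rightarrow>\<^sub>E sphere 0 1.
     \<forall>S. S permutes {1..n} \<longrightarrow> S \<noteq> T \<longrightarrow> total_cost n g y T < total_cost n g y S}"

locale iid_sphere_sample =
  fixes P :: "(real ^ 'd) measure" and n :: nat and g :: "nat \<Rightarrow> real ^ 'd"
  assumes dim: "CARD('d) \<ge> 2" and P: "P \<in> bounded_density_class"
    and g: "g ` {1..n} \<subseteq> sphere 0 1" "inj_on g {1..n}"
begin

abbreviation "PP \<equiv> \<Pi>\<^sub>M l\<in>{1..n}. P"

lemma prob_P: "prob_space P" and sets_P: "sets P = sets sphere_borel" and space_P: "space P = sphere 0 1"
  using bounded_densityD[OF P] by auto

lemma g_unit: "l \<in> {1..n} \<Longrightarrow> norm (g l) = 1"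
  using g(1) by (auto simp: image_subset_iff)

lemma perm_in: "T permutes {1..n} \<Longrightarrow> l \<in> {1..n} \<Longrightarrow> T l \<in> {1..n}"
  by (simp only: permutes_in_image)

lemma component_cost_measurable:
  assumes "l \<in> {1..n}" "s \<in> {1..n}"
  shows "(\<lambda>y. cost (y l) (g s)) \<in> borel_measurable PP"
proof (rule cost_measurable)
  have "(\<lambda>y. y l) \<in> PP \<rightarrow>\<^sub>M P" by (rule measurable_component_singleton[OF assms(1)])
  then show "(\<lambda>y. y l) \<in> PP \<rightarrow>\<^sub>M sphere_borel" by (rule measurable_compose[OF _ measurable_ident_sets[OF sets_P]])
  show "(\<lambda>y. g s) \<in> PP \<rightarrow>\<^sub>M sphere_borel" using g_unit[OF assms(2)] by (intro measurable_const) simp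
qed

lemma total_cost_measurable:
  assumes T: "T permutes {1..n}"
  shows "(\<lambda>y. total_cost n g y T) \<in> borel_measurable PP"
  unfolding total_cost_def
proof (rule borel_measurable_sum)
  fix l assume l: "l \<in> {1..n}"
  show "(\<lambda>y. cost (y l) (g (T l))) \<in> borel_measurable PP"
    by (rule component_cost_measurable[OF l perm_in[OF T l]])
qed

lemma space_PP: "space PP = {1..n} \<rightarrow>\<^sub>E sphere 0 1"
  by (simp add: space_PiM space_P)

lemma strictly_optimal_measurable:
  assumes T: "T permutes {1..n}"
  shows "strictly_optimal n g T \<in> sets PP"
proof -
  let ?A = "{S. S permutes {1..n} \<and> S \<noteq> T}"
  have fin: "finite ?A" by (rule finite_subset[of _ "{S. S permutes {1..n}}"]) (auto simp: finite_permutations)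
  have "strictly_optimal n g T = {y \<in> space PP. \<forall>S\<in>?A. total_cost n g y T < total_cost n g y S}"
    unfolding space_PP by (auto simp: strictly_optimal_def)
  moreover have "{y \<in> space PP. \<forall>S\<in>?A. total_cost n g y T < total_cost n g y S} \<in> sets PP"
    by (intro sets.sets_Collect_finite_All fin borel_measurable_less total_cost_measurable T) auto
  ultimately show ?thesis by simp
qed

text \<open>
  Fix all points but one whose two assigned grid points differ; a tie puts that point in a level set
  of a difference of two costs.
\<close>
lemma no_ties:
  assumes S: "S permutes {1..n}" and T: "T permutes {1..n}" and ne: "S \<noteq> T"
  shows "AE y in PP. total_cost n g y S \<noteq> total_cost n g y T"
proof -
  obtain l where l2: "S l \<noteq> T l" using ne by blast
  have "l \<in> {1..n}"
  proof (rule ccontr)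
    assume "l \<notin> {1..n}"
    then show False using permutes_not_in[OF S] permutes_not_in[OF T] l2 by simp
  qed
  with l2 have l: "l \<in> {1..n}" "S l \<noteq> T l" by blast+
  define I where "I = {1..n} - {l}"
  have I: "finite I" "l \<notin> I" "insert l I = {1..n}" using l by (auto simp: I_def)
  have Sl: "S l \<in> {1..n}" "T l \<in> {1..n}" using perm_in[OF S l(1)] perm_in[OF T l(1)] by auto
  have gne: "g (S l) \<noteq> g (T l)" using g(2) Sl l(2) by (auto dest: inj_onD)
  define E where "E = {y \<in> space PP. total_cost n g y S = total_cost n g y T}"
  have E: "E \<in> sets PP" unfolding E_def by (intro borel_measurable_eq total_cost_measurable S T)
  interpret PF: product_sigma_finite "\<lambda>_::nat. P"
    by (intro product_sigma_finite.intro prob_space_imp_sigma_finite prob_P)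
  have "emeasure PP E = (\<integral>\<^sup>+ y. indicator E y \<partial>PiM (insert l I) (\<lambda>_. P))"
    using E by (simp add: I(3))
  also have "\<dots> = (\<integral>\<^sup>+ x. (\<integral>\<^sup>+ z. indicator E (x(l := z)) \<partial>P) \<partial>PiM I (\<lambda>_. P))"
    by (rule PF.product_nn_integral_insert[OF I(1,2)]) (use E I(3) in simp)
  also have "\<dots> = (\<integral>\<^sup>+ x. 0 \<partial>PiM I (\<lambda>_. P))"
  proof (rule nn_integral_cong)
    fix x assume "x \<in> space (PiM I (\<lambda>_. P))"
    define c where "c = (\<Sum>k\<in>I. cost (x k) (g (T k))) - (\<Sum>k\<in>I. cost (x k) (g (S k)))"
    let ?N = "{z \<in> sphere 0 1. cost z (g (S l)) - cost z (g (T l)) = c}"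
    have N: "?N \<in> null_sets P"
      by (rule bounded_densityD(4)[OF P cost_difference_level_null[OF dim g_unit[OF Sl(1)] g_unit[OF Sl(2)] gne]])
    have tc: "total_cost n g (x(l := z)) R = cost z (g (R l)) + (\<Sum>k\<in>I. cost (x k) (g (R k)))" for R z
    proof -
      have "total_cost n g (x(l := z)) R = (\<Sum>k\<in>insert l I. cost ((x(l := z)) k) (g (R k)))"
        unfolding total_cost_def I(3) ..
      also have "\<dots> = cost z (g (R l)) + (\<Sum>k\<in>I. cost ((x(l := z)) k) (g (R k)))"
        by (subst sum.insert[OF I(1,2)]) simp
      also have "(\<Sum>k\<in>I. cost ((x(l := z)) k) (g (R k))) = (\<Sum>k\<in>I. cost (x k) (g (R k)))"
        using I(2) by (intro sum.cong) auto
      finally show ?thesis .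
    qed
    have "AE z in P. indicator E (x(l := z)) = (0::ennreal)"
      using AE_not_in[OF N] AE_space
    proof eventually_elim
      case (elim z)
      then show ?case by (auto simp: E_def tc c_def space_P indicator_def)
    qed
    then have "(\<integral>\<^sup>+ z. indicator E (x(l := z)) \<partial>P) = (\<integral>\<^sup>+ z. 0 \<partial>P)" by (rule nn_integral_cong_AE)
    then show "(\<integral>\<^sup>+ z. indicator E (x(l := z)) \<partial>P) = 0" by simp
  qed
  finally have "E \<in> null_sets PP" using E by (simp add: null_sets_def)
  then have "AE y in PP. y \<notin> E" by (rule AE_not_in)
  then show ?thesis using AE_space by eventually_elim (auto simp: E_def)
qed

lemma AE_strictly_optimal: "AE y in PP. \<exists>T. T permutes {1..n} \<and> y \<in> strictly_optimal n g T"
proof -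
  let ?\<Pi> = "{T. T permutes {1..n}}"
  have fin: "finite ?\<Pi>" by (simp add: finite_permutations)
  have "AE y in PP. \<forall>S\<in>?\<Pi>. \<forall>T\<in>?\<Pi>. S \<noteq> T \<longrightarrow> total_cost n g y S \<noteq> total_cost n g y T"
    using no_ties by (intro AE_finite_allI fin) auto
  then show ?thesis using AE_space
  proof eventually_elim
    case (elim y)
    let ?c = "total_cost n g y"
    have ne: "id \<in> ?\<Pi>" using permutes_id by blast
    have "?c ` ?\<Pi> \<noteq> {}" using ne by blast
    then have "Min (?c ` ?\<Pi>) \<in> ?c ` ?\<Pi>" by (rule Min_in[OF finite_imageI[OF fin]])
    then obtain T where T0: "T \<in> ?\<Pi>" "Min (?c ` ?\<Pi>) = ?c T" by (rule imageE)
    have T: "T permutes {1..n}" "\<And>S. S permutes {1..n} \<Longrightarrow> ?c T \<le> ?c S"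
    proof -
      show "T permutes {1..n}" using T0(1) by simp
      fix S assume "S permutes {1..n}"
      then have "?c S \<in> ?c ` ?\<Pi>" by blast
      then show "?c T \<le> ?c S" unfolding T0(2)[symmetric] using fin by (intro Min_le) auto
    qed
    have "total_cost n g y T < total_cost n g y S" if "S permutes {1..n}" "S \<noteq> T" for S
      using T(2)[OF that(1)] elim(1) T(1) that by (metis less_le mem_Collect_eq)
    then show ?case using T(1) elim(2) unfolding space_PP strictly_optimal_def by blast
  qed
qed

lemma strictly_optimal_unique:
  assumes "S permutes {1..n}" "T permutes {1..n}" "y \<in> strictly_optimal n g S" "y \<in> strictly_optimal n g T"
  shows "S = T"
proof (rule ccontr)
  assume "S \<noteq> T"
  then have "total_cost n g y S < total_cost n g y T" "total_cost n g y T < total_cost n g y S"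
    using assms unfolding strictly_optimal_def by auto
  then show False by simp
qed

text \<open>
  Relabelling the sample by \<open>T\<close> preserves its law and turns the event for \<open>T\<close> into the event for the
  identity.
\<close>
lemma prob_strictly_optimal_eq:
  assumes T: "T permutes {1..n}"
  shows "measure PP (strictly_optimal n g T) = measure PP (strictly_optimal n g id)"
proof -
  let ?\<phi> = "\<lambda>y. \<lambda>l\<in>{1..n}. y (T l)"
  have d: "distr PP PP ?\<phi> = PP"
    using distr_PiM_reindex[of "{1..n}" "\<lambda>_. P" T "{1..n}"] prob_P permutes_inj_on[OF T] perm_in[OF T] by auto
  have m: "?\<phi> \<in> PP \<rightarrow>\<^sub>M PP"
    by (intro measurable_restrict measurable_component_singleton perm_in[OF T])
  have cost: "total_cost n g (?\<phi> y) R = total_cost n g y (R \<circ> inv T)" for y R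
  proof -
    have "total_cost n g y (R \<circ> inv T) = (\<Sum>l=1..n. cost (y (T l)) (g ((R \<circ> inv T) (T l))))"
      unfolding total_cost_def by (rule sum_permuted[OF T, symmetric])
    also have "\<dots> = (\<Sum>l=1..n. cost (?\<phi> y l) (g (R l)))"
      by (intro sum.cong) (simp_all add: permutes_inverses[OF T])
    finally show ?thesis by (simp add: total_cost_def)
  qed
  have "?\<phi> -` strictly_optimal n g T \<inter> space PP = strictly_optimal n g id"
  proof (intro equalityI subsetI)
    fix y assume y: "y \<in> ?\<phi> -` strictly_optimal n g T \<inter> space PP"
    have "total_cost n g y id < total_cost n g y S" if S: "S permutes {1..n}" "S \<noteq> id" for S
    proof -
      have "S \<circ> T permutes {1..n}" by (rule permutes_compose[OF T S(1)])
      moreover have "S \<circ> T \<noteq> T"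
      proof
        assume "S \<circ> T = T"
        then have "S \<circ> T \<circ> inv T = T \<circ> inv T" by simp
        then show False using S(2) by (simp add: comp_assoc permutes_inv_o[OF T])
      qed
      ultimately have "total_cost n g (?\<phi> y) T < total_cost n g (?\<phi> y) (S \<circ> T)"
        using y unfolding strictly_optimal_def by blast
      then show ?thesis unfolding cost by (simp add: comp_assoc permutes_inv_o[OF T])
    qed
    then show "y \<in> strictly_optimal n g id" using y unfolding strictly_optimal_def space_PP by blast
  next
    fix y assume y: "y \<in> strictly_optimal n g id"
    then have sp: "y \<in> space PP" unfolding space_PP strictly_optimal_def by blast
    have "total_cost n g (?\<phi> y) T < total_cost n g (?\<phi> y) S" if S: "S permutes {1..n}" "S \<noteq> T" for S
    proof -
      have "S \<circ> inv T permutes {1..n}" by (rule permutes_compose[OF permutes_inv[OF T] S(1)])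
      moreover have "S \<circ> inv T \<noteq> id"
      proof
        assume "S \<circ> inv T = id"
        then have "S \<circ> inv T \<circ> T = T" by simp
        then show False using S(2) by (simp add: comp_assoc permutes_inv_o[OF T])
      qed
      ultimately have "total_cost n g y id < total_cost n g y (S \<circ> inv T)"
        using y unfolding strictly_optimal_def by blast
      then show ?thesis unfolding cost by (simp add: permutes_inv_o[OF T])
    qed
    then have "?\<phi> y \<in> strictly_optimal n g T"
      using measurable_space[OF m sp] unfolding strictly_optimal_def space_PP by blast
    then show "y \<in> ?\<phi> -` strictly_optimal n g T \<inter> space PP" using sp by blast
  qed
  then have "measure (distr PP PP ?\<phi>) (strictly_optimal n g T) = measure PP (strictly_optimal n g id)"
    by (simp add: measure_distr[OF m strictly_optimal_measurable[OF T]])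
  then show ?thesis unfolding d .
qed

lemma prob_strictly_optimal:
  assumes T: "T permutes {1..n}"
  shows "measure PP (strictly_optimal n g T) = 1 / fact n"
proof -
  let ?\<Pi> = "{T. T permutes {1..n}}"
  have fin: "finite ?\<Pi>" by (simp add: finite_permutations)
  interpret PP: prob_space PP by (rule prob_space_PiM) (rule prob_P)
  have "1 = measure PP (\<Union>T\<in>?\<Pi>. strictly_optimal n g T)"
  proof (rule PP.AE_in_set_eq_1[THEN iffD1, symmetric])
    show "(\<Union>T\<in>?\<Pi>. strictly_optimal n g T) \<in> sets PP"
      using strictly_optimal_measurable fin by (intro sets.finite_UN) auto
    show "AE y in PP. y \<in> (\<Union>T\<in>?\<Pi>. strictly_optimal n g T)"
      using AE_strictly_optimal by eventually_elim auto
  qed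
  also have "\<dots> = (\<Sum>T\<in>?\<Pi>. measure PP (strictly_optimal n g T))"
  proof (rule PP.finite_measure_finite_Union[OF fin])
    show "strictly_optimal n g ` ?\<Pi> \<subseteq> sets PP" using strictly_optimal_measurable by blast
    show "disjoint_family_on (strictly_optimal n g) ?\<Pi>"
      unfolding disjoint_family_on_def
    proof (intro ballI impI)
      fix S T assume ST: "S \<in> ?\<Pi>" "T \<in> ?\<Pi>" "S \<noteq> T"
      have "y \<notin> strictly_optimal n g T" if y: "y \<in> strictly_optimal n g S" for y
        using strictly_optimal_unique[OF _ _ y] ST by blast
      then show "strictly_optimal n g S \<inter> strictly_optimal n g T = {}" by blast
    qed
  qed
  also have "\<dots> = (\<Sum>T\<in>?\<Pi>. measure PP (strictly_optimal n g id))"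
    by (rule sum.cong[OF refl], rule prob_strictly_optimal_eq, simp)
  also have "\<dots> = fact n * measure PP (strictly_optimal n g id)"
    by (simp add: card_permutations)
  finally show ?thesis unfolding prob_strictly_optimal_eq[OF T] by (simp add: field_simps)
qed

text \<open>
  A bijection onto the \<open>n\<close> distinct grid points forces the sample points to be distinct, so the
  empirical map is given by a permutation, and that permutation is optimal.
\<close>
lemma empirical_df_permutation:
  assumes F: "empirical_directional_df n g y F" and T: "T permutes {1..n}"
    and y: "restrict y {1..n} \<in> strictly_optimal n g T" and l: "l \<in> {1..n}"
  shows "F (y l) = g (T l)"
proof -
  let ?\<Pi> = "{T. T permutes {1..n}}"
  have fin: "finite ?\<Pi>" by (simp add: finite_permutations)
  have bij: "bij_betw F (y ` {1..n}) (g ` {1..n})" 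
    and min: "(\<Sum>l=1..n. cost (y l) (F (y l))) = Min ((\<lambda>T. \<Sum>l=1..n. cost (y l) (g (T l))) ` ?\<Pi>)"
    using F unfolding empirical_directional_df_def by auto
  have "card (y ` {1..n}) = card {1..n}"
    using bij_betw_same_card[OF bij] card_image[OF g(2)] by simp
  then have inj_y: "inj_on y {1..n}" by (intro eq_card_imp_inj_on) auto
  have bFy: "bij_betw (F \<circ> y) {1..n} (g ` {1..n})"
    by (rule bij_betw_trans[OF inj_on_imp_bij_betw[OF inj_y] bij])
  have bg: "bij_betw (inv_into {1..n} g) (g ` {1..n}) {1..n}"
    by (rule bij_betw_inv_into[OF inj_on_imp_bij_betw[OF g(2)]])
  define S where "S k = (if k \<in> {1..n} then inv_into {1..n} g (F (y k)) else k)" for k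
  have "bij_betw S {1..n} {1..n}"
    using bij_betw_trans[OF bFy bg] by (rule bij_betw_cong[THEN iffD1, rotated]) (simp add: S_def)
  then have S: "S permutes {1..n}" by (rule bij_imp_permutes) (auto simp: S_def)
  have gS: "g (S k) = F (y k)" if "k \<in> {1..n}" for k
    using that bij_betwE[OF bFy] by (simp add: S_def f_inv_into_f)
  have "S = T"
  proof (rule ccontr)
    assume "S \<noteq> T"
    then have "total_cost n g (restrict y {1..n}) T < total_cost n g (restrict y {1..n}) S"
      using y S unfolding strictly_optimal_def by blast
    moreover have "total_cost n g (restrict y {1..n}) S = (\<Sum>l=1..n. cost (y l) (F (y l)))"
      unfolding total_cost_def by (intro sum.cong) (auto simp: gS)
    moreover have "(\<Sum>l=1..n. cost (y l) (F (y l))) \<le> (\<Sum>l=1..n. cost (y l) (g (T l)))"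
      unfolding min using fin T by (intro Min_le) auto
    moreover have "(\<Sum>l=1..n. cost (y l) (g (T l))) = total_cost n g (restrict y {1..n}) T"
      unfolding total_cost_def by (intro sum.cong) auto
    ultimately show False by simp
  qed
  then show ?thesis using gS[OF l] by simp
qed

theorem expectation_of_ranks:
  fixes M :: "'w measure" and Y :: "nat \<Rightarrow> 'w \<Rightarrow> real ^ 'd" and Z :: "'w \<Rightarrow> real"
  assumes Ym: "(\<lambda>\<omega>. \<lambda>l\<in>{1..n}. Y l \<omega>) \<in> M \<rightarrow>\<^sub>M PP"
    and Y: "distr M PP (\<lambda>\<omega>. \<lambda>l\<in>{1..n}. Y l \<omega>) = PP" and M: "prob_space M"
    and F: "AE \<omega> in M. empirical_directional_df n g (\<lambda>l. Y l \<omega>) (F \<omega>)"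
    and Z: "Z \<in> borel_measurable M"
      "\<And>\<omega> T. T permutes {1..n} \<Longrightarrow> (\<And>l. l \<in> {1..n} \<Longrightarrow> F \<omega> (Y l \<omega>) = g (T l)) \<Longrightarrow> Z \<omega> = \<phi> T"
  shows "(\<integral>\<omega>. Z \<omega> \<partial>M) = perm_mean n \<phi>"
proof -
  interpret M: prob_space M by fact
  let ?\<Pi> = "{T. T permutes {1..n}}" and ?Y = "\<lambda>\<omega>. \<lambda>l\<in>{1..n}. Y l \<omega>"
  have fin: "finite ?\<Pi>" by (simp add: finite_permutations)
  let ?A = "\<lambda>T. ?Y -` strictly_optimal n g T \<inter> space M"
  have A: "?A T \<in> sets M" if "T \<in> ?\<Pi>" for T
    using that by (intro measurable_sets[OF Ym] strictly_optimal_measurable) simp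
  have "AE y in distr M PP ?Y. \<exists>T. T permutes {1..n} \<and> y \<in> strictly_optimal n g T"
    unfolding Y by (rule AE_strictly_optimal)
  then have "AE \<omega> in M. \<exists>T. T permutes {1..n} \<and> ?Y \<omega> \<in> strictly_optimal n g T"
    by (rule AE_distrD[OF Ym])
  then have "AE \<omega> in M. Z \<omega> = (\<Sum>T\<in>?\<Pi>. \<phi> T * indicator (?A T) \<omega>)"
    using F AE_space
  proof eventually_elim
    case (elim \<omega>)
    then obtain T where T: "T permutes {1..n}" "?Y \<omega> \<in> strictly_optimal n g T" by blast
    have "Z \<omega> = \<phi> T"
      by (rule Z(2)[OF T(1)]) (rule empirical_df_permutation[OF elim(2) T(1,2)])
    moreover have "(\<Sum>S\<in>?\<Pi>. \<phi> S * indicator (?A S) \<omega>) = (\<Sum>S\<in>?\<Pi>. if S = T then \<phi> S else 0)"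
    proof (rule sum.cong[OF refl])
      fix S assume "S \<in> ?\<Pi>"
      then have "\<omega> \<in> ?A S \<longleftrightarrow> S = T" using strictly_optimal_unique[of S T "?Y \<omega>"] T elim(3) by auto
      then show "\<phi> S * indicator (?A S) \<omega> = (if S = T then \<phi> S else 0)" by (simp add: indicator_def)
    qed
    ultimately show ?case using T(1) fin by simp
  qed
  then have "(\<integral>\<omega>. Z \<omega> \<partial>M) = (\<integral>\<omega>. (\<Sum>T\<in>?\<Pi>. \<phi> T * indicator (?A T) \<omega>) \<partial>M)"
    using Z(1) A by (intro integral_cong_AE) auto
  also have "\<dots> = (\<Sum>T\<in>?\<Pi>. \<phi> T * M.prob (?A T))"
    using A by (subst Bochner_Integration.integral_sum) (auto intro!: integrable_mult_right simp: M.emeasure_eq_measure)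
  also have "\<dots> = (\<Sum>T\<in>?\<Pi>. \<phi> T * (1 / fact n))"
  proof (intro sum.cong refl arg_cong2[where f="(*)"])
    fix T assume "T \<in> ?\<Pi>"
    then have T: "T permutes {1..n}" by simp
    have "M.prob (?A T) = measure (distr M PP ?Y) (strictly_optimal n g T)"
      by (rule measure_distr[OF Ym strictly_optimal_measurable[OF T], symmetric])
    then show "M.prob (?A T) = 1 / fact n" unfolding Y prob_strictly_optimal[OF T] .
  qed
  finally show ?thesis by (simp add: perm_mean_def sum_distrib_left)
qed

end

section \<open>The statistic as a function of the ranks\<close>

lemma rank_manova_statistic_eq:
  fixes J :: "real ^ 'd \<Rightarrow> real ^ 'k" and N :: "'m::finite \<Rightarrow> nat"
  assumes L: "\<And>v. v \<bullet> (moore_penrose_inverse (covariance_matrix uniform_sphere J) *v v) = (norm (L v))\<^sup>2"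
  shows "rank_manova_statistic J F n N x y = (\<Sum>i\<in>UNIV. (norm (L (score_deviation J F n N x y i)))\<^sup>2)"
proof -
  let ?B = "moore_penrose_inverse (covariance_matrix uniform_sphere J)"
  let ?s = "score_deviation J F n N x y"
  let ?v = "stacked_score_deviation J F n N x y"
  have k: "(kronecker_product (mat 1 :: real ^ 'm ^ 'm) ?B *v ?v) $ (i, a) = (?B *v ?s i) $ a" for i :: 'm and a
  proof -
    have "(kronecker_product (mat 1 :: real ^ 'm ^ 'm) ?B *v ?v) $ (i, a) =
        (\<Sum>q\<in>UNIV \<times> UNIV. (mat 1 :: real ^ 'm ^ 'm) $ i $ fst q * ?B $ a $ snd q * ?s (fst q) $ snd q)"
      by (simp add: matrix_vector_mult_def kronecker_product_def stacked_score_deviation_def)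
    also have "\<dots> = (\<Sum>j\<in>UNIV. \<Sum>b\<in>UNIV. (mat 1 :: real ^ 'm ^ 'm) $ i $ j * ?B $ a $ b * ?s j $ b)"
      by (simp add: sum.cartesian_product split_beta')
    also have "\<dots> = (\<Sum>j\<in>UNIV. if j = i then (\<Sum>b\<in>UNIV. ?B $ a $ b * ?s j $ b) else 0)"
      by (intro sum.cong refl) (simp add: mat_def)
    also have "\<dots> = (?B *v ?s i) $ a" by (simp add: matrix_vector_mult_def)
    finally show ?thesis .
  qed
  have "rank_manova_statistic J F n N x y = (\<Sum>p\<in>UNIV \<times> UNIV. ?s (fst p) $ snd p * (?B *v ?s (fst p)) $ snd p)"
  proof -
    have "?v $ p = ?s (fst p) $ snd p" for p by (simp add: stacked_score_deviation_def)
    moreover have "(kronecker_product (mat 1 :: real ^ 'm ^ 'm) ?B *v ?v) $ p = (?B *v ?s (fst p)) $ snd p" for p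
      using k[of "fst p" "snd p"] by simp
    ultimately show ?thesis
      unfolding rank_manova_statistic_def inner_vec_def UNIV_Times_UNIV by (simp only: inner_real_def)
  qed
  also have "\<dots> = (\<Sum>i\<in>UNIV. \<Sum>a\<in>UNIV. ?s i $ a * (?B *v ?s i) $ a)"
    by (simp add: sum.cartesian_product split_beta')
  also have "\<dots> = (\<Sum>i\<in>UNIV. (norm (L (?s i)))\<^sup>2)"
    unfolding L[symmetric] by (simp add: inner_vec_def)
  finally show ?thesis .
qed

lemma sum_sample_eq:
  fixes N :: "'m::finite \<Rightarrow> nat" and f :: "'m \<times> nat \<Rightarrow> 'v::real_vector"
  assumes e: "bij_betw e {1..n} (SIGMA i:UNIV. {1..N i})"
  shows "(\<Sum>j=1..N i. f (i, j)) = (\<Sum>l=1..n. of_bool (fst (e l) = i) *\<^sub>R f (e l))"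
proof -
  have "(\<Sum>l=1..n. of_bool (fst (e l) = i) *\<^sub>R f (e l)) = (\<Sum>p\<in>(SIGMA i:UNIV. {1..N i}). of_bool (fst p = i) *\<^sub>R f p)"
    by (rule sum.reindex_bij_betw[OF e, of "\<lambda>p. of_bool (fst p = i) *\<^sub>R f p"])
  also have "\<dots> = (\<Sum>k\<in>UNIV. \<Sum>j=1..N k. of_bool (k = i) *\<^sub>R f (k, j))"
    by (subst sum.Sigma) (auto simp: split_beta')
  also have "\<dots> = (\<Sum>k\<in>UNIV. if k = i then (\<Sum>j=1..N k. f (k, j)) else 0)"
    by (intro sum.cong refl) simp
  finally show ?thesis by simp
qed

text \<open>
  Subtracting the pooled mean is the same as centring the grid scores.
\<close>
lemma statistic_eq_permutation:
  fixes J :: "real ^ 'd \<Rightarrow> real ^ 'k" and N :: "'m::finite \<Rightarrow> nat"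
  assumes e: "bij_betw e {1..n} (SIGMA i:UNIV. {1..N i})" and N: "\<And>i. N i > 0" and n: "n > 0"
    and y: "\<And>l. l \<in> {1..n} \<Longrightarrow> y l = x (fst (e l)) (snd (e l))"
    and T: "T permutes {1..n}" "\<And>l. l \<in> {1..n} \<Longrightarrow> F (y l) = g (T l)"
    and L: "linear L" "\<And>v. v \<bullet> (moore_penrose_inverse (covariance_matrix uniform_sphere J) *v v) = (norm (L v))\<^sup>2"
    and gs: "grouped_scores n (\<lambda>l. fst (e l)) (\<lambda>s. L (J (g s) - (1 / real n) *\<^sub>R (\<Sum>s=1..n. J (g s))))"
  shows "rank_manova_statistic J F n N x y =
    grouped_scores.Q n (\<lambda>l. fst (e l)) (\<lambda>s. L (J (g s) - (1 / real n) *\<^sub>R (\<Sum>s=1..n. J (g s)))) T"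
proof -
  define \<mu> where "\<mu> = (1 / real n) *\<^sub>R (\<Sum>s=1..n. J (g s))"
  interpret grouped_scores n "\<lambda>l. fst (e l)" "\<lambda>s. L (J (g s) - \<mu>)" using gs unfolding \<mu>_def .
  have size: "size i = real (N i)" for i
    using sum_sample_eq[OF e, where f="\<lambda>_. 1 :: real" and i=i] unfolding size_def by simp
  have "L (score_deviation J F n N x y i) = dev T $ i" for i
  proof -
    have s0: "sqrt (real (N i)) > 0" using N by simp
    have "(\<Sum>j=1..N i. J (F (x i j))) = (\<Sum>l=1..n. of_bool (fst (e l) = i) *\<^sub>R J (F (x (fst (e l)) (snd (e l)))))"
      using sum_sample_eq[OF e, where f="\<lambda>p. J (F (x (fst p) (snd p)))" and i=i] by simp
    also have "\<dots> = (\<Sum>l=1..n. of_bool (fst (e l) = i) *\<^sub>R J (g (T l)))"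
      by (intro sum.cong refl) (simp add: T(2)[symmetric] y)
    finally have 1: "(\<Sum>j=1..N i. J (F (x i j))) = (\<Sum>l=1..n. of_bool (fst (e l) = i) *\<^sub>R J (g (T l)))" .
    have "(\<Sum>l=1..n. J (F (y l))) = (\<Sum>l=1..n. J (g (T l)))" by (intro sum.cong refl) (simp add: T(2))
    also have "\<dots> = (\<Sum>s=1..n. J (g s))" by (rule sum_permuted[OF T(1)])
    also have "\<dots> = real n *\<^sub>R \<mu>" using n by (simp add: \<mu>_def)
    finally have 2: "(\<Sum>l=1..n. J (F (y l))) = real n *\<^sub>R \<mu>" .
    have 3: "(\<Sum>l=1..n. of_bool (fst (e l) = i) *\<^sub>R (J (g (T l)) - \<mu>)) = (\<Sum>l=1..n. of_bool (fst (e l) = i) *\<^sub>R J (g (T l))) - real (N i) *\<^sub>R \<mu>"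
      unfolding scaleR_diff_right sum_subtractf scaleR_sum_left[symmetric] size[symmetric] size_def ..
    have "(1 / sqrt (real n)) *\<^sub>R (\<Sum>l=1..n. (sqrt (real (N i)) / sqrt (real n)) *\<^sub>R J (F (y l)))
        = (1 / sqrt (real n) * (sqrt (real (N i)) / sqrt (real n)) * real n) *\<^sub>R \<mu>"
      unfolding scaleR_sum_right[symmetric] 2 by simp
    also have "1 / sqrt (real n) * (sqrt (real (N i)) / sqrt (real n)) * real n = 1 / sqrt (real (N i)) * real (N i)"
    proof -
      have "1 / sqrt (real n) * (sqrt (real (N i)) / sqrt (real n)) * real n = sqrt (real (N i))" using n by simp
      also have "\<dots> = 1 / sqrt (real (N i)) * real (N i)" by (simp add: real_div_sqrt)
      finally show ?thesis .
    qed
    finally have 4: "(1 / sqrt (real n)) *\<^sub>R (\<Sum>l=1..n. (sqrt (real (N i)) / sqrt (real n)) *\<^sub>R J (F (y l)))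
        = (1 / sqrt (real (N i))) *\<^sub>R (real (N i) *\<^sub>R \<mu>)" by simp
    have "score_deviation J F n N x y i = (1 / sqrt (real (N i))) *\<^sub>R (\<Sum>l=1..n. of_bool (fst (e l) = i) *\<^sub>R (J (g (T l)) - \<mu>))"
      unfolding score_deviation_def 1 4 unfolding 3 by (simp only: scaleR_diff_right)
    then have "L (score_deviation J F n N x y i) = (1 / sqrt (real (N i))) *\<^sub>R (\<Sum>l=1..n. of_bool (fst (e l) = i) *\<^sub>R L (J (g (T l)) - \<mu>))"
      by (simp add: linear_scale[OF L(1)] linear_sum[OF L(1)])
    also have "\<dots> = dev T $ i"
      by (simp add: comb_sum_def kernel_def weight_def size sum_component scaleR_sum_right)
    finally show ?thesis .
  qed
  then show ?thesis
    unfolding rank_manova_statistic_eq[OF L(2)] Q_def \<mu>_def[symmetric]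
    by (simp add: power2_norm_eq_inner inner_vec_def)
qed

section \<open>Limits of grid averages\<close>

lemma discrete_uniform_integral:
  fixes f :: "real ^ 'd \<Rightarrow> real"
  assumes g: "g ` {1..n} \<subseteq> sphere 0 1" and f: "f \<in> borel_measurable sphere_borel"
  shows "(\<integral>u. f u \<partial>discrete_uniform n g) = (\<Sum>s=1..n. f (g s)) / real n"
proof -
  have "g \<in> uniform_count_measure {1..n} \<rightarrow>\<^sub>M sphere_borel"
    using g by (auto simp: measurable_def space_uniform_count_measure sets_uniform_count_measure)
  then show ?thesis
    unfolding discrete_uniform_def using f by (subst integral_distr) (auto simp: integral_uniform_count_measure)
qed

lemma grid_average_limit:
  fixes f :: "real ^ 'd \<Rightarrow> real"
  assumes g: "\<And>n. g n ` {1..n} \<subseteq> sphere 0 1"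
    and lim: "weakly_converges (\<lambda>n. discrete_uniform n (g n)) uniform_sphere"
    and f: "continuous_on (sphere 0 1) f"
  shows "(\<lambda>n. (\<Sum>s=1..n. f (g n s)) / real n) \<longlonglongrightarrow> (\<integral>u. f u \<partial>uniform_sphere)"
proof -
  have "bounded (f ` sphere 0 1)" by (intro compact_imp_bounded compact_continuous_image f compact_sphere)
  then have "(\<lambda>n. \<integral>u. f u \<partial>discrete_uniform n (g n)) \<longlonglongrightarrow> (\<integral>u. f u \<partial>uniform_sphere)"
    using lim f unfolding weakly_converges_def by simp
  then show ?thesis unfolding discrete_uniform_integral[OF g measurable_on_sphere[OF f]] .
qed

definition grid_covariance :: "nat \<Rightarrow> (nat \<Rightarrow> real ^ 'k) \<Rightarrow> real ^ 'k ^ 'k" where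
  "grid_covariance n v = (\<chi> a b. (\<Sum>s=1..n. (v s - (1 / real n) *\<^sub>R (\<Sum>s=1..n. v s)) $ a *
     (v s - (1 / real n) *\<^sub>R (\<Sum>s=1..n. v s)) $ b) / real n)"

lemma grid_covariance_form:
  "n > 0 \<Longrightarrow> (\<Sum>s=1..n. ((v s - (1 / real n) *\<^sub>R (\<Sum>s=1..n. v s)) \<bullet> z)\<^sup>2) = real n * (z \<bullet> (grid_covariance n v *v z))"
proof -
  assume n: "n > 0"
  define w where "w s = v s - (1 / real n) *\<^sub>R (\<Sum>s=1..n. v s)" for s
  have "real n * (z \<bullet> (grid_covariance n v *v z)) = (\<Sum>a\<in>UNIV. \<Sum>b\<in>UNIV. \<Sum>s=1..n. z $ a * z $ b * (w s $ a * w s $ b))"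
    using n unfolding inner_vec_def matrix_vector_mult_def grid_covariance_def w_def[symmetric]
    by (simp add: sum_distrib_left sum_distrib_right sum_divide_distrib mult_ac)
  also have "\<dots> = (\<Sum>a\<in>UNIV. \<Sum>s=1..n. \<Sum>b\<in>UNIV. z $ a * z $ b * (w s $ a * w s $ b))"
    by (intro sum.cong refl, rule sum.swap)
  also have "\<dots> = (\<Sum>s=1..n. \<Sum>a\<in>UNIV. \<Sum>b\<in>UNIV. z $ a * z $ b * (w s $ a * w s $ b))"
    by (rule sum.swap)
  also have "\<dots> = (\<Sum>s=1..n. (w s \<bullet> z)\<^sup>2)"
    by (intro sum.cong refl) (simp add: inner_vec_def power2_eq_square sum_product mult_ac)
  finally show ?thesis by (simp add: w_def)
qed

lemma integrable_on_sphere: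
  fixes f :: "real ^ 'd \<Rightarrow> real"
  assumes "continuous_on (sphere 0 1) f" shows "integrable uniform_sphere f"
proof -
  interpret U: prob_space "uniform_sphere :: (real ^ 'd) measure" by (rule prob_uniform_sphere)
  have "bounded (f ` sphere 0 1)" by (intro compact_imp_bounded compact_continuous_image assms compact_sphere)
  then obtain B where B: "\<And>u. u \<in> sphere 0 1 \<Longrightarrow> norm (f u) \<le> B" unfolding bounded_iff by blast
  show ?thesis
    by (rule U.integrable_const_bound[where B=B])
       (use B measurable_on_sphere[OF assms] in \<open>auto intro!: AE_I2 simp: measurable_cong_sets[OF sets_uniform_sphere refl]\<close>)
qed

lemma covariance_entry:
  fixes J :: "real ^ 'd \<Rightarrow> real ^ 'k"
  assumes J: "continuous_on (sphere 0 1) J"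
  shows "covariance_matrix uniform_sphere J $ a $ b =
    (\<integral>u. J u $ a * J u $ b \<partial>uniform_sphere) - (\<integral>u. J u $ a \<partial>uniform_sphere) * (\<integral>u. J u $ b \<partial>uniform_sphere)"
proof -
  interpret U: prob_space "uniform_sphere :: (real ^ 'd) measure" by (rule prob_uniform_sphere)
  let ?m = "\<lambda>a. \<integral>u. J u $ a \<partial>uniform_sphere"
  have i: "integrable uniform_sphere (\<lambda>u. J u $ a * J u $ b)" "integrable uniform_sphere (\<lambda>u. J u $ a)" "integrable uniform_sphere (\<lambda>u. J u $ b)"
    by (intro integrable_on_sphere continuous_intros J)+
  have "covariance_matrix uniform_sphere J $ a $ b =
      (\<integral>u. (J u $ a * J u $ b - ?m b * J u $ a) - (?m a * J u $ b - ?m a * ?m b) \<partial>uniform_sphere)"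
    unfolding covariance_matrix_def by (simp add: algebra_simps)
  also have "\<dots> = (\<integral>u. J u $ a * J u $ b \<partial>uniform_sphere) - ?m b * ?m a - (?m a * ?m b - ?m a * ?m b)"
    using i U.prob_space by simp
  finally show ?thesis by (simp add: mult_ac)
qed

lemma covariance_psd:
  fixes J :: "real ^ 'd \<Rightarrow> real ^ 'k"
  assumes J: "continuous_on (sphere 0 1) J"
  shows "0 \<le> x \<bullet> (covariance_matrix uniform_sphere J *v x)"
proof -
  define w where "w u a = J u $ a - (\<integral>v. J v $ a \<partial>uniform_sphere)" for u a
  have i: "integrable uniform_sphere (\<lambda>u. w u a * w u b)" for a b
    unfolding w_def by (intro integrable_on_sphere continuous_intros J)
  have "x \<bullet> (covariance_matrix uniform_sphere J *v x) = (\<Sum>a\<in>UNIV. \<Sum>b\<in>UNIV. \<integral>u. x $ a * x $ b * (w u a * w u b) \<partial>uniform_sphere)"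
    unfolding inner_vec_def matrix_vector_mult_def covariance_matrix_def w_def[symmetric]
    by (simp add: sum_distrib_left mult_ac)
  also have "\<dots> = (\<integral>u. (\<Sum>a\<in>UNIV. \<Sum>b\<in>UNIV. x $ a * x $ b * (w u a * w u b)) \<partial>uniform_sphere)"
    using i by simp
  also have "(\<lambda>u. \<Sum>a\<in>UNIV. \<Sum>b\<in>UNIV. x $ a * x $ b * (w u a * w u b)) = (\<lambda>u. (\<Sum>a\<in>UNIV. x $ a * w u a)\<^sup>2)"
    by (rule ext) (simp add: power2_eq_square sum_product mult_ac)
  finally show ?thesis by simp
qed

lemma covariance_symmetric: "transpose (covariance_matrix M J) = covariance_matrix M J"
  by (simp add: transpose_def covariance_matrix_def mult.commute)

lemma grid_covariance_limit:
  fixes J :: "real ^ 'd \<Rightarrow> real ^ 'k"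
  assumes g: "\<And>n. g n ` {1..n} \<subseteq> sphere 0 1"
    and lim: "weakly_converges (\<lambda>n. discrete_uniform n (g n)) uniform_sphere"
    and J: "continuous_on (sphere 0 1) J"
  shows "(\<lambda>n. grid_covariance n (\<lambda>s. J (g n s)) $ a $ b) \<longlonglongrightarrow> covariance_matrix uniform_sphere J $ a $ b"
proof -
  let ?S = "\<lambda>a n. (\<Sum>s=1..n. J (g n s) $ a) / real n"
  have lim1: "(\<lambda>n. (\<Sum>s=1..n. J (g n s) $ a * J (g n s) $ b) / real n - ?S a n * ?S b n) \<longlonglongrightarrow> covariance_matrix uniform_sphere J $ a $ b"
    unfolding covariance_entry[OF J]
    by (intro tendsto_diff tendsto_mult grid_average_limit[OF g lim] continuous_intros J)
  have eqn: "grid_covariance n (\<lambda>s. J (g n s)) $ a $ b = (\<Sum>s=1..n. J (g n s) $ a * J (g n s) $ b) / real n - ?S a n * ?S b n" if n: "n > 0" for n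
  proof -
    have p: "(J (g n s) - (1 / real n) *\<^sub>R (\<Sum>s=1..n. J (g n s))) $ c = J (g n s) $ c - ?S c n" for s c
      by (simp add: sum_component)
    have "(\<Sum>s=1..n. (J (g n s) $ a - ?S a n) * (J (g n s) $ b - ?S b n)) =
       (\<Sum>s=1..n. (J (g n s) $ a * J (g n s) $ b - ?S b n * J (g n s) $ a) - (?S a n * J (g n s) $ b - ?S a n * ?S b n))"
      by (intro sum.cong refl) (simp add: algebra_simps)
    also have "\<dots> = (\<Sum>s=1..n. J (g n s) $ a * J (g n s) $ b) - ?S b n * (\<Sum>s=1..n. J (g n s) $ a)
       - (?S a n * (\<Sum>s=1..n. J (g n s) $ b) - real n * (?S a n * ?S b n))"
      by (simp only: sum_subtractf sum_distrib_left sum_constant) simp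
    also have "\<dots> = (\<Sum>s=1..n. J (g n s) $ a * J (g n s) $ b) - real n * (?S a n * ?S b n)"
      using n by (simp add: field_simps)
    finally show ?thesis unfolding grid_covariance_def vec_lambda_beta p using n by (simp add: diff_divide_distrib)
  qed
  show ?thesis
    by (rule Lim_transform_eventually[OF lim1 eventually_sequentiallyI[of 1]]) (rule eqn[symmetric], simp)
qed

section \<open>Asymptotics of the rank-based statistic\<close>

text \<open>
  Weak convergence of the grids gives convergence of the grid covariance, which \<open>\<epsilon>\<close> measures in a
  whitened scale.
\<close>
lemma whitened_scores_bounded:
  fixes J :: "real ^ 'd \<Rightarrow> real ^ 'k" and N :: "nat \<Rightarrow> 'm::finite \<Rightarrow> nat"
  assumes total: "\<And>n. (\<Sum>i\<in>UNIV. N n i) = n"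
    and r: "\<And>i. 0 < r i" "\<And>i. (\<lambda>n. real (N n i) / real n) \<longlonglongrightarrow> r i"
    and e: "\<And>n. bij_betw (e n) {1..n} (SIGMA i:UNIV. {1..N n i})"
    and g: "\<And>n. g n ` {1..n} \<subseteq> sphere 0 1"
    and lim: "weakly_converges (\<lambda>n. discrete_uniform n (g n)) uniform_sphere"
    and J: "continuous_on (sphere 0 1) J"
    and L: "linear L" "linear Lt" "\<And>x y. L x \<bullet> y = x \<bullet> Lt y"
      "\<And>y. y \<in> range L \<Longrightarrow> Lt y \<bullet> (covariance_matrix uniform_sphere J *v Lt y) = (norm y)\<^sup>2"
      "(\<Sum>b\<in>Basis. Lt b \<bullet> (covariance_matrix uniform_sphere J *v Lt b)) = real K"
  defines "\<alpha> \<equiv> \<lambda>n s. L (J (g n s) - (1 / real n) *\<^sub>R (\<Sum>s=1..n. J (g n s)))"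
  obtains C \<rho> \<epsilon> where "\<forall>\<^sub>F n in sequentially. bounded_scores n (\<lambda>l. fst (e n l)) (\<alpha> n) C \<rho> (\<epsilon> n) \<and> (\<forall>i. N n i > 0) \<and> n > 0"
    "\<epsilon> \<longlonglongrightarrow> 0" "\<And>n. \<epsilon> n \<ge> 0" "(\<lambda>n. (\<Sum>s=1..n. (norm (\<alpha> n s))\<^sup>2) / real n) \<longlonglongrightarrow> real K"
proof -
  let ?D = "covariance_matrix uniform_sphere J"
  define V where "V n = grid_covariance n (\<lambda>s. J (g n s))" for n
  have V: "(\<lambda>n. V n $ a $ b) \<longlonglongrightarrow> ?D $ a $ b" for a b
    unfolding V_def by (rule grid_covariance_limit[OF g lim J])
  have inner_\<alpha>: "\<alpha> n s \<bullet> z = (J (g n s) - (1 / real n) *\<^sub>R (\<Sum>s=1..n. J (g n s))) \<bullet> Lt z" for n s z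
    unfolding \<alpha>_def by (rule L(3))
  have form: "(\<Sum>s=1..n. (\<alpha> n s \<bullet> z)\<^sup>2) = real n * (Lt z \<bullet> (V n *v Lt z))" if "n > 0" for n z
    unfolding inner_\<alpha> V_def by (rule grid_covariance_form[OF that])
  have quad: "z \<bullet> (A *v z) = (\<Sum>a\<in>UNIV. \<Sum>b\<in>UNIV. z $ a * z $ b * A $ a $ b)" for z :: "real ^ 'k" and A :: "real ^ 'k ^ 'k"
    by (simp add: inner_vec_def matrix_vector_mult_def sum_distrib_left mult_ac)
  obtain BJ where BJ: "\<And>u. u \<in> sphere 0 1 \<Longrightarrow> norm (J u) \<le> BJ"
    using compact_imp_bounded[OF compact_continuous_image[OF J compact_sphere]] unfolding bounded_iff by blast
  obtain BL where BL: "BL > 0" "\<And>x. norm (L x) \<le> BL * norm x" using linear_bounded_pos[OF L(1)] by blast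
  obtain BT where BT: "BT > 0" "\<And>x. norm (Lt x) \<le> BT * norm x" using linear_bounded_pos[OF L(2)] by blast
  define C where "C = BL * (2 * \<bar>BJ\<bar>) + 1"
  define \<rho> where "\<rho> = Min (range r) / 2"
  have \<rho>: "\<rho> > 0" "2 * \<rho> \<le> r i" for i using r(1) by (auto simp: \<rho>_def)
  define \<epsilon> where "\<epsilon> n = BT\<^sup>2 * (\<Sum>a\<in>UNIV. \<Sum>b\<in>UNIV. \<bar>V n $ a $ b - ?D $ a $ b\<bar>)" for n
  have \<epsilon>lim: "\<epsilon> \<longlonglongrightarrow> 0"
  proof -
    have "\<epsilon> \<longlonglongrightarrow> BT\<^sup>2 * (\<Sum>a\<in>(UNIV::'k set). \<Sum>b\<in>(UNIV::'k set). \<bar>?D $ a $ b - ?D $ a $ b\<bar>)"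
      unfolding \<epsilon>_def by (intro tendsto_intros V)
    then show ?thesis by simp
  qed
  have \<epsilon>0: "\<epsilon> n \<ge> 0" for n by (simp add: \<epsilon>_def sum_nonneg)
  have ms: "(\<lambda>n. (\<Sum>s=1..n. (norm (\<alpha> n s))\<^sup>2) / real n) \<longlonglongrightarrow> real K"
  proof (rule Lim_transform_eventually[OF _ eventually_sequentiallyI[of 1]])
    show "(\<lambda>n. \<Sum>b\<in>Basis. Lt b \<bullet> (V n *v Lt b)) \<longlonglongrightarrow> real K"
      unfolding L(5)[symmetric] quad by (intro tendsto_intros V)
    fix n :: nat assume n: "1 \<le> n"
    have "(\<Sum>s=1..n. (norm (\<alpha> n s))\<^sup>2) = (\<Sum>s=1..n. \<Sum>b\<in>Basis. (\<alpha> n s \<bullet> b)\<^sup>2)"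
    proof (intro sum.cong refl)
      fix s show "(norm (\<alpha> n s))\<^sup>2 = (\<Sum>b\<in>Basis. (\<alpha> n s \<bullet> b)\<^sup>2)"
        unfolding power2_norm_eq_inner by (subst euclidean_inner) (simp add: power2_eq_square)
    qed
    also have "\<dots> = (\<Sum>b\<in>Basis. real n * (Lt b \<bullet> (V n *v Lt b)))"
      using n by (subst sum.swap) (simp add: form)
    finally show "(\<Sum>b\<in>Basis. Lt b \<bullet> (V n *v Lt b)) = (\<Sum>s=1..n. (norm (\<alpha> n s))\<^sup>2) / real n"
      using n by (simp add: sum_distrib_left[symmetric])
  qed
  have evN: "\<forall>\<^sub>F n in sequentially. \<forall>i. real (N n i) / real n > \<rho>"
  proof (rule eventually_all_finite)
    fix i
    have "\<rho> < r i" using \<rho>(1) \<rho>(2)[of i] by linarith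
    then show "\<forall>\<^sub>F n in sequentially. real (N n i) / real n > \<rho>" using order_tendstoD(1)[OF r(2)] by blast
  qed
  have "\<forall>\<^sub>F n in sequentially. bounded_scores n (\<lambda>l. fst (e n l)) (\<alpha> n) C \<rho> (\<epsilon> n) \<and> (\<forall>i. N n i > 0) \<and> n > 0"
    using evN eventually_gt_at_top[of 0]
  proof eventually_elim
    case (elim n)
    then have n: "n > 0" "real n > 0" by auto
    have Nbig: "real (N n i) > \<rho> * real n" for i using elim(1)[rule_format, of i] n by (simp add: field_simps)
    have Npos: "N n i > 0" for i
    proof -
      have "\<rho> * real n > 0" using \<rho>(1) n by simp
      then show ?thesis using Nbig[of i] by linarith
    qed
    let ?\<mu> = "(1 / real n) *\<^sub>R (\<Sum>s=1..n. J (g n s))"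
    interpret grouped_scores n "\<lambda>l. fst (e n l)" "\<alpha> n"
    proof
      show "n > 0" by (rule n)
      have "(\<Sum>s=1..n. J (g n s) - ?\<mu>) = 0"
        unfolding sum_subtractf sum_constant_scaleR using n by simp
      then show "(\<Sum>s=1..n. \<alpha> n s) = 0"
        unfolding \<alpha>_def linear_sum[OF L(1), symmetric] by (simp add: linear_0[OF L(1)])
      fix i
      have "(i, 1) \<in> e n ` {1..n}" using bij_betw_imp_surj_on[OF e, of n] Npos[of i] by (auto simp: Suc_le_eq One_nat_def)
      then obtain l where "(i, 1) = e n l" "l \<in> {1..n}" by (rule imageE)
      then show "\<exists>l\<in>{1..n}. fst (e n l) = i" by (metis fst_conv)
    qed
    have size: "size i = real (N n i)" for i
      using sum_sample_eq[OF e, where f="\<lambda>_. 1 :: real" and i=i and n=n] unfolding size_def by simp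
    have "bounded_scores n (\<lambda>l. fst (e n l)) (\<alpha> n) C \<rho> (\<epsilon> n)"
    proof
      show "C > 0" using BL(1) by (simp add: C_def add_nonneg_pos)
      show "\<rho> > 0" by (rule \<rho>)
      show "\<rho> * real n \<le> size i" for i unfolding size using Nbig[of i] by simp
      fix s assume s: "s \<in> {1..n}"
      have Jb: "norm (J (g n s)) \<le> \<bar>BJ\<bar>" if "s \<in> {1..n}" for s
        using BJ[of "g n s"] g[of n] that by (auto simp: image_subset_iff)
      have "norm (\<Sum>s=1..n. J (g n s)) \<le> (\<Sum>s=1..n. \<bar>BJ\<bar>)" by (rule sum_norm_le) (rule Jb)
      then have "norm ?\<mu> \<le> \<bar>BJ\<bar>" using n by (simp add: field_simps)
      then have "norm (J (g n s) - ?\<mu>) \<le> 2 * \<bar>BJ\<bar>"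
        using Jb[OF s] norm_triangle_ineq4[of "J (g n s)" ?\<mu>] by linarith
      then have "BL * norm (J (g n s) - ?\<mu>) \<le> BL * (2 * \<bar>BJ\<bar>)" using BL(1) by (intro mult_left_mono) auto
      then show "norm (\<alpha> n s) \<le> C"
        unfolding C_def \<alpha>_def using BL(2)[of "J (g n s) - ?\<mu>"] by linarith
    next
      fix x assume x: "x \<in> span (\<alpha> n ` {1..n})"
      have "span (\<alpha> n ` {1..n}) \<subseteq> range L"
        by (rule span_minimal) (auto simp: \<alpha>_def intro!: linear_subspace_image[OF L(1)])
      then have nx: "Lt x \<bullet> (?D *v Lt x) = (norm x)\<^sup>2" using L(4) x by blast
      let ?z = "Lt x"
      have "(\<Sum>s=1..n. (\<alpha> n s \<bullet> x)\<^sup>2) - real n * (norm x)\<^sup>2 =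
          real n * (\<Sum>a\<in>UNIV. \<Sum>b\<in>UNIV. ?z $ a * ?z $ b * (V n $ a $ b - ?D $ a $ b))"
        unfolding form[OF n(1)] nx[symmetric] quad by (simp add: right_diff_distrib sum_subtractf)
      moreover have "\<bar>\<Sum>a\<in>UNIV. \<Sum>b\<in>UNIV. ?z $ a * ?z $ b * (V n $ a $ b - ?D $ a $ b)\<bar> \<le> \<epsilon> n * (norm x)\<^sup>2"
      proof -
        have "\<bar>\<Sum>a\<in>UNIV. \<Sum>b\<in>UNIV. ?z $ a * ?z $ b * (V n $ a $ b - ?D $ a $ b)\<bar> \<le>
            (\<Sum>a\<in>UNIV. \<Sum>b\<in>UNIV. \<bar>?z $ a * ?z $ b * (V n $ a $ b - ?D $ a $ b)\<bar>)"
          by (rule order_trans[OF sum_abs], rule sum_mono, rule sum_abs)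
        also have "\<dots> \<le> (\<Sum>a\<in>UNIV. \<Sum>b\<in>UNIV. (norm ?z)\<^sup>2 * \<bar>V n $ a $ b - ?D $ a $ b\<bar>)"
          unfolding abs_mult power2_eq_square
          by (intro sum_mono mult_right_mono mult_mono component_le_norm_cart) auto
        also have "\<dots> = (norm ?z)\<^sup>2 * (\<Sum>a\<in>UNIV. \<Sum>b\<in>UNIV. \<bar>V n $ a $ b - ?D $ a $ b\<bar>)"
          by (simp only: sum_distrib_left)
        also have "\<dots> \<le> (BT * norm x)\<^sup>2 * (\<Sum>a\<in>UNIV. \<Sum>b\<in>UNIV. \<bar>V n $ a $ b - ?D $ a $ b\<bar>)"
          using BT by (intro mult_right_mono power_mono sum_nonneg) auto
        finally show ?thesis by (simp add: \<epsilon>_def power_mult_distrib mult_ac)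
      qed
      ultimately show "\<bar>(\<Sum>s=1..n. (\<alpha> n s \<bullet> x)\<^sup>2) - real n * (norm x)\<^sup>2\<bar> \<le> real n * \<epsilon> n * (norm x)\<^sup>2"
        using n by (simp add: abs_mult mult.assoc mult_left_mono)
    qed
    then show ?case using Npos n by blast
  qed
  then show ?thesis using that \<epsilon>lim \<epsilon>0 ms by blast
qed

theorem proposition7:
  fixes M :: "nat \<Rightarrow> 'w measure"
    and N :: "nat \<Rightarrow> 'm::finite \<Rightarrow> nat"
    and r :: "'m \<Rightarrow> real"
    and P :: "'m \<Rightarrow> (real ^ 'd) measure"
    and F :: "'m \<Rightarrow> real ^ 'd \<Rightarrow> real ^ 'd"
    and X :: "nat \<Rightarrow> 'm \<Rightarrow> nat \<Rightarrow> 'w \<Rightarrow> real ^ 'd"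
    and e :: "nat \<Rightarrow> nat \<Rightarrow> 'm \<times> nat"
    and Y :: "nat \<Rightarrow> nat \<Rightarrow> 'w \<Rightarrow> real ^ 'd"
    and g :: "nat \<Rightarrow> nat \<Rightarrow> real ^ 'd"
    and F_emp :: "nat \<Rightarrow> 'w \<Rightarrow> real ^ 'd \<Rightarrow> real ^ 'd"
    and J :: "real ^ 'd \<Rightarrow> real ^ 'k"
  assumes dim: "CARD('d) \<ge> 2"
    and groups: "CARD('m) \<ge> 2"
    (* sample sizes *)
    and total_size: "\<And>n. (\<Sum>i\<in>UNIV. N n i) = n"
    and ratio_bounds: "\<And>i. 0 < r i \<and> r i < 1"
    and ratio_limit: "\<And>i. (\<lambda>n. real (N n i) / real n) \<longlonglongrightarrow> r i"
    (* the samples *)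
    and prob: "\<And>n. prob_space (M n)"
    and P_class: "\<And>i. P i \<in> bounded_density_class"
    and F_df: "\<And>i. directional_df (P i) (F i)"
    and indep: "\<And>n. prob_space.indep_vars (M n) (\<lambda>_. sphere_borel)
                       (\<lambda>(i, j). X n i j) (SIGMA i:UNIV. {1..N n i})"
    and law: "\<And>n i j. j \<in> {1..N n i} \<Longrightarrow> distr (M n) sphere_borel (X n i j) = P i"
    (* an arbitrary enumeration of the pooled sample *)
    and enum: "\<And>n. bij_betw (e n) {1..n} (SIGMA i:UNIV. {1..N n i})"
    and pooled: "\<And>n l \<omega>. l \<in> {1..n} \<Longrightarrow> Y n l \<omega> = X n (fst (e n l)) (snd (e n l)) \<omega>"
    (* grids *)
    and grid_sphere: "\<And>n. g n ` {1..n} \<subseteq> sphere 0 1"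
    and grid_distinct: "\<And>n. inj_on (g n) {1..n}"
    and grid_limit: "weakly_converges (\<lambda>n. discrete_uniform n (g n)) uniform_sphere"
    (* empirical directional distribution function of the pooled sample, which is
       almost surely free of ties *)
    and F_emp_df: "\<And>n. AE \<omega> in M n. empirical_directional_df n (g n) (\<lambda>l. Y n l \<omega>) (F_emp n \<omega>)"
    and F_emp_measurable: "\<And>n l. l \<in> {1..n} \<Longrightarrow>
           (\<lambda>\<omega>. F_emp n \<omega> (Y n l \<omega>)) \<in> M n \<rightarrow>\<^sub>M sphere_borel"
    (* (i), (ii), (iii) *)
    and J_continuous: "continuous_on (sphere 0 1) J"
    and J_square_integrable: "integrable uniform_sphere (\<lambda>u. (norm (J u))\<^sup>2)"
    and J_grid: "\<And>G :: nat \<Rightarrow> nat \<Rightarrow> real ^ 'd.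
           (\<And>n. G n ` {1..n} \<subseteq> sphere 0 1) \<Longrightarrow>
           weakly_converges (\<lambda>n. discrete_uniform n (G n)) uniform_sphere \<Longrightarrow>
           (\<lambda>n. (\<Sum>l=1..n. (norm (J (G n l)))\<^sup>2) / real n)
             \<longlonglongrightarrow> (\<integral>u. (norm (J u))\<^sup>2 \<partial>uniform_sphere)"
    (* null hypothesis *)
    and H0: "\<And>i i' z. z \<in> sphere 0 1 \<Longrightarrow> F i z = F i' z"
  shows "weak_conv_m
    (\<lambda>n. distr (M n) borel
       (\<lambda>\<omega>. rank_manova_statistic J (F_emp n \<omega>) n (N n) (\<lambda>i j. X n i j \<omega>) (\<lambda>l. Y n l \<omega>)))
    (chi_square ((CARD('m) - 1) * rank (covariance_matrix uniform_sphere J)))"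
proof -
  let ?D = "covariance_matrix uniform_sphere J"
  have "\<exists>L Lt :: real ^ 'k \<Rightarrow> real ^ 'k. linear L \<and> linear Lt \<and> (\<forall>x y. L x \<bullet> y = x \<bullet> Lt y) \<and>
    (\<forall>x. x \<bullet> (moore_penrose_inverse ?D *v x) = (norm (L x))\<^sup>2) \<and>
    (\<forall>y. y \<in> range L \<longrightarrow> Lt y \<bullet> (?D *v Lt y) = (norm y)\<^sup>2) \<and>
    (\<Sum>b\<in>Basis. Lt b \<bullet> (?D *v Lt b)) = real (rank ?D)"
    by (rule whitening[OF covariance_symmetric[of uniform_sphere J] covariance_psd[OF J_continuous]]) blast
  then obtain L Lt :: "real ^ 'k \<Rightarrow> real ^ 'k" where L: "linear L" "linear Lt" "\<And>x y. L x \<bullet> y = x \<bullet> Lt y"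
    "\<And>x. x \<bullet> (moore_penrose_inverse ?D *v x) = (norm (L x))\<^sup>2"
    "\<And>y. y \<in> range L \<Longrightarrow> Lt y \<bullet> (?D *v Lt y) = (norm y)\<^sup>2"
    "(\<Sum>b\<in>Basis. Lt b \<bullet> (?D *v Lt b)) = real (rank ?D)"
    by blast
  define \<alpha> where "\<alpha> = (\<lambda>n s. L (J (g n s) - (1 / real n) *\<^sub>R (\<Sum>s=1..n. J (g n s))))"
  define Q where "Q n T = grouped_scores.Q n (\<lambda>l. fst (e n l)) (\<alpha> n) T" for n T
  define stat where "stat n \<omega> = rank_manova_statistic J (F_emp n \<omega>) n (N n) (\<lambda>i j. X n i j \<omega>) (\<lambda>l. Y n l \<omega>)" for n \<omega>
  obtain C \<rho> \<epsilon> where bounded: "\<forall>\<^sub>F n in sequentially. bounded_scores n (\<lambda>l. fst (e n l)) (\<lambda>s. L (J (g n s) - (1 / real n) *\<^sub>R (\<Sum>s=1..n. J (g n s)))) C \<rho> (\<epsilon> n) \<and> (\<forall>i. N n i > 0) \<and> n > 0"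
    "\<epsilon> \<longlonglongrightarrow> 0" "\<And>n. \<epsilon> n \<ge> 0"
    "(\<lambda>n. (\<Sum>s=1..n. (norm (L (J (g n s) - (1 / real n) *\<^sub>R (\<Sum>s=1..n. J (g n s)))))\<^sup>2) / real n) \<longlonglongrightarrow> real (rank ?D)"
  proof (rule whitened_scores_bounded[OF total_size conjunct1[OF ratio_bounds] ratio_limit enum grid_sphere grid_limit J_continuous L(1,2,3,5,6)])
    fix y assume "y \<in> range L" then show "y \<in> range L" .
  next
    fix C \<rho> \<epsilon>
    assume "\<forall>\<^sub>F n in sequentially. bounded_scores n (\<lambda>l. fst (e n l)) (\<lambda>s. L (J (g n s) - (1 / real n) *\<^sub>R (\<Sum>s=1..n. J (g n s)))) C \<rho> (\<epsilon> n) \<and> (\<forall>i. N n i > 0) \<and> n > 0"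
      "\<epsilon> \<longlonglongrightarrow> 0" "\<And>n. \<epsilon> n \<ge> 0"
      "(\<lambda>n. (\<Sum>s=1..n. (norm (L (J (g n s) - (1 / real n) *\<^sub>R (\<Sum>s=1..n. J (g n s)))))\<^sup>2) / real n) \<longlonglongrightarrow> real (rank ?D)"
    then show thesis by (rule that)
  qed
  have sc: "\<forall>\<^sub>F n in sequentially. bounded_scores n (\<lambda>l. fst (e n l)) (\<alpha> n) C \<rho> (\<epsilon> n) \<and> (\<forall>i. N n i > 0) \<and> n > 0"
    "\<epsilon> \<longlonglongrightarrow> 0" "\<And>n. \<epsilon> n \<ge> 0"
    "(\<lambda>n. (\<Sum>s=1..n. (norm (\<alpha> n s))\<^sup>2) / real n) \<longlonglongrightarrow> real (rank ?D)"
    unfolding \<alpha>_def by (rule bounded)+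
  obtain i0 :: 'm where True by blast
  have P_eq: "P i = P i0" for i
    by (rule same_df_imp_same_law[OF dim P_class P_class F_df F_df H0])
  have e_in: "e n l \<in> (SIGMA i:UNIV. {1..N n i})" if "l \<in> {1..n}" for n l
    using bij_betwE[OF enum] that by blast
  have stat_eq: "stat n \<omega> = (\<Sum>i\<in>UNIV. (norm (L (score_deviation J (F_emp n \<omega>) n (N n) (\<lambda>i j. X n i j \<omega>) (\<lambda>l. Y n l \<omega>) i)))\<^sup>2)" for n \<omega>
    unfolding stat_def by (rule rank_manova_statistic_eq[OF L(4)])
  have stat_nonneg: "0 \<le> stat n \<omega>" for n \<omega> unfolding stat_eq by (simp add: sum_nonneg)
  have stat_measurable: "stat n \<in> borel_measurable (M n)" for n
  proof -
    have JF: "(\<lambda>\<omega>. J (F_emp n \<omega> (Y n l \<omega>))) \<in> borel_measurable (M n)" if "l \<in> {1..n}" for l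
      by (rule measurable_compose[OF F_emp_measurable[OF that] measurable_on_sphere[OF J_continuous]])
    have JX: "(\<lambda>\<omega>. J (F_emp n \<omega> (X n i j \<omega>))) \<in> borel_measurable (M n)" if j: "j \<in> {1..N n i}" for i j
    proof -
      have "(i, j) \<in> e n ` {1..n}" using bij_betw_imp_surj_on[OF enum, of n] j by auto
      then obtain l where l: "l \<in> {1..n}" "e n l = (i, j)" by (metis imageE)
      then have "X n i j = Y n l" using pooled by auto
      then show ?thesis using JF[OF l(1)] by simp
    qed
    have "(\<lambda>\<omega>. score_deviation J (F_emp n \<omega>) n (N n) (\<lambda>i j. X n i j \<omega>) (\<lambda>l. Y n l \<omega>) i) \<in> borel_measurable (M n)" for i
      unfolding score_deviation_def
      by (intro borel_measurable_diff borel_measurable_scaleR borel_measurable_const borel_measurable_sum JF JX)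
    then have "(\<lambda>\<omega>. L (score_deviation J (F_emp n \<omega>) n (N n) (\<lambda>i j. X n i j \<omega>) (\<lambda>l. Y n l \<omega>) i)) \<in> borel_measurable (M n)" for i
      by (rule measurable_compose) (intro borel_measurable_continuous_onI linear_continuous_on L(1)[unfolded linear_conv_bounded_linear])
    then have "(\<lambda>\<omega>. norm (L (score_deviation J (F_emp n \<omega>) n (N n) (\<lambda>i j. X n i j \<omega>) (\<lambda>l. Y n l \<omega>) i))) \<in> borel_measurable (M n)" for i
      by (rule measurable_compose) (rule borel_measurable_continuous_onI[OF continuous_on_norm_id])
    then show ?thesis unfolding stat_eq by (intro borel_measurable_sum borel_measurable_power)
  qed
  have mean: "(\<integral>\<omega>. exp (- s * stat n \<omega>) \<partial>M n) = perm_mean n (\<lambda>T. exp (- s * Q n T))"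
    if n: "n > 0" "\<And>i. N n i > 0" and gs: "grouped_scores n (\<lambda>l. fst (e n l)) (\<alpha> n)" for n and s :: real
  proof -
    interpret I: iid_sphere_sample "P i0" n "g n"
      by unfold_locales (fact dim, fact P_class, fact grid_sphere, fact grid_distinct)
    interpret Mn: prob_space "M n" by (rule prob)
    let ?I = "SIGMA i:UNIV. {1..N n i}"
    let ?X = "\<lambda>p \<omega>. X n (fst p) (snd p) \<omega>"
    have iv: "Mn.indep_vars (\<lambda>_. sphere_borel) ?X ?I" using indep[of n] by (simp add: case_prod_unfold)
    have rv: "?X p \<in> M n \<rightarrow>\<^sub>M sphere_borel" if "p \<in> ?I" for p using iv that unfolding Mn.indep_vars_def by blast
    have lw: "distr (M n) sphere_borel (?X p) = P i0" if "p \<in> ?I" for p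
      using law[of "snd p" n "fst p"] that P_eq[of "fst p"] by (auto simp: split_beta')
    have "?I \<noteq> {}" using e_in[of 1 n] n by auto
    have dX: "distr (M n) (\<Pi>\<^sub>M p\<in>?I. sphere_borel) (\<lambda>\<omega>. \<lambda>p\<in>?I. ?X p \<omega>) = (\<Pi>\<^sub>M p\<in>?I. P i0)"
    proof -
      have "distr (M n) (\<Pi>\<^sub>M p\<in>?I. sphere_borel) (\<lambda>\<omega>. \<lambda>p\<in>?I. ?X p \<omega>) = (\<Pi>\<^sub>M p\<in>?I. distr (M n) sphere_borel (?X p))"
        by (rule iffD1[OF Mn.indep_vars_iff_distr_eq_PiM'[where M' = "\<lambda>_. sphere_borel" and X = ?X and I = ?I, OF \<open>?I \<noteq> {}\<close> rv] iv])
      also have "\<dots> = (\<Pi>\<^sub>M p\<in>?I. P i0)" by (rule PiM_cong[OF refl lw])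
      finally show ?thesis .
    qed
    have sets_eq: "sets (\<Pi>\<^sub>M p\<in>?I. sphere_borel) = sets (\<Pi>\<^sub>M p\<in>?I. P i0)"
      by (rule sets_PiM_cong) (simp_all add: I.sets_P)
    have Xm: "(\<lambda>\<omega>. \<lambda>p\<in>?I. ?X p \<omega>) \<in> M n \<rightarrow>\<^sub>M (\<Pi>\<^sub>M p\<in>?I. P i0)"
      unfolding measurable_cong_sets[OF refl sets_eq[symmetric]] by (rule measurable_restrict) (rule rv)
    let ?R = "\<lambda>x. \<lambda>l\<in>{1..n}. x (e n l)"
    have Rm: "?R \<in> (\<Pi>\<^sub>M p\<in>?I. P i0) \<rightarrow>\<^sub>M (\<Pi>\<^sub>M l\<in>{1..n}. P i0)"
      by (intro measurable_restrict measurable_component_singleton e_in)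
    have YR: "(\<lambda>\<omega>. \<lambda>l\<in>{1..n}. Y n l \<omega>) = (\<lambda>\<omega>. ?R (\<lambda>p\<in>?I. ?X p \<omega>))"
      by (intro ext) (auto simp: pooled e_in restrict_def)
    have Ym: "(\<lambda>\<omega>. \<lambda>l\<in>{1..n}. Y n l \<omega>) \<in> M n \<rightarrow>\<^sub>M (\<Pi>\<^sub>M l\<in>{1..n}. P i0)"
      unfolding YR by (rule measurable_compose[OF Xm Rm])
    have "distr (M n) (\<Pi>\<^sub>M l\<in>{1..n}. P i0) (\<lambda>\<omega>. \<lambda>l\<in>{1..n}. Y n l \<omega>) =
        distr (distr (M n) (\<Pi>\<^sub>M p\<in>?I. P i0) (\<lambda>\<omega>. \<lambda>p\<in>?I. ?X p \<omega>)) (\<Pi>\<^sub>M l\<in>{1..n}. P i0) ?R"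
      unfolding YR using distr_distr[OF Rm Xm] by (simp add: o_def)
    also have "distr (M n) (\<Pi>\<^sub>M p\<in>?I. P i0) (\<lambda>\<omega>. \<lambda>p\<in>?I. ?X p \<omega>) = (\<Pi>\<^sub>M p\<in>?I. P i0)"
      unfolding dX[symmetric] by (rule distr_cong) (simp_all add: sets_eq dX)
    also have "distr (\<Pi>\<^sub>M p\<in>?I. P i0) (\<Pi>\<^sub>M l\<in>{1..n}. P i0) ?R = (\<Pi>\<^sub>M l\<in>{1..n}. P i0)"
      by (rule distr_PiM_reindex) (use I.prob_P enum[of n] e_in in \<open>auto simp: bij_betw_def\<close>)
    finally have Ylaw: "distr (M n) (\<Pi>\<^sub>M l\<in>{1..n}. P i0) (\<lambda>\<omega>. \<lambda>l\<in>{1..n}. Y n l \<omega>) = (\<Pi>\<^sub>M l\<in>{1..n}. P i0)" .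
    show ?thesis
    proof (rule I.expectation_of_ranks[OF Ym Ylaw prob F_emp_df])
      show "(\<lambda>\<omega>. exp (- s * stat n \<omega>)) \<in> borel_measurable (M n)" using stat_measurable[of n] by measurable
      fix \<omega> T assume T: "T permutes {1..n}" "\<And>l. l \<in> {1..n} \<Longrightarrow> F_emp n \<omega> (Y n l \<omega>) = g n (T l)"
      have "stat n \<omega> = Q n T"
        unfolding stat_def Q_def \<alpha>_def
        by (rule statistic_eq_permutation[OF enum n(2,1) pooled T L(1,4) gs[unfolded \<alpha>_def]])
      then show "exp (- s * stat n \<omega>) = exp (- s * Q n T)" by simp
    qed
  qed
  have lap: "(\<lambda>n. \<integral>\<omega>. exp (- real j * stat n \<omega>) \<partial>M n) \<longlonglongrightarrow> (1 + 2 * real j) powr (- ((real CARD('m) - 1) * real (rank ?D)) / 2)"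
    if j: "j > 0" for j :: nat
  proof (rule Lim_transform_eventually)
    show "(\<lambda>n. perm_mean n (\<lambda>T. exp (- real j * Q n T))) \<longlonglongrightarrow> (1 + 2 * real j) powr (- ((real CARD('m) - 1) * real (rank ?D)) / 2)"
      unfolding Q_def
      by (rule permutation_laplace_limit[OF _ sc(2,3,4)]) (use sc(1) j in \<open>auto elim: eventually_mono\<close>)
    show "\<forall>\<^sub>F n in sequentially. perm_mean n (\<lambda>T. exp (- real j * Q n T)) = (\<integral>\<omega>. exp (- real j * stat n \<omega>) \<partial>M n)"
      using sc(1)
    proof eventually_elim
      case (elim n)
      then have "grouped_scores n (\<lambda>l. fst (e n l)) (\<alpha> n)" by (blast intro: bounded_scores.axioms(1))
      then show ?case using elim by (intro mean[symmetric]) auto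
    qed
  qed
  have "weak_conv_m (\<lambda>n. distr (M n) borel (stat n)) (chi_square ((CARD('m) - 1) * rank ?D))"
  proof (rule laplace_imp_weak_conv)
    show "real_distribution (distr (M n) borel (stat n))" for n
      by (rule prob_space.real_distribution_distr[OF prob stat_measurable])
    show "AE x in distr (M n) borel (stat n). 0 \<le> x" for n
      by (subst AE_distr_iff[OF stat_measurable]) (auto simp: stat_nonneg)
    show "real_distribution (chi_square ((CARD('m) - 1) * rank ?D))" by (rule real_distribution_chi_square)
    show "AE x in chi_square ((CARD('m) - 1) * rank ?D). 0 \<le> x" by (rule AE_chi_square_nonneg)
    fix j :: nat assume j: "j > 0"
    have m: "real ((CARD('m) - 1) * rank ?D) = (real CARD('m) - 1) * real (rank ?D)"
      using groups by (simp add: of_nat_diff)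
    have "(\<integral>x. exp (- real j * x) \<partial>chi_square ((CARD('m) - 1) * rank ?D)) =
        (1 + 2 * real j) powr (- ((real CARD('m) - 1) * real (rank ?D)) / 2)"
      using chi_square_laplace[of "real j" "(CARD('m) - 1) * rank ?D"] j unfolding m by simp
    moreover have "(\<integral>x. exp (- real j * x) \<partial>distr (M n) borel (stat n)) = (\<integral>\<omega>. exp (- real j * stat n \<omega>) \<partial>M n)" for n
      by (rule integral_distr[OF stat_measurable]) simp
    ultimately show "(\<lambda>n. \<integral>x. exp (- real j * x) \<partial>distr (M n) borel (stat n)) \<longlonglongrightarrow>
        (\<integral>x. exp (- real j * x) \<partial>chi_square ((CARD('m) - 1) * rank ?D))"
      using lap[OF j] by simp
  qed
  then show ?thesis unfolding stat_def[abs_def] .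
qed

end
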